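(* Let Assumptions 1 and 2 and the feasibility assumption (all stated in the context) hold. Let $c>1$, $\tau_t=1/c^{t}$, $\Psi_t=\sum_{k=1}^t\tau_k$, let $\kappa\in(0,1)$ be a constant, and let $\{x_{i,t}\}$ be the sequences generated by Algorithm 1 (described in the context) with event-triggering thresholds $\tau_t$ and $$\alpha_t=\sqrt{\frac{\Psi_t}{t}},\quad \beta_t=\frac{1}{t^{\kappa}},\quad \gamma_t=\frac{1}{t^{1-\kappa}},\quad \xi_t=\frac{1}{t+1},\quad \delta_t=\frac{r(\mathbb{X})}{t+1},\qquad \forall t\in\mathbb{N}_+.$$ Then for any $T\in\mathbb{N}_+$ and any comparator sequence $y_{[T]}=(y_1,\dots,y_T)\in\mathcal{X}_T$, $$\mathbf{E}[\mathrm{Net\text{-}Reg}(\{x_{i,t}\},y_{[T]})]=\mathcal{O}\big(T^{\max\{\kappa,1/2\}}+\sqrt{T}\,P_T\big),$$ $$\mathbf{E}[\mathrm{Net\text{-}CCV}(\{x_{i,t}\})]=\mathcal{O}\big(T^{\max\{1-\kappa/2,\,3/4\}}\big),$$ where $P_T=\sum_{t=1}^{T-1}\|y_{t+1}-y_t\|$ is the path-length of $y_{[T]}$.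
   Context: Setting. There are $n$ agents, $i\in[n]=\{1,\dots,n\}$, and a set $\mathbb{X}\subseteq\mathbb{R}^p$. For each $t\in\mathbb{N}_+$ and $i\in[n]$ there are a local loss function $f_{i,t}:\mathbb{X}\to\mathbb{R}$ and a local constraint function $g_{i,t}:\mathbb{X}\to\mathbb{R}^{m_i}$. Set $f_t(x)=\frac1n\sum_{j=1}^n f_{j,t}(x)$, $g_t(x)=\mathrm{col}(g_{1,t}(x),\dots,g_{n,t}(x))\in\mathbb{R}^m$, $m=\sum_i m_i$. $\|\cdot\|$ is the Euclidean norm (spectral norm for matrices), $[\cdot]_+$ is the componentwise positive part, $\mathcal{P}_{\mathbb{K}}$ is Euclidean projection onto $\mathbb{K}$, $\mathbb{B}^p$ and $\mathbb{S}^p$ are the unit ball and unit sphere of $\mathbb{R}^p$ centered at the origin, vector inequalities are componentwise. Performance measures: $\mathrm{Net\text{-}Reg}(\{x_{i,t}\},y_{[T]})=\frac1n\sum_{i=1}^n\sum_{t=1}^T f_t(x_{i,t})-\sum_{t=1}^T f_t(y_t)$ and $\mathrm{Net\text{-}CCV}(\{x_{i,t}\})=\frac1n\sum_{i=1}^n\sum_{t=1}^T\|[g_t(x_{i,t})]_+\|$. $\mathcal{X}_T=\{(x_1,\dots,x_T): x_t\in\mathbb{X},\ g_t(x_t)\le \mathbf{0}_m\ \forall t\in[T]\}$ is the set of feasible decision sequences. Feasibility assumption (standing): for every $T\in\mathbb{N}_+$, $\mathcal{X}_T$ is non-empty, and so is the set of feasible static sequences $\{(x,\dots,x): x\in\mathbb{X},\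 g_t(x)\le\mathbf{0}_m\ \forall t\in[T]\}$. Assumption 1. (i) $\mathbb{X}$ is convex and closed, and $r(\mathbb{X})\mathbb{B}^p\subseteq\mathbb{X}\subseteq R(\mathbb{X})\mathbb{B}^p$ for constants $r(\mathbb{X}),R(\mathbb{X})>0$. (ii) All $f_{i,t}$ and $g_{i,t}$ are convex (the latter componentwise), and there is a constant $F_1$ with $|f_{i,t}(x)-f_{i,t}(y)|\le F_1$ and $\|g_{i,t}(x)\|\le F_1$ for all $x,y\in\mathbb{X}$, $i$, $t$. (iii) Subgradients $\partial f_{i,t}(x)\in\mathbb{R}^p$ and $\partial g_{i,t}(x)\in\mathbb{R}^{p\times m_i}$ exist and there is a constant $F_2$ with $\|\partial f_{i,t}(x)\|\le F_2$, $\|\partial g_{i,t}(x)\|\le F_2$ for all $x\in\mathbb{X}$, $i$, $t$. Assumption 2. For $t\in\mathbb{N}_+$, $\mathcal{G}_t=([n],\mathcal{E}_t)$ is a directed graph with mixing matrix $W_t\in\mathbb{R}^{n\times n}$ such that: (i) there is a constant $w\in(0,1)$ with $[W_t]_{ij}\ge w$ if $(j,i)\in\mathcal{E}_t$ or $i=j$, and $[W_t]_{ij}=0$ otherwise; (ii) $W_t$ is doubly stochastic; (iii) there is an integer $B>0$ such that $([n],\cup_{l=0}^{B-1}\mathcal{E}_{t+l})$ is strongly connected for every $t$. Algorithm 1. Inputs: $r(\mathbb{X})$ and non-increasing sequences $\{\alpha_t\},\{\beta_t\},\{\gamma_t\},\{\tau_t\}\subseteq(0,+\infty)$, $\{\xi_t\}\subseteq(0,1)$,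 $\{\delta_t\}$ with $\delta_t\in(0,r(\mathbb{X})\xi_t]$. Initialization: $x_{i,1}\in(1-\xi_1)\mathbb{X}$, $\hat x_{i,1}=x_{i,1}$, $q_{i,1}=\mathbf{0}_{m_i}$. For $t=1,2,\dots$ and each $i\in[n]$: draw $u_{i,t}$ uniformly from $\mathbb{S}^p$ (all draws over $i,t$ independent), and set $\hat\partial f_{i,t}(x_{i,t})=\frac{p}{\delta_t}\big(f_{i,t}(x_{i,t}+\delta_tu_{i,t})-f_{i,t}(x_{i,t})\big)u_{i,t}\in\mathbb{R}^p$, $\hat\partial[g_{i,t}(x_{i,t})]_+=\frac{p}{\delta_t}\,u_{i,t}\big([g_{i,t}(x_{i,t}+\delta_tu_{i,t})]_+-[g_{i,t}(x_{i,t})]_+\big)^T\in\mathbb{R}^{p\times m_i}$, $z_{i,t+1}=\sum_{j=1}^n[W_t]_{ij}\hat x_{j,t}$, $\hat\omega_{i,t+1}=\hat\partial f_{i,t}(x_{i,t})+\hat\partial[g_{i,t}(x_{i,t})]_+\,q_{i,t}$, $x_{i,t+1}=\mathcal{P}_{(1-\xi_{t+1})\mathbb{X}}(z_{i,t+1}-\alpha_{t+1}\hat\omega_{i,t+1})$, $q_{i,t+1}=\big[(1-\beta_{t+1}\gamma_{t+1})q_{i,t}+\gamma_{t+1}\big([g_{i,t}(x_{i,t})]_++(\hat\partial[g_{i,t}(x_{i,t})]_+)^T(x_{i,t+1}-x_{i,t})\big)\big]_+$, and $\hat x_{i,t+1}=x_{i,t+1}$ if $\|x_{i,t+1}-\hat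 x_{i,t}\|\ge\tau_{t+1}$, otherwise $\hat x_{i,t+1}=\hat x_{i,t}$. $\mathbf{E}$ is expectation over the random vectors $u_{i,t}$. The constants hidden in $\mathcal{O}(\cdot)$ do not depend on $T$ or on the comparator sequence; they may depend on the other problem data and algorithm parameters. *)

theory Defs
  imports "HOL-Probability.Probability"
begin

text \<open>
  Agents are the elements of a finite type \<open>'n\<close>, decisions live in \<open>real ^ 'p\<close>, and rounds are
  positive naturals; values of sequences at round \<open>0\<close> are never used. The dimension
  \<open>m i\<close> of agent \<open>i\<close>'s constraint depends on \<open>i\<close>, so a vector of that dimension is a function
  \<open>nat \<Rightarrow> real\<close> read only at indices below \<open>m i\<close>, with Euclidean norm \<open>L2_set _ {..<m i}\<close>;
  a matrix with \<open>m i\<close> columns in \<open>real ^ 'p\<close> is given by its columns, a function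
  \<open>nat \<Rightarrow> real ^ 'p\<close>.
\<close>

definition spectral_norm :: "nat \<Rightarrow> (nat \<Rightarrow> real ^ 'p) \<Rightarrow> real" where
  "spectral_norm d A =
     (SUP v \<in> {v. L2_set v {..<d} \<le> 1}. norm (\<Sum>k<d. v k *\<^sub>R A k))"

definition subgradient_on :: "(real ^ 'p) set \<Rightarrow> (real ^ 'p \<Rightarrow> real) \<Rightarrow> real ^ 'p \<Rightarrow> real ^ 'p \<Rightarrow> bool" where
  "subgradient_on X h x v \<longleftrightarrow> (\<forall>y\<in>X. h y \<ge> h x + v \<bullet> (y - x))"

definition avg_loss :: "('n::finite \<Rightarrow> nat \<Rightarrow> real ^ 'p \<Rightarrow> real) \<Rightarrow> nat \<Rightarrow> real ^ 'p \<Rightarrow> real" where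
  "avg_loss f t z = (1 / real CARD('n)) * (\<Sum>j\<in>UNIV. f j t z)"

definition pos_constraint_norm ::
  "('n::finite \<Rightarrow> nat) \<Rightarrow> ('n \<Rightarrow> nat \<Rightarrow> real ^ 'p \<Rightarrow> nat \<Rightarrow> real) \<Rightarrow> nat \<Rightarrow> real ^ 'p \<Rightarrow> real" where
  "pos_constraint_norm m g t z =
     L2_set (\<lambda>(j, k). max 0 (g j t z k)) (SIGMA j:UNIV. {..<m j})"

definition net_reg ::
  "('n::finite \<Rightarrow> nat \<Rightarrow> real ^ 'p \<Rightarrow> real) \<Rightarrow> ('n \<Rightarrow> nat \<Rightarrow> real ^ 'p) \<Rightarrow> (nat \<Rightarrow> real ^ 'p) \<Rightarrow> nat \<Rightarrow> real" where
  "net_reg f x y T =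
     (1 / real CARD('n)) * (\<Sum>i\<in>UNIV. \<Sum>t=1..T. avg_loss f t (x i t)) - (\<Sum>t=1..T. avg_loss f t (y t))"

definition net_ccv ::
  "('n::finite \<Rightarrow> nat) \<Rightarrow> ('n \<Rightarrow> nat \<Rightarrow> real ^ 'p \<Rightarrow> nat \<Rightarrow> real) \<Rightarrow> ('n \<Rightarrow> nat \<Rightarrow> real ^ 'p) \<Rightarrow> nat \<Rightarrow> real" where
  "net_ccv m g x T =
     (1 / real CARD('n)) * (\<Sum>i\<in>UNIV. \<Sum>t=1..T. pos_constraint_norm m g t (x i t))"

text \<open>A sequence of length \<open>T\<close> is a function on \<open>nat\<close> whose values outside \<open>{1..T}\<close> are irrelevant.\<close>

definition feasible_seqs ::
  "(real ^ 'p) set \<Rightarrow> ('n::finite \<Rightarrow> nat) \<Rightarrow> ('n \<Rightarrow> nat \<Rightarrow> real ^ 'p \<Rightarrow> nat \<Rightarrow> real) \<Rightarrow> nat \<Rightarrow> (nat \<Rightarrow> real ^ 'p) set" where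
  "feasible_seqs X m g T =
     {y. \<forall>t\<in>{1..T}. y t \<in> X \<and> (\<forall>i. \<forall>k<m i. g i t (y t) k \<le> 0)}"

definition feasible_static_seqs ::
  "(real ^ 'p) set \<Rightarrow> ('n::finite \<Rightarrow> nat) \<Rightarrow> ('n \<Rightarrow> nat \<Rightarrow> real ^ 'p \<Rightarrow> nat \<Rightarrow> real) \<Rightarrow> nat \<Rightarrow> (nat \<Rightarrow> real ^ 'p) set" where
  "feasible_static_seqs X m g T =
     {(\<lambda>_. z) | z. z \<in> X \<and> (\<forall>t\<in>{1..T}. \<forall>i. \<forall>k<m i. g i t z k \<le> 0)}"

definition path_length :: "(nat \<Rightarrow> real ^ 'p) \<Rightarrow> nat \<Rightarrow> real" where
  "path_length y T = (\<Sum>t=1..<T. norm (y (t + 1) - y t))"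

definition feasibility_assm ::
  "(real ^ 'p) set \<Rightarrow> ('n::finite \<Rightarrow> nat) \<Rightarrow> ('n \<Rightarrow> nat \<Rightarrow> real ^ 'p \<Rightarrow> nat \<Rightarrow> real) \<Rightarrow> bool" where
  "feasibility_assm X m g \<longleftrightarrow>
     (\<forall>T\<ge>1. feasible_seqs X m g T \<noteq> {} \<and> feasible_static_seqs X m g T \<noteq> {})"

text \<open>
  At each point of \<open>X\<close> some subgradient obeys the bound \<open>F2\<close>; asking it of all subgradients
  would be unsatisfiable on the boundary of \<open>X\<close>, where outward normals can be added freely.
\<close>

definition convex_problem_assm ::
  "(real ^ 'p) set \<Rightarrow> real \<Rightarrow> real \<Rightarrow> ('n::finite \<Rightarrow> nat) \<Rightarrow>
   ('n \<Rightarrow> nat \<Rightarrow> real ^ 'p \<Rightarrow> real) \<Rightarrow> ('n \<Rightarrow> nat \<Rightarrow> real ^ 'p \<Rightarrow> nat \<Rightarrow> real) \<Rightarrow> real \<Rightarrow> real \<Rightarrow> bool" where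
  "convex_problem_assm X r R m f g F1 F2 \<longleftrightarrow>
     convex X \<and> closed X \<and> r > 0 \<and> R > 0 \<and> cball 0 r \<subseteq> X \<and> X \<subseteq> cball 0 R \<and>
     (\<forall>i. \<forall>t\<ge>1.
        convex_on X (f i t) \<and> (\<forall>k<m i. convex_on X (\<lambda>z. g i t z k)) \<and>
        (\<forall>z\<in>X. \<forall>z'\<in>X. \<bar>f i t z - f i t z'\<bar> \<le> F1) \<and>
        (\<forall>z\<in>X. L2_set (g i t z) {..<m i} \<le> F1) \<and>
        (\<forall>z\<in>X. \<exists>v. subgradient_on X (f i t) z v \<and> norm v \<le> F2) \<and>
        (\<forall>z\<in>X. \<exists>A. (\<forall>k<m i. subgradient_on X (\<lambda>z'. g i t z' k) z (A k)) \<and>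
                     spectral_norm (m i) A \<le> F2))"

definition doubly_stochastic :: "real ^ 'n ^ 'n \<Rightarrow> bool" where
  "doubly_stochastic A \<longleftrightarrow>
     (\<forall>i j. A $ i $ j \<ge> 0) \<and> (\<forall>i. (\<Sum>j\<in>UNIV. A $ i $ j) = 1) \<and> (\<forall>j. (\<Sum>i\<in>UNIV. A $ i $ j) = 1)"

definition strongly_connected_edges :: "('n \<times> 'n) set \<Rightarrow> bool" where
  "strongly_connected_edges D \<longleftrightarrow> (\<forall>i j. (i, j) \<in> D\<^sup>*)"

definition network_assm ::
  "(nat \<Rightarrow> ('n \<times> 'n) set) \<Rightarrow> (nat \<Rightarrow> real ^ 'n ^ 'n::finite) \<Rightarrow> real \<Rightarrow> nat \<Rightarrow> bool" where
  "network_assm E W w B \<longleftrightarrow>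
     0 < w \<and> w < 1 \<and> B > 0 \<and>
     (\<forall>t\<ge>1.
        (\<forall>i j. if (j, i) \<in> E t \<or> i = j then W t $ i $ j \<ge> w else W t $ i $ j = 0) \<and>
        doubly_stochastic (W t) \<and>
        strongly_connected_edges (\<Union>l\<in>{0..B-1}. E (t + l)))"

text \<open>
  Normalised surface measure on the unit sphere, as the cone measure: the law of \<open>x / norm x\<close>
  for \<open>x\<close> uniform in the unit ball.
\<close>

definition uniform_sphere :: "(real ^ 'p) measure" where
  "uniform_sphere = distr (uniform_measure lborel (cball 0 1)) borel sgn"

text \<open>
  The draws lie on the sphere surely, not just almost surely, since the losses and constraints
  carry no information outside \<open>X\<close>.
\<close>

definition indep_sphere_draws :: "'w measure \<Rightarrow> ('n::finite \<Rightarrow> nat \<Rightarrow> 'w \<Rightarrow> real ^ 'p) \<Rightarrow> bool" where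
  "indep_sphere_draws M u \<longleftrightarrow>
     prob_space M \<and>
     prob_space.indep_vars M (\<lambda>_. borel) (\<lambda>(i, t). u i t) (UNIV \<times> {1..}) \<and>
     (\<forall>i. \<forall>t\<ge>1. distr M borel (u i t) = uniform_sphere \<and> (\<forall>\<omega>\<in>space M. u i t \<omega> \<in> sphere 0 1))"

text \<open>
  Two-point gradient estimator of \<open>h\<close> at \<open>x\<close>. The estimator of a vector-valued function has
  the estimators of its components as columns.
\<close>

definition grad_est :: "real \<Rightarrow> (real ^ 'p \<Rightarrow> real) \<Rightarrow> real ^ 'p \<Rightarrow> real ^ 'p \<Rightarrow> real ^ 'p" where
  "grad_est d h x u = (real CARD('p) / d * (h (x + d *\<^sub>R u) - h x)) *\<^sub>R u"

text \<open>
  Along one realisation \<open>u\<close> of the draws, \<open>x\<close>, \<open>xh\<close> and \<open>q\<close> are the decisions, the last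
  broadcast decisions and the dual variables generated from the initial decisions \<open>x1\<close>.
\<close>

definition algorithm_run ::
  "(real ^ 'p) set \<Rightarrow> ('n::finite \<Rightarrow> nat) \<Rightarrow>
   ('n \<Rightarrow> nat \<Rightarrow> real ^ 'p \<Rightarrow> real) \<Rightarrow> ('n \<Rightarrow> nat \<Rightarrow> real ^ 'p \<Rightarrow> nat \<Rightarrow> real) \<Rightarrow> (nat \<Rightarrow> real ^ 'n ^ 'n) \<Rightarrow>
   (nat \<Rightarrow> real) \<Rightarrow> (nat \<Rightarrow> real) \<Rightarrow> (nat \<Rightarrow> real) \<Rightarrow> (nat \<Rightarrow> real) \<Rightarrow> (nat \<Rightarrow> real) \<Rightarrow> (nat \<Rightarrow> real) \<Rightarrow>
   ('n \<Rightarrow> real ^ 'p) \<Rightarrow> ('n \<Rightarrow> nat \<Rightarrow> real ^ 'p) \<Rightarrow>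
   ('n \<Rightarrow> nat \<Rightarrow> real ^ 'p) \<Rightarrow> ('n \<Rightarrow> nat \<Rightarrow> real ^ 'p) \<Rightarrow> ('n \<Rightarrow> nat \<Rightarrow> nat \<Rightarrow> real) \<Rightarrow> bool" where
  "algorithm_run X m f g W \<alpha> \<beta> \<gamma> \<tau> \<xi> \<delta> x1 u x xh q \<longleftrightarrow>
     (\<forall>i. x1 i \<in> (\<lambda>z. (1 - \<xi> 1) *\<^sub>R z) ` X \<and> x i 1 = x1 i \<and> xh i 1 = x i 1 \<and> (\<forall>k<m i. q i 1 k = 0)) \<and>
     (\<forall>t\<ge>1. \<forall>i.
        let gp = (\<lambda>k z. max 0 (g i t z k));
            df = grad_est (\<delta> t) (f i t) (x i t) (u i t);
            dg = (\<lambda>k. grad_est (\<delta> t) (gp k) (x i t) (u i t));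
            z = (\<Sum>j\<in>UNIV. W t $ i $ j *\<^sub>R xh j t);
            \<omega> = df + (\<Sum>k<m i. q i t k *\<^sub>R dg k)
        in
          x i (t + 1) = closest_point ((\<lambda>z. (1 - \<xi> (t + 1)) *\<^sub>R z) ` X) (z - \<alpha> (t + 1) *\<^sub>R \<omega>) \<and>
          (\<forall>k<m i. q i (t + 1) k =
             max 0 ((1 - \<beta> (t + 1) * \<gamma> (t + 1)) * q i t k
                    + \<gamma> (t + 1) * (gp k (x i t) + dg k \<bullet> (x i (t + 1) - x i t)))) \<and>
          xh i (t + 1) = (if norm (x i (t + 1) - xh i t) \<ge> \<tau> (t + 1) then x i (t + 1) else xh i t))"

end

theory Submission
  imports Defs
begin

text \<open>
  Each projection step gives the usual telescoping inequality for \<open>norm (x - y)\<^sup>2\<close>, and the dual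
  update gives one for \<open>(q - \<mu>)\<^sup>2\<close> with an arbitrary constant multiplier \<open>\<mu> \<ge> 0\<close>. Summed over
  agents and rounds along one realisation, all errors that involve the displacements
  \<open>norm (x i (t + 1) - z i t)\<close> (in particular the disagreement of the agents, which by the
  contraction of the mixing matrices is at most a constant plus a constant times the total
  displacement) are absorbed in the negative squares left over by the projection. In expectation
  the gradient estimators may be replaced by differences of function values up to \<open>O(\<delta> t)\<close>.
  The regret bound is the case \<open>\<mu> = 0\<close>; for the constraint violation \<open>\<mu>\<close> is chosen as a power of \<open>T\<close>.
\<close>

section \<open>Orthogonal invariance of the uniform law on the sphere\<close>

text \<open>The obstacle is the dual variable \<open>q\<close>, which may grow like
  \<open>t powr \<kappa>\<close>: no displacement may be multiplied by it. The dual update is driven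
  by the constraint linearised at \<open>x (t + 1)\<close>, so the term
  \<open>q * (dg \<bullet> (x (t + 1) - x t))\<close> of the projection inequality is absorbed
  exactly by \<open>q * b\<close>, which the dual inequality controls; displacements carry only a
  weight of order 1 + \<mu>. What remains, \<open>est_gap\<close>, pairs the estimators with
  \<open>x t - v t\<close>, which is fixed by the past draws, so the draw of the current round can
  be integrated out. Projecting onto \<open>(1 - \<xi> t) X\<close> leaves room for the
  perturbations and forces the comparator to be shrunk as well. As
  \<open>\<delta> t = r * \<xi> t\<close>, shrinking and estimator bias both cost O(1/t), weighted
  by at most O(\<open>t powr \<kappa>\<close>): a total of order \<open>T powr \<kappa>\<close>,
  like the sum of the \<open>\<gamma> t\<close>. A multiple \<open>\<Lambda>\<close> of the
  disagreement is carried along on the left-hand side; it later pays for evaluating the loss and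
  constraint of one agent at the decision of another.\<close>

text \<open>
  The library has the invariance of Lebesgue measure under orthogonal maps only for well-ordered
  index types. Here \<open>lborel\<close> and its image under \<open>f\<close> are two translation-invariant measures, so
  Fubini's theorem gives \<open>N A * lborel B = lborel A * N B\<close> for the unit ball \<open>B\<close>, which \<open>f\<close> preserves.
\<close>

lemma distr_lborel_orthogonal_transformation:
  fixes f :: "'a::euclidean_space \<Rightarrow> 'a"
  assumes f: "orthogonal_transformation f"
  shows "distr lborel borel f = lborel"
proof (rule measure_eqI)
  have lin: "linear f" and norm_f: "\<And>v. norm (f v) = norm v"
    using f by (auto simp: orthogonal_transformation)
  have [measurable]: "f \<in> borel_measurable borel"
    by (intro borel_measurable_continuous_onI linear_continuous_on linear_conv_bounded_linear[THEN iffD1] lin)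
  define N where "N = distr lborel borel f"
  have [simp, measurable_cong]: "sets N = sets borel" and [simp]: "space N = UNIV"
    by (simp_all add: N_def)
  interpret N: sigma_finite_measure N
  proof
    have "countable (range (\<lambda>n::nat. cball (0::'a) (real n)))" by simp
    moreover have "\<Union> (range (\<lambda>n::nat. cball (0::'a) (real n))) = space N"
      using real_arch_simple by fastforce
    moreover have "emeasure N (cball 0 (real n)) \<noteq> \<infinity>" for n :: nat
    proof -
      have "f -` cball 0 (real n) = cball 0 (real n)" by (auto simp: norm_f)
      then show ?thesis
        using emeasure_lborel_cball_finite[of "0::'a" "real n"] by (simp add: N_def emeasure_distr)
    qed
    ultimately show "\<exists>A. countable A \<and> A \<subseteq> sets N \<and> \<Union> A = space N \<and> (\<forall>a\<in>A. emeasure N a \<noteq> \<infinity>)"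
      by (intro exI[of _ "range (\<lambda>n::nat. cball (0::'a) (real n))"]) auto
  qed
  interpret P: pair_sigma_finite N lborel ..
  \<comment> \<open>A shift by \<open>a = f b\<close> after applying \<open>f\<close> is a shift by
    \<open>b\<close> before applying it, and \<open>lborel\<close> does not see the latter.\<close>
  have shift_N: "(\<integral>\<^sup>+x. h (x + a) \<partial>N) = (\<integral>\<^sup>+x. h x \<partial>N)"
    if [measurable]: "h \<in> borel_measurable borel" for h :: "'a \<Rightarrow> ennreal" and a
  proof -
    obtain b where b: "f b = a" using orthogonal_transformation_surj[OF f] by (metis surjD)
    have "(\<integral>\<^sup>+x. h x \<partial>N) = (\<integral>\<^sup>+x. h (f x) \<partial>lborel)"
      by (simp add: N_def nn_integral_distr)
    also have "\<dots> = (\<integral>\<^sup>+x. h (f x) \<partial>distr lborel borel ((+) b))"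
      by (simp add: lborel_distr_plus)
    also have "\<dots> = (\<integral>\<^sup>+x. h (f (b + x)) \<partial>lborel)"
      by (subst nn_integral_distr) auto
    also have "\<dots> = (\<integral>\<^sup>+x. h (f x + a) \<partial>lborel)"
      by (simp add: linear_add[OF lin] b add.commute)
    also have "\<dots> = (\<integral>\<^sup>+x. h (x + a) \<partial>N)"
      by (simp add: N_def nn_integral_distr)
    finally show ?thesis ..
  qed
  have shift_L: "(\<integral>\<^sup>+x. h (x + a) \<partial>lborel) = (\<integral>\<^sup>+x. h x \<partial>lborel)"
    if [measurable]: "h \<in> borel_measurable borel" for h :: "'a \<Rightarrow> ennreal" and a
  proof -
    have "(\<integral>\<^sup>+x. h x \<partial>lborel) = (\<integral>\<^sup>+x. h x \<partial>distr lborel borel ((+) a))"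
      by (simp add: lborel_distr_plus)
    also have "\<dots> = (\<integral>\<^sup>+x. h (x + a) \<partial>lborel)"
      by (subst nn_integral_distr) (auto simp: add.commute)
    finally show ?thesis ..
  qed
  fix A assume "A \<in> sets (distr lborel borel f)"
  then have A [measurable]: "A \<in> sets borel" by simp
  let ?B = "cball (0::'a) 1"
  have [measurable]: "?B \<in> sets borel" by simp
  have meas: "(\<lambda>(x::'a, y). indicator A x * indicator ?B (y - x) :: ennreal) \<in> borel_measurable (N \<Otimes>\<^sub>M lborel)"
    "(\<lambda>(x::'a, y). indicator A (x + y) * indicator ?B (- x) :: ennreal) \<in> borel_measurable (N \<Otimes>\<^sub>M lborel)"
    by (auto simp: N_def)
  have NB: "emeasure N ?B = emeasure lborel ?B"
  proof -
    have "f -` ?B = ?B" by (auto simp: norm_f)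
    then show ?thesis by (simp add: N_def emeasure_distr)
  qed
  have "emeasure N A * emeasure lborel ?B = (\<integral>\<^sup>+x. indicator A x * emeasure lborel ?B \<partial>N)"
    by (subst nn_integral_multc) auto
  also have "\<dots> = (\<integral>\<^sup>+x. \<integral>\<^sup>+y. indicator A x * indicator ?B (y + (- x)) \<partial>lborel \<partial>N)"
    by (simp add: nn_integral_cmult shift_L del: add_uminus_conv_diff)
  also have "\<dots> = (\<integral>\<^sup>+y. \<integral>\<^sup>+x. indicator A x * indicator ?B (y - x) \<partial>N \<partial>lborel)"
    using P.Fubini'[OF meas(1)] by simp
  \<comment> \<open>For fixed \<open>y\<close>, substitute \<open>x + y\<close> for \<open>x\<close>
    under \<open>N\<close>. The ball is symmetric, so the sign of \<open>- x\<close> disappears in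
    the next step, and \<open>y\<close> then occurs only as a shift of \<open>A\<close>.\<close>
  also have "\<dots> = (\<integral>\<^sup>+y. \<integral>\<^sup>+x. indicator A (x + y) * indicator ?B (- x) \<partial>N \<partial>lborel)"
  proof (rule nn_integral_cong)
    fix y :: 'a
    show "(\<integral>\<^sup>+x. indicator A x * indicator ?B (y - x) \<partial>N) = (\<integral>\<^sup>+x. indicator A (x + y) * indicator ?B (- x) \<partial>N)"
      using shift_N[of "\<lambda>x. indicator A x * indicator ?B (y - x)" y] by simp
  qed
  also have "\<dots> = (\<integral>\<^sup>+x. \<integral>\<^sup>+y. indicator A (y + x) * indicator ?B x \<partial>lborel \<partial>N)"
    using P.Fubini'[OF meas(2)] by (simp add: add.commute indicator_def)
  also have "\<dots> = (\<integral>\<^sup>+x. emeasure lborel A * indicator ?B x \<partial>N)"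
    by (simp add: nn_integral_multc shift_L)
  also have "\<dots> = emeasure lborel A * emeasure lborel ?B"
    by (simp add: nn_integral_cmult NB)
  finally have *: "emeasure N A * emeasure lborel ?B = emeasure lborel A * emeasure lborel ?B" .
  have "emeasure lborel ?B \<noteq> 0" "emeasure lborel ?B \<noteq> \<infinity>"
    using emeasure_lborel_cball_finite[of "0::'a" 1] content_cball_pos[of 1 "0::'a"]
    by (auto simp: measure_def)
  then have "emeasure N A = emeasure lborel A"
    using * by (simp add: ennreal_mult_cancel_left mult.commute[of _ "emeasure lborel ?B"])
  then show "emeasure (distr lborel borel f) A = emeasure lborel A"
    by (simp add: N_def)
qed simp

text \<open>An orthogonal map preserves Lebesgue measure and the unit ball, hence the uniform law on
  the ball; it commutes with \<open>sgn\<close>, which carries the invariance over to the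
  sphere.\<close>

lemma distr_uniform_sphere_orthogonal_transformation:
  fixes f :: "real ^ 'p \<Rightarrow> real ^ 'p"
  assumes f: "orthogonal_transformation f"
  shows "distr uniform_sphere borel f = uniform_sphere"
proof -
  have lin: "linear f" and norm_f: "\<And>v. norm (f v) = norm v"
    using f by (auto simp: orthogonal_transformation)
  have [measurable]: "f \<in> borel_measurable borel"
    by (intro borel_measurable_continuous_onI linear_continuous_on linear_conv_bounded_linear[THEN iffD1] lin)
  have [measurable]: "(sgn :: real^'p \<Rightarrow> real^'p) \<in> borel_measurable borel"
    unfolding sgn_div_norm by measurable
  let ?U = "uniform_measure lborel (cball (0::real^'p) 1)"
  have sgn_f: "sgn (f v) = f (sgn v)" for v
    by (simp add: sgn_div_norm norm_f linear_scale[OF lin])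
  have "distr ?U borel f = ?U"
  proof (rule measure_eqI)
    fix A assume "A \<in> sets (distr ?U borel f)"
    then have [measurable]: "A \<in> sets borel" by simp
    have "cball 0 1 \<inter> f -` A = f -` (cball 0 1 \<inter> A)" by (auto simp: norm_f)
    then have "emeasure lborel (cball 0 1 \<inter> f -` A) = emeasure (distr lborel borel f) (cball 0 1 \<inter> A)"
      by (simp add: emeasure_distr)
    then show "emeasure (distr ?U borel f) A = emeasure ?U A"
      by (simp add: emeasure_distr distr_lborel_orthogonal_transformation[OF f] measurable_sets_borel[of f borel])
  qed simp
  then have "distr (distr ?U borel f) borel sgn = uniform_sphere"
    by (simp add: uniform_sphere_def)
  then show ?thesis
    by (simp add: uniform_sphere_def distr_distr comp_def sgn_f)
qed

section \<open>The two-point gradient estimator\<close>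

text \<open>For a unit vector \<open>e\<close> this is the Householder reflection in the hyperplane
  orthogonal to \<open>e\<close>.\<close>

definition reflect :: "'a::real_inner \<Rightarrow> 'a \<Rightarrow> 'a" where
  "reflect e v = v - (2 * (e \<bullet> v)) *\<^sub>R e"

lemma inner_reflect:
  assumes "norm e = 1"
  shows "e \<bullet> reflect e v = - (e \<bullet> v)"
  using assms by (simp add: reflect_def inner_diff_right dot_square_norm)

lemma orthogonal_transformation_reflect:
  assumes "norm e = 1"
  shows "orthogonal_transformation (reflect e)"
proof -
  have "e \<bullet> e = 1" using assms by (simp add: dot_square_norm)
  then have "reflect e v \<bullet> reflect e w = v \<bullet> w" for v w
    by (simp add: reflect_def inner_diff_left inner_diff_right inner_commute)
  moreover have "linear (reflect e)"
    by (rule linearI) (simp_all add: reflect_def inner_add_right algebra_simps)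
  ultimately show ?thesis
    by (simp add: orthogonal_transformation_def)
qed

text \<open>The reflection in the hyperplane that bisects \<open>a\<close> and \<open>b\<close>
  exchanges them, because equal norms give
  \<open>2 * ((a - b) \<bullet> a) = (norm (a - b))\<^sup>2\<close>.\<close>

lemma orthogonal_transformation_swap_unit:
  fixes a b :: "'a::real_inner"
  assumes "norm a = 1" "norm b = 1"
  obtains T where "orthogonal_transformation T" "T a = b"
proof (cases "a = b")
  case True
  then show ?thesis using that[of "\<lambda>x. x"] by simp
next
  case False
  define e where "e = (1 / norm (a - b)) *\<^sub>R (a - b)"
  have e: "norm e = 1" using False by (simp add: e_def)
  have aa: "a \<bullet> a = 1" "b \<bullet> b = 1" using assms by (simp_all add: dot_square_norm)
  have n: "(norm (a - b))\<^sup>2 = 2 - 2 * (a \<bullet> b)"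
    by (simp add: power2_norm_eq_inner inner_diff_left inner_diff_right aa inner_commute)
  have "2 * ((a - b) \<bullet> a) = (norm (a - b))\<^sup>2"
    by (simp add: n inner_diff_left aa inner_commute[of b])
  then have "2 * (e \<bullet> a) = norm (a - b)"
    using False by (simp add: e_def power2_eq_square)
  then have "reflect e a = b"
    using False by (simp add: reflect_def e_def)
  then show ?thesis using that orthogonal_transformation_reflect[OF e] by blast
qed

section \<open>Moments of the uniform law on the sphere\<close>

lemma sets_uniform_sphere [simp, measurable_cong]: "sets (uniform_sphere :: (real^'p) measure) = sets borel"
  by (simp add: uniform_sphere_def)

lemma space_uniform_sphere [simp]: "space (uniform_sphere :: (real^'p) measure) = UNIV"
  by (simp add: uniform_sphere_def)

lemma prob_space_uniform_sphere: "prob_space (uniform_sphere :: (real^'p) measure)"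
  and AE_uniform_sphere: "AE v in (uniform_sphere :: (real^'p) measure). norm v = 1"
proof -
  let ?B = "cball (0::real^'p) 1"
  have B: "emeasure lborel ?B \<noteq> 0" "emeasure lborel ?B \<noteq> \<infinity>"
    using emeasure_lborel_cball_finite[of "0::real^'p" 1] content_cball_pos[of 1 "0::real^'p"]
    by (auto simp: measure_def)
  have [measurable]: "(sgn :: real^'p \<Rightarrow> real^'p) \<in> borel_measurable borel"
    unfolding sgn_div_norm by measurable
  show "prob_space (uniform_sphere :: (real^'p) measure)"
    unfolding uniform_sphere_def
    using B by (intro prob_space.prob_space_distr prob_space_uniform_measure) auto
  \<comment> \<open>\<open>sgn 0 = 0\<close> lies off the sphere, so the norm is 1 only almost
    everywhere.\<close>
  have "AE v in lborel. v \<noteq> (0::real^'p)"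
    by (rule AE_lborel_singleton)
  then have "AE v in uniform_measure lborel ?B. norm (sgn v) = 1"
    by (intro AE_uniform_measureI) (auto elim!: eventually_mono simp: norm_sgn)
  then show "AE v in (uniform_sphere :: (real^'p) measure). norm v = 1"
    unfolding uniform_sphere_def by (subst AE_distr_iff) auto
qed

interpretation uniform_sphere: prob_space "uniform_sphere :: (real^'p) measure"
  by (rule prob_space_uniform_sphere)

lemma integrable_uniform_sphere:
  fixes h :: "real^'p \<Rightarrow> real"
  assumes "h \<in> borel_measurable borel" "\<And>v. norm v = 1 \<Longrightarrow> \<bar>h v\<bar> \<le> K"
  shows "integrable uniform_sphere h"
proof (rule uniform_sphere.integrable_const_bound[of _ K])
  show "AE x in uniform_sphere. norm (h x) \<le> K" using AE_uniform_sphere by eventually_elim (use assms in auto)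
  show "h \<in> borel_measurable uniform_sphere" using assms by simp
qed

lemma integral_uniform_sphere_orthogonal:
  fixes h :: "real^'p \<Rightarrow> real" and T :: "real^'p \<Rightarrow> real^'p"
  assumes "orthogonal_transformation T" and [measurable]: "h \<in> borel_measurable borel"
  shows "(\<integral>v. h (T v) \<partial>uniform_sphere) = (\<integral>v. h v \<partial>uniform_sphere)"
proof -
  have [measurable]: "T \<in> borel_measurable borel"
    by (intro borel_measurable_continuous_onI linear_continuous_on linear_conv_bounded_linear[THEN iffD1]
        orthogonal_transformation_linear assms)
  have "(\<integral>v. h v \<partial>uniform_sphere) = (\<integral>v. h v \<partial>distr uniform_sphere borel T)"
    by (simp only: distr_uniform_sphere_orthogonal_transformation[OF assms(1)])
  then show ?thesis by (simp add: integral_distr)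
qed

text \<open>By invariance all unit directions have the same second moment, and over an orthonormal
  basis these moments add up to the mean of \<open>(norm v)\<^sup>2\<close>, which is 1.\<close>

lemma uniform_sphere_second_moment:
  assumes e: "norm (e::real^'p) = 1"
  shows "(\<integral>v. (e \<bullet> v)\<^sup>2 \<partial>uniform_sphere) = 1 / CARD('p)"
proof -
  have int: "integrable uniform_sphere (\<lambda>v. (b \<bullet> v)\<^sup>2)" for b :: "real^'p"
  proof (rule integrable_uniform_sphere)
    fix v :: "real^'p" assume "norm v = 1"
    then have "\<bar>b \<bullet> v\<bar> \<le> norm b" using Cauchy_Schwarz_ineq2[of b v] by simp
    then show "\<bar>(b \<bullet> v)\<^sup>2\<bar> \<le> (norm b)\<^sup>2" by (metis abs_le_square_iff abs_norm_cancel abs_power2)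
  qed measurable
  have eq: "(\<integral>v. (b \<bullet> v)\<^sup>2 \<partial>uniform_sphere) = (\<integral>v. (e \<bullet> v)\<^sup>2 \<partial>uniform_sphere)" if "b \<in> Basis" for b :: "real^'p"
  proof -
    have "norm b = 1" using that by simp
    then obtain T where T: "orthogonal_transformation T" "T e = b"
      using orthogonal_transformation_swap_unit[of e b] e by blast
    have "(\<integral>v. (b \<bullet> v)\<^sup>2 \<partial>uniform_sphere) = (\<integral>v. (b \<bullet> T v)\<^sup>2 \<partial>uniform_sphere)"
      by (rule integral_uniform_sphere_orthogonal[symmetric, OF T(1)]) measurable
    moreover have "b \<bullet> T v = e \<bullet> v" for v
      using T by (metis orthogonal_transformation_def)
    ultimately show ?thesis by simp
  qed
  have "1 = (\<integral>v. (norm v)\<^sup>2 \<partial>(uniform_sphere :: (real^'p) measure))"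
  proof -
    have "(\<integral>v. (norm v)\<^sup>2 \<partial>(uniform_sphere :: (real^'p) measure)) = (\<integral>v. 1 \<partial>(uniform_sphere :: (real^'p) measure))"
      by (rule integral_cong_AE) (use AE_uniform_sphere in \<open>auto elim!: eventually_mono\<close>)
    then show ?thesis using uniform_sphere.prob_space by simp
  qed
  also have "\<dots> = (\<integral>v. (\<Sum>b\<in>Basis. (b \<bullet> v)\<^sup>2) \<partial>(uniform_sphere :: (real^'p) measure))"
    by (rule Bochner_Integration.integral_cong[OF refl])
      (subst power2_norm_eq_inner, subst euclidean_inner, simp only: power2_eq_square inner_commute)
  also have "\<dots> = (\<Sum>b\<in>Basis. \<integral>v. (b \<bullet> v)\<^sup>2 \<partial>(uniform_sphere :: (real^'p) measure))"
    by (rule Bochner_Integration.integral_sum) (rule int)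
  also have "\<dots> = CARD('p) * (\<integral>v. (e \<bullet> v)\<^sup>2 \<partial>uniform_sphere)"
    using eq by simp
  finally show ?thesis by (simp add: field_simps)
qed

text \<open>Slopes of a convex function increase along a line. The inequality is cross-multiplied so
  that \<open>s = 0\<close> is allowed, which occurs below when the draw is orthogonal to
  \<open>e\<close>.\<close>

lemma convex_on_slope:
  fixes h :: "'a::real_vector \<Rightarrow> real"
  assumes h: "convex_on A h" and A: "a \<in> A" "c \<in> A" and D: "0 < D" and s: "0 \<le> s"
    and e: "c = a + (D + s) *\<^sub>R e"
  shows "D * (h c - h (a + D *\<^sub>R e)) \<ge> s * (h (a + D *\<^sub>R e) - h a)"
proof -
  have 1: "s / (D + s) + D / (D + s) = 1" and 2: "D / (D + s) * (D + s) = D"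
    using D s by (simp_all add: add_divide_distrib[symmetric])
  have b: "a + D *\<^sub>R e = (s / (D + s)) *\<^sub>R a + (D / (D + s)) *\<^sub>R c"
    unfolding e scaleR_add_right scaleR_scaleR 2 add.assoc[symmetric] scaleR_add_left[symmetric] 1
    by simp
  have "h (a + D *\<^sub>R e) \<le> (s / (D + s)) * h a + (D / (D + s)) * h c"
  proof -
    have "h (v *\<^sub>R a + w *\<^sub>R c) \<le> v * h a + w * h c" if "v \<ge> 0" "w \<ge> 0" "v + w = 1" for v w
      using h A that unfolding convex_on_def by blast
    from this[OF _ _ 1] show ?thesis unfolding b using D s by simp
  qed
  then have "(D + s) * h (a + D *\<^sub>R e) \<le> (D + s) * ((s / (D + s)) * h a + (D / (D + s)) * h c)"
    using D s by (intro mult_left_mono) auto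
  also have "\<dots> = s * h a + D * h c" using D s by (simp add: distrib_left)
  finally show ?thesis by (simp add: algebra_simps)
qed

text \<open>
  Two points of the sphere that are mirror images in the hyperplane orthogonal to \<open>a - b\<close> span a
  segment parallel to \<open>a - b\<close>, along which convexity compares the slopes of \<open>h\<close>. Averaging over
  such pairs avoids the usual appeal to Stokes' theorem for the ball-smoothed function.
\<close>

lemma grad_est_expectation_ge:
  fixes h :: "real^'p \<Rightarrow> real"
  assumes h: "convex_on X h" and [measurable]: "h \<in> borel_measurable borel"
    and lip: "\<And>x y. x \<in> X \<Longrightarrow> y \<in> X \<Longrightarrow> \<bar>h x - h y\<bar> \<le> L * norm (x - y)"
    and d: "d > 0" and ab: "cball a d \<subseteq> X" "cball b d \<subseteq> X"
  shows "(\<integral>v. grad_est d h a v \<bullet> (a - b) \<partial>uniform_sphere) \<ge> h a - h b - 2 * L * d"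
proof (cases "a = b")
  case True
  \<comment> \<open>The sign of \<open>L\<close> follows from \<open>lip\<close> at \<open>a\<close>
    and a point at distance \<open>d\<close> from it.\<close>
  have "0 \<le> L * norm (d *\<^sub>R (axis undefined 1 :: real^'p))"
    using lip[of a "a + d *\<^sub>R axis undefined 1"] ab d by (auto simp: subset_iff dist_norm)
  then have "L * d \<ge> 0" using d by simp
  then show ?thesis using True by simp
next
  case False
  define D where "D = norm (a - b)"
  define e where "e = (1 / D) *\<^sub>R (a - b)"
  have D: "D > 0" and e: "norm e = 1" and De: "D *\<^sub>R e = a - b"
    using False by (simp_all add: D_def e_def)
  let ?T = "reflect e"
  have T: "orthogonal_transformation ?T" by (rule orthogonal_transformation_reflect[OF e])
  have [measurable]: "?T \<in> borel_measurable borel"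
    by (intro borel_measurable_continuous_onI linear_continuous_on linear_conv_bounded_linear[THEN iffD1]
        orthogonal_transformation_linear T)
  \<comment> \<open>Up to the factor \<open>CARD('p) * D / d\<close>, this is the component of the
    estimator along \<open>a - b\<close>.\<close>
  define k where "k v = (e \<bullet> v) * (h (a + d *\<^sub>R v) - h a)" for v
  have [measurable]: "k \<in> borel_measurable borel" unfolding k_def by measurable
  have aX: "a \<in> X" and bX: "b \<in> X" using ab d by auto
  have in_X: "a + d *\<^sub>R v \<in> X" "b + d *\<^sub>R v \<in> X" if "norm v = 1" for v
    using ab d that by (auto simp: subset_iff dist_norm)
  have inner_le: "\<bar>e \<bullet> v\<bar> \<le> 1" if "norm v = 1" for v
    using Cauchy_Schwarz_ineq2[of e v] e that by simp
  have k_le: "\<bar>k v\<bar> \<le> L * d" if v: "norm v = 1" for v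
  proof -
    have "\<bar>h (a + d *\<^sub>R v) - h a\<bar> \<le> L * d"
      using lip[OF in_X(1)[OF v] aX] d v by simp
    then show ?thesis unfolding k_def abs_mult
      using mult_mono[OF inner_le[OF v], of "\<bar>h (a + d *\<^sub>R v) - h a\<bar>" "L * d"] by simp
  qed
  have norm_T: "norm (?T v) = norm v" for v using T by (rule orthogonal_transformation_norm)
  have int: "integrable uniform_sphere k" "integrable uniform_sphere (\<lambda>v. k (?T v))"
    using k_le norm_T by (auto intro!: integrable_uniform_sphere[where K = "L * d"])
  have int2: "integrable uniform_sphere (\<lambda>v. (e \<bullet> v)\<^sup>2)"
    using inner_le by (intro integrable_uniform_sphere[where K = 1]) (auto simp: abs_square_le_1)
  let ?\<Delta> = "h a - h b - 2 * L * d"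
  have ineq: "D * (t * (h (a + d *\<^sub>R v) - h (a + d *\<^sub>R ?T v))) \<ge> 2 * d * t\<^sup>2 * ?\<Delta>"
    if v: "norm v = 1" and t: "t = e \<bullet> v" "t \<ge> 0" for v t
  proof -
    let ?v' = "?T v"
    have v': "norm ?v' = 1" using norm_T v by simp
    \<comment> \<open>As \<open>v - ?T v = 2 t e\<close>, the points \<open>b + d v'\<close>,
      \<open>a + d v'\<close> and \<open>a + d v\<close> lie in this order on a line of direction
      \<open>e\<close>, at consecutive distances \<open>D\<close> and \<open>2 d t\<close>.\<close>
    have "a + d *\<^sub>R v = (b + d *\<^sub>R ?v') + (D + 2 * d * t) *\<^sub>R e"
      by (simp add: reflect_def t scaleR_add_left De algebra_simps)
    from convex_on_slope[OF h in_X(2)[OF v'] in_X(1)[OF v] D _ this]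
    have "D * (h (a + d *\<^sub>R v) - h (a + d *\<^sub>R ?v')) \<ge> (2 * d * t) * (h (a + d *\<^sub>R ?v') - h (b + d *\<^sub>R ?v'))"
      using d t by (simp add: De add.commute)
    \<comment> \<open>The loss \<open>2 L d\<close> comes from replacing \<open>a + d v'\<close> by
      \<open>a\<close> and \<open>b + d v'\<close> by \<open>b\<close>.\<close>
    moreover have "h (a + d *\<^sub>R ?v') - h (b + d *\<^sub>R ?v') \<ge> ?\<Delta>"
      using lip[OF in_X(1)[OF v'] aX] lip[OF in_X(2)[OF v'] bX] d v' by (auto simp: abs_le_iff)
    ultimately have "D * (h (a + d *\<^sub>R v) - h (a + d *\<^sub>R ?v')) \<ge> (2 * d * t) * ?\<Delta>"
      using d t by (smt (verit) mult_left_mono mult_nonneg_nonneg)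
    then have "t * (D * (h (a + d *\<^sub>R v) - h (a + d *\<^sub>R ?v'))) \<ge> t * ((2 * d * t) * ?\<Delta>)"
      using t by (intro mult_left_mono) auto
    then show ?thesis by (simp add: power2_eq_square algebra_simps)
  qed
  have TT: "?T (?T v) = v" for v
    using e by (simp add: reflect_def inner_diff_right dot_square_norm)
  \<comment> \<open>Mirror images have opposite components along \<open>e\<close>:
    \<open>h a\<close> cancels in the sum, and \<open>ineq\<close> applies to whichever of the two
    has the nonnegative component.\<close>
  have pair: "D * (k v + k (?T v)) \<ge> 2 * d * ?\<Delta> * (e \<bullet> v)\<^sup>2" if v: "norm v = 1" for v
  proof (cases "e \<bullet> v \<ge> 0")
    case True
    from ineq[OF v refl True] show ?thesis
      by (simp add: k_def inner_reflect[OF e] algebra_simps)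
  next
    case False
    have "norm (?T v) = 1" "e \<bullet> ?T v \<ge> 0" using False norm_T v by (simp_all add: inner_reflect[OF e])
    from ineq[OF this(1) refl this(2)] show ?thesis
      by (simp add: k_def inner_reflect[OF e] TT algebra_simps)
  qed
  \<comment> \<open>The second moment \<open>1 / CARD('p)\<close> is what the factor
    \<open>CARD('p)\<close> in the estimator compensates.\<close>
  have "2 * d * ?\<Delta> * (1 / CARD('p)) = (\<integral>v. 2 * d * ?\<Delta> * (e \<bullet> v)\<^sup>2 \<partial>uniform_sphere)"
    by (simp add: uniform_sphere_second_moment[OF e])
  also have "\<dots> \<le> (\<integral>v. D * (k v + k (?T v)) \<partial>uniform_sphere)"
    by (rule integral_mono_AE) (use AE_uniform_sphere int int2 pair in \<open>auto elim!: eventually_mono\<close>)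
  also have "\<dots> = D * ((\<integral>v. k v \<partial>uniform_sphere) + (\<integral>v. k (?T v) \<partial>uniform_sphere))"
    using int by simp
  also have "\<dots> = 2 * D * (\<integral>v. k v \<partial>uniform_sphere)"
    by (simp add: integral_uniform_sphere_orthogonal[OF T])
  finally have *: "d * ?\<Delta> \<le> CARD('p) * D * (\<integral>v. k v \<partial>uniform_sphere)"
    by (simp add: field_simps)
  have "grad_est d h a v \<bullet> (a - b) = CARD('p) * D / d * k v" for v
    by (simp add: grad_est_def De[symmetric] k_def inner_commute)
  then have "(\<integral>v. grad_est d h a v \<bullet> (a - b) \<partial>uniform_sphere) = CARD('p) * D / d * (\<integral>v. k v \<partial>uniform_sphere)"
    by simp
  moreover have "?\<Delta> \<le> CARD('p) * D * (\<integral>v. k v \<partial>uniform_sphere) / d"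
    using * d by (simp add: field_simps)
  ultimately show ?thesis by simp
qed

section \<open>Independence of a draw from the past\<close>

text \<open>A freezing lemma without conditional expectations: the identity into the
  sub-sigma-algebra \<open>N\<close>, paired with the independent \<open>U\<close>, has a product
  law, so Fubini integrates \<open>U\<close> out with \<open>\<omega>\<close> held fixed.\<close>

lemma (in prob_space) expectation_indep_ge:
  fixes \<phi> :: "'a \<times> 'b \<Rightarrow> real" and \<psi> :: "'a \<Rightarrow> real"
  assumes N: "space N = space M" "sets N \<subseteq> events" and U [measurable]: "random_variable K U"
    and indep: "indep_set (sets N) {U -` B \<inter> space M | B. B \<in> sets K}"
    and [measurable]: "\<phi> \<in> borel_measurable (N \<Otimes>\<^sub>M K)" "\<psi> \<in> borel_measurable N"
    and int: "integrable M (\<lambda>\<omega>. \<phi> (\<omega>, U \<omega>))" "integrable M \<psi>"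
    and le: "\<And>\<omega>. \<omega> \<in> space N \<Longrightarrow> \<psi> \<omega> \<le> (\<integral>v. \<phi> (\<omega>, v) \<partial>distr M K U)"
  shows "expectation \<psi> \<le> expectation (\<lambda>\<omega>. \<phi> (\<omega>, U \<omega>))"
proof -
  have [measurable]: "(\<lambda>\<omega>. \<omega>) \<in> measurable M N"
    using N by (auto simp: measurable_def)
  let ?N = "distr M N (\<lambda>\<omega>. \<omega>)" and ?K = "distr M K U"
  interpret N: prob_space ?N by (rule prob_space_distr) simp
  interpret K: prob_space ?K by (rule prob_space_distr) simp
  interpret P: pair_prob_space ?N ?K ..
  have joint: "?N \<Otimes>\<^sub>M ?K = distr M (N \<Otimes>\<^sub>M K) (\<lambda>\<omega>. (\<omega>, U \<omega>))"
  proof (rule pair_measure_eqI)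
    fix A B assume A: "A \<in> sets ?N" and B: "B \<in> sets ?K"
    then have [measurable]: "A \<in> sets N" "B \<in> sets K" by auto
    have "A \<inter> space M = A" using sets.sets_into_space[of A N] N by auto
    moreover have "(\<lambda>\<omega>. (\<omega>, U \<omega>)) -` (A \<times> B) \<inter> space M = A \<inter> (U -` B \<inter> space M)"
      using calculation by auto
    moreover have "prob (A \<inter> (U -` B \<inter> space M)) = prob A * prob (U -` B \<inter> space M)"
      using A B by (intro indep_setD[OF indep]) auto
    ultimately show "emeasure ?N A * emeasure ?K B = emeasure (distr M (N \<Otimes>\<^sub>M K) (\<lambda>\<omega>. (\<omega>, U \<omega>))) (A \<times> B)"
      by (simp add: emeasure_distr emeasure_eq_measure ennreal_mult[symmetric])
  qed (auto intro: N.sigma_finite_measure_axioms K.sigma_finite_measure_axioms)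
  have int_joint: "integrable (?N \<Otimes>\<^sub>M ?K) \<phi>"
    unfolding joint using int(1) by (subst integrable_distr_eq) auto
  have "expectation \<psi> = (\<integral>\<omega>. \<psi> \<omega> \<partial>?N)"
    by (simp add: integral_distr)
  also have "\<dots> \<le> (\<integral>\<omega>. (\<integral>v. \<phi> (\<omega>, v) \<partial>?K) \<partial>?N)"
    using le int(2) P.integrable_fst'[OF int_joint]
    by (intro integral_mono) (auto simp: integrable_distr_eq)
  also have "\<dots> = (\<integral>z. \<phi> z \<partial>(?N \<Otimes>\<^sub>M ?K))"
    by (rule P.integral_fst'[OF int_joint])
  also have "\<dots> = expectation (\<lambda>\<omega>. \<phi> (\<omega>, U \<omega>))"
    unfolding joint by (subst integral_distr) auto
  finally show ?thesis .
qed

text \<open>For losses and constraints, about which nothing is known off \<open>X\<close>: it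
  suffices that \<open>Y\<close> takes its values in \<open>X\<close>.\<close>

lemma borel_measurable_compose_continuous_on:
  fixes h :: "'b::topological_space \<Rightarrow> 'c::topological_space"
  assumes "continuous_on X h" "Y \<in> borel_measurable N" "\<And>\<omega>. \<omega> \<in> space N \<Longrightarrow> Y \<omega> \<in> X"
  shows "(\<lambda>\<omega>. h (Y \<omega>)) \<in> borel_measurable N"
  using assms
  by (intro measurable_compose[OF measurable_restrict_space2 borel_measurable_continuous_on_restrict[of X h]]) auto

section \<open>The filtration generated by the draws\<close>

definition draw_events :: "'w measure \<Rightarrow> ('n \<Rightarrow> nat \<Rightarrow> 'w \<Rightarrow> real ^ 'p) \<Rightarrow> 'n \<times> nat \<Rightarrow> 'w set set" where
  "draw_events M u = (\<lambda>(i, s). {u i s -` A \<inter> space M | A. A \<in> sets borel})"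

text \<open>Only the sigma-algebra matters here, not the measure. Round \<open>t\<close> is
  excluded: the state at round \<open>t\<close> is to be measurable, the draw of round
  \<open>t\<close> independent.\<close>

definition past :: "'w measure \<Rightarrow> ('n \<Rightarrow> nat \<Rightarrow> 'w \<Rightarrow> real ^ 'p) \<Rightarrow> nat \<Rightarrow> 'w measure" where
  "past M u t = sigma (space M) (\<Union>z\<in>UNIV \<times> {1..<t}. draw_events M u z)"

lemma draw_events_subset: "(\<Union>z\<in>Z. draw_events M u z) \<subseteq> Pow (space M)"
  by (auto simp: draw_events_def)

lemma space_past [simp]: "space (past M u t) = space M"
  by (simp add: past_def space_measure_of_conv)

lemma sets_past: "sets (past M u t) = sigma_sets (space M) (\<Union>z\<in>UNIV \<times> {1..<t}. draw_events M u z)"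
  unfolding past_def by (rule sets_measure_of) (rule draw_events_subset)

lemma sets_past_mono: "s \<le> t \<Longrightarrow> sets (past M u s) \<subseteq> sets (past M u t)"
  unfolding sets_past by (intro sigma_sets_mono' UN_mono) auto

lemma measurable_past_mono: "f \<in> measurable (past M u s) K \<Longrightarrow> s \<le> t \<Longrightarrow> f \<in> measurable (past M u t) K"
  using sets_past_mono[of s t M u] by (auto simp: measurable_def)

lemma measurable_past_draw:
  fixes u :: "'n \<Rightarrow> nat \<Rightarrow> 'w \<Rightarrow> real ^ 'p"
  assumes "1 \<le> s" "s < t"
  shows "u i s \<in> borel_measurable (past M u t)"
proof (rule measurableI)
  fix A :: "(real^'p) set" assume "A \<in> sets borel"
  then have "u i s -` A \<inter> space M \<in> draw_events M u (i, s)"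
    by (auto simp: draw_events_def)
  then have "u i s -` A \<inter> space M \<in> (\<Union>z\<in>UNIV \<times> {1..<t}. draw_events M u z)"
    using assms by (intro UN_I[of "(i, s)"]) auto
  then show "u i s -` A \<inter> space (past M u t) \<in> sets (past M u t)"
    by (simp add: sets_past sigma_sets.Basic)
qed simp

context
  fixes M :: "'w measure" and u :: "'n::finite \<Rightarrow> nat \<Rightarrow> 'w \<Rightarrow> real ^ 'p"
  assumes draws: "indep_sphere_draws M u"
begin

interpretation prob_space M
  using draws by (simp add: indep_sphere_draws_def)

lemma measurable_draw: "1 \<le> t \<Longrightarrow> u i t \<in> borel_measurable M"
  using draws by (auto simp: indep_sphere_draws_def indep_vars_def2)

lemma sets_past_subset: "sets (past M u t) \<subseteq> sets M"
proof -
  have "(\<Union>z\<in>UNIV \<times> {1..<t}. draw_events M u z) \<subseteq> sets M"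
    using measurable_draw by (auto simp: draw_events_def intro!: measurable_sets)
  then show ?thesis unfolding sets_past by (rule sets.sigma_sets_subset)
qed

lemma measurable_past: "f \<in> measurable (past M u t) K \<Longrightarrow> f \<in> measurable M K"
  using sets_past_subset[of t] by (auto simp: measurable_def)

text \<open>Disjoint groups of independent families generate independent sigma-algebras; the two
  groups are all draws of the rounds before \<open>t\<close> and the single draw
  \<open>(i, t)\<close>.\<close>

lemma indep_set_past:
  assumes t: "1 \<le> t"
  shows "indep_set (sets (past M u t)) {u i t -` A \<inter> space M | A. A \<in> sets borel}"
proof -
  let ?E = "draw_events M u"
  define I where "I = case_bool (UNIV \<times> {1..<t}) {(i, t)}"
  have "indep_vars (\<lambda>_. borel) (\<lambda>(i, t). u i t) (UNIV \<times> {1..})"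
    using draws by (simp add: indep_sphere_draws_def)
  then have "indep_sets ?E (UNIV \<times> {1..})"
    unfolding indep_vars_def2 by (simp add: draw_events_def case_prod_unfold)
  then have "indep_sets ?E (\<Union>j\<in>UNIV. I j)"
  proof (rule indep_sets_mono_index[rotated])
    show "(\<Union>j\<in>UNIV. I j) \<subseteq> UNIV \<times> {1..}"
      using t by (auto simp: I_def UNIV_bool)
  qed
  then have "indep_sets (\<lambda>j. sigma_sets (space M) (\<Union>z\<in>I j. ?E z)) UNIV"
  proof (rule indep_sets_collect_sigma)
    show "Int_stable (?E z)" for z
    proof (rule Int_stableI)
      fix a b assume "a \<in> ?E z" "b \<in> ?E z"
      then obtain A A' where "A \<in> sets borel" "A' \<in> sets borel"
        "a = u (fst z) (snd z) -` A \<inter> space M" "b = u (fst z) (snd z) -` A' \<inter> space M"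
        by (auto simp: draw_events_def case_prod_unfold)
      then have "A \<inter> A' \<in> sets borel" "a \<inter> b = u (fst z) (snd z) -` (A \<inter> A') \<inter> space M" by auto
      then show "a \<inter> b \<in> ?E z"
        unfolding draw_events_def case_prod_unfold by blast
    qed
    show "disjoint_family_on I UNIV"
      by (auto simp: disjoint_family_on_def I_def split: bool.splits)
  qed
  also have "(\<lambda>j. sigma_sets (space M) (\<Union>z\<in>I j. ?E z)) =
      case_bool (sets (past M u t)) (sigma_sets (space M) (?E (i, t)))"
    by (auto simp: I_def sets_past fun_eq_iff split: bool.splits)
  finally have *: "indep_set (sets (past M u t)) (sigma_sets (space M) (?E (i, t)))"
    unfolding indep_set_def .
  moreover have "{u i t -` A \<inter> space M | A. A \<in> sets borel} \<subseteq> sigma_sets (space M) (?E (i, t))"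
    by (auto simp: draw_events_def)
  ultimately show ?thesis
    unfolding indep_sets2_eq by blast
qed

end

section \<open>Consensus\<close>

text \<open>The diameter of the agents' positions. It contracts under every row-stochastic matrix
  that has a column bounded away from zero, so no spectral theory is involved.\<close>

definition spread :: "('n::finite \<Rightarrow> 'a::real_normed_vector) \<Rightarrow> real" where
  "spread x = Max (range (\<lambda>(i, j). norm (x i - x j)))"

lemma norm_diff_le_spread: "norm (x i - x j) \<le> spread x"
  unfolding spread_def by (rule Max_ge) (auto intro!: image_eqI[of _ _ "(i, j)"])

lemma spread_leI: "(\<And>i j. norm (x i - x j) \<le> K) \<Longrightarrow> spread x \<le> K"
  unfolding spread_def by (subst Max_le_iff) auto

lemma spread_nonneg: "0 \<le> spread x"
  using norm_diff_le_spread[of x undefined undefined] by simp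

lemma spread_bounded:
  assumes "\<And>i. norm (x i) \<le> R"
  shows "spread x \<le> 2 * R"
  using assms by (intro spread_leI norm_triangle_le_diff) (metis add_mono mult_2)

text \<open>Doeblin's argument: all rows share the mass \<open>\<eta>\<close> in column
  \<open>j0\<close>, which contributes the same vector to both averages and cancels. Only rows of
  mass \<open>1 - \<eta>\<close> are left to disagree.\<close>

lemma spread_contraction:
  fixes x :: "'n::finite \<Rightarrow> 'a::real_normed_vector" and A :: "'n \<Rightarrow> 'n \<Rightarrow> real"
  assumes nonneg: "\<And>i j. 0 \<le> A i j" and rows: "\<And>i. (\<Sum>j\<in>UNIV. A i j) = 1"
    and col: "\<And>i. \<eta> \<le> A i j0" and \<eta>: "\<eta> < 1"
  shows "norm ((\<Sum>j\<in>UNIV. A i j *\<^sub>R x j) - (\<Sum>j\<in>UNIV. A l j *\<^sub>R x j)) \<le> (1 - \<eta>) * spread x"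
proof -
  define C where "C i j = A i j - (if j = j0 then \<eta> else 0)" for i j
  have C: "0 \<le> C i j" for i j using nonneg col by (simp add: C_def)
  have C_rows: "(\<Sum>j\<in>UNIV. C i j) = 1 - \<eta>" for i
    by (simp add: C_def sum_subtractf rows)
  have split: "(\<Sum>j\<in>UNIV. A i j *\<^sub>R x j) = (\<Sum>j\<in>UNIV. C i j *\<^sub>R x j) + \<eta> *\<^sub>R x j0" for i
  proof -
    have "(\<Sum>j\<in>UNIV. A i j *\<^sub>R x j) = (\<Sum>j\<in>UNIV. C i j *\<^sub>R x j + (if j = j0 then \<eta> *\<^sub>R x j else 0))"
      by (rule sum.cong) (auto simp: C_def scaleR_left_diff_distrib)
    then show ?thesis by (simp add: sum.distrib)
  qed
  let ?d = "(\<Sum>j\<in>UNIV. C i j *\<^sub>R x j) - (\<Sum>j\<in>UNIV. C l j *\<^sub>R x j)"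
  \<comment> \<open>The product of the two remaining rows couples them; multiplying by their mass
    \<open>1 - \<eta>\<close> turns the difference of averages into a double sum of differences of
    points.\<close>
  have "(1 - \<eta>) *\<^sub>R ?d = (\<Sum>j\<in>UNIV. \<Sum>k\<in>UNIV. (C i j * C l k) *\<^sub>R (x j - x k))"
  proof -
    have "(\<Sum>j\<in>UNIV. \<Sum>k\<in>UNIV. (C i j * C l k) *\<^sub>R (x j - x k)) =
        (\<Sum>j\<in>UNIV. \<Sum>k\<in>UNIV. C l k *\<^sub>R (C i j *\<^sub>R x j)) - (\<Sum>j\<in>UNIV. \<Sum>k\<in>UNIV. C i j *\<^sub>R (C l k *\<^sub>R x k))"
      by (simp add: scaleR_right_diff_distrib sum_subtractf mult.commute)
    also have "(\<Sum>j\<in>UNIV. \<Sum>k\<in>UNIV. C l k *\<^sub>R (C i j *\<^sub>R x j)) = (1 - \<eta>) *\<^sub>R (\<Sum>j\<in>UNIV. C i j *\<^sub>R x j)"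
      by (simp only: scaleR_left.sum[symmetric] C_rows scaleR_right.sum[symmetric])
    also have "(\<Sum>j\<in>UNIV. \<Sum>k\<in>UNIV. C i j *\<^sub>R (C l k *\<^sub>R x k)) = (1 - \<eta>) *\<^sub>R (\<Sum>j\<in>UNIV. C l j *\<^sub>R x j)"
      by (simp only: scaleR_left.sum[symmetric] C_rows scaleR_right.sum[symmetric])
    finally show ?thesis by (simp add: scaleR_right_diff_distrib)
  qed
  then have "(1 - \<eta>) * norm ?d = norm (\<Sum>j\<in>UNIV. \<Sum>k\<in>UNIV. (C i j * C l k) *\<^sub>R (x j - x k))"
    using \<eta> by (simp flip: \<open>(1 - \<eta>) *\<^sub>R ?d = _\<close>)
  also have "\<dots> \<le> (\<Sum>j\<in>UNIV. \<Sum>k\<in>UNIV. (C i j * C l k) * spread x)"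
    using C norm_diff_le_spread[of x]
    by (intro order_trans[OF norm_sum] sum_mono) (auto intro!: mult_left_mono)
  also have "\<dots> = (1 - \<eta>) * ((1 - \<eta>) * spread x)"
    by (simp only: sum_distrib_right[symmetric] sum_distrib_left[symmetric] C_rows mult.assoc)
  finally have "norm ?d \<le> (1 - \<eta>) * spread x" using \<eta> by simp
  then show ?thesis by (simp add: split)
qed

text \<open>The product \<open>W (t + k - 1) ... W t\<close> of \<open>k\<close> consecutive mixing
  matrices, the latest on the left.\<close>

fun transition :: "(nat \<Rightarrow> real ^ 'n ^ 'n) \<Rightarrow> nat \<Rightarrow> nat \<Rightarrow> 'n \<Rightarrow> 'n::finite \<Rightarrow> real" where
  "transition W t 0 i j = (if i = j then 1 else 0)"
| "transition W t (Suc k) i j = (\<Sum>l\<in>UNIV. W (t + k) $ i $ l * transition W t k l j)"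

lemma rtrancl_leaves_set:
  assumes "(a, b) \<in> D\<^sup>*" "a \<in> S" "b \<notin> S"
  shows "\<exists>(j, i)\<in>D. j \<in> S \<and> i \<notin> S"
  using assms by (induction rule: rtrancl_induct) auto

section \<open>Reachability and contraction over a window of rounds\<close>

locale network =
  fixes E :: "nat \<Rightarrow> ('n::finite \<times> 'n) set" and W :: "nat \<Rightarrow> real ^ 'n ^ 'n" and w :: real and B :: nat
  assumes network: "network_assm E W w B"
begin

lemma w_pos: "0 < w" and w_less_1: "w < 1" and B_pos: "0 < B"
  using network by (auto simp: network_assm_def)

lemma
  assumes t: "t \<ge> 1"
  shows W_nonneg: "0 \<le> W t $ i $ j"
    and W_rows: "(\<Sum>j\<in>UNIV. W t $ i $ j) = 1"
    and W_cols: "(\<Sum>i\<in>UNIV. W t $ i $ j) = 1"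
    and W_edge: "(j, i) \<in> E t \<Longrightarrow> w \<le> W t $ i $ j"
    and W_diag: "w \<le> W t $ i $ i"
    and connected: "(i, j) \<in> (\<Union>l\<in>{0..B-1}. E (t + l))\<^sup>*"
proof -
  have e: "if (j, i) \<in> E t \<or> i = j then w \<le> W t $ i $ j else W t $ i $ j = 0" for i j
    using network t unfolding network_assm_def by blast
  have ds: "doubly_stochastic (W t)" and sc: "strongly_connected_edges (\<Union>l\<in>{0..B-1}. E (t + l))"
    using network t unfolding network_assm_def by blast+
  show "(j, i) \<in> E t \<Longrightarrow> w \<le> W t $ i $ j" "w \<le> W t $ i $ i"
    using e[of j i] e[of i i] by simp_all
  show "0 \<le> W t $ i $ j" "(\<Sum>j\<in>UNIV. W t $ i $ j) = 1" "(\<Sum>i\<in>UNIV. W t $ i $ j) = 1"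
    using ds by (simp_all add: doubly_stochastic_def)
  show "(i, j) \<in> (\<Union>l\<in>{0..B-1}. E (t + l))\<^sup>*"
    using sc unfolding strongly_connected_edges_def by blast
qed

lemma transition_nonneg: "t \<ge> 1 \<Longrightarrow> 0 \<le> transition W t k i j"
  by (induction k arbitrary: i) (auto intro!: sum_nonneg mult_nonneg_nonneg W_nonneg)

lemma transition_rows:
  assumes t: "t \<ge> 1"
  shows "(\<Sum>j\<in>UNIV. transition W t k i j) = 1"
proof (induction k arbitrary: i)
  case (Suc k)
  have "(\<Sum>j\<in>UNIV. transition W t (Suc k) i j) = (\<Sum>l\<in>UNIV. \<Sum>j\<in>UNIV. W (t + k) $ i $ l * transition W t k l j)"
    by (simp del: sum_distrib_left) (rule sum.swap)
  also have "\<dots> = 1"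
    using t by (simp add: sum_distrib_left[symmetric] Suc.IH W_rows)
  finally show ?case .
qed simp

text \<open>Each passage along an edge or a self-loop keeps at least a factor \<open>w\<close>, so
  \<open>w ^ k\<close> is the natural threshold after \<open>k\<close> rounds.\<close>

definition reached :: "nat \<Rightarrow> nat \<Rightarrow> 'n \<Rightarrow> 'n set" where
  "reached t k j0 = {i. w ^ k \<le> transition W t k i j0}"

lemma reached_edge:
  assumes t: "t \<ge> 1" and j: "j \<in> reached t k j0" and w: "w \<le> W (t + k) $ i $ j"
  shows "i \<in> reached t (Suc k) j0"
proof -
  have "w ^ Suc k \<le> W (t + k) $ i $ j * transition W t k j j0"
    using j w w_pos by (auto simp: reached_def intro!: mult_mono)
  also have "\<dots> \<le> (\<Sum>l\<in>UNIV. W (t + k) $ i $ l * transition W t k l j0)"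
    using t by (intro member_le_sum) (auto intro!: mult_nonneg_nonneg W_nonneg transition_nonneg)
  finally show ?thesis by (simp add: reached_def)
qed

lemma reached_Suc: "t \<ge> 1 \<Longrightarrow> reached t k j0 \<subseteq> reached t (Suc k) j0"
  using reached_edge W_diag[of "t + k"] by auto

lemma reached_mono: "t \<ge> 1 \<Longrightarrow> k \<le> k' \<Longrightarrow> reached t k j0 \<subseteq> reached t k' j0"
  by (rule lift_Suc_mono_le[of "\<lambda>k. reached t k j0"]) (use reached_Suc in blast)+

text \<open>Within \<open>B\<close> rounds some edge leads out of the set. Self-loops keep the set
  from shrinking until that edge appears, so its source is still reached then and its target
  joins.\<close>

lemma reached_block:
  assumes t: "t \<ge> 1" and S: "reached t k j0 \<noteq> UNIV" "j0 \<in> reached t k j0"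
  shows "reached t k j0 \<subset> reached t (k + B) j0"
proof -
  obtain i' where "i' \<notin> reached t k j0" using S by auto
  then obtain j i where e: "(j, i) \<in> (\<Union>l\<in>{0..B-1}. E (t + k + l))" "j \<in> reached t k j0" "i \<notin> reached t k j0"
    using rtrancl_leaves_set[OF connected[of "t + k" j0 i'] S(2)] t by auto
  then obtain l where l: "l \<le> B - 1" "(j, i) \<in> E (t + (k + l))" by (auto simp: add.assoc)
  have "j \<in> reached t (k + l) j0" using e reached_mono[OF t, of k "k + l"] by auto
  then have "i \<in> reached t (Suc (k + l)) j0"
    using t l by (intro reached_edge[OF t _ W_edge]) auto
  moreover have "i \<in> reached t (k + B) j0"
  proof -
    have "Suc (k + l) \<le> k + B" using l B_pos by linarith
    then show ?thesis using calculation reached_mono[OF t] by blast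
  qed
  ultimately show ?thesis using e reached_mono[OF t, of k "k + B"] by auto
qed

text \<open>Each block of \<open>B\<close> rounds adds at least one agent until all are reached.
  Hence \<open>CARD('n)\<close> blocks suffice, which is the window length \<open>L\<close>
  below.\<close>

lemma reached_card:
  assumes t: "t \<ge> 1"
  shows "reached t (m * B) j0 = UNIV \<or> card (reached t (m * B) j0) \<ge> m + 1"
proof (induction m)
  case 0
  have "j0 \<in> reached t 0 j0" by (simp add: reached_def)
  then have "0 < card (reached t 0 j0)" by (auto simp: card_gt_0_iff)
  then show ?case by (simp del: card_gt_0_iff card_0_eq)
next
  case (Suc m)
  have "j0 \<in> reached t 0 j0" by (simp add: reached_def)
  then have j0: "j0 \<in> reached t (m * B) j0" using reached_mono[OF t] by blast
  show ?case
  proof (cases "reached t (m * B) j0 = UNIV")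
    case True
    then show ?thesis using reached_mono[OF t, of "m * B" "Suc m * B"] by auto
  next
    case False
    have "card (reached t (m * B) j0) < card (reached t (m * B + B) j0)"
      by (rule psubset_card_mono[OF _ reached_block[OF t False j0]]) simp
    then show ?thesis using Suc False by (simp add: add.commute)
  qed
qed

definition L where "L = CARD('n) * B"
definition \<eta> where "\<eta> = w ^ L"

lemma L_pos: "L > 0" by (simp add: L_def B_pos)

lemma \<eta>_pos: "0 < \<eta>" by (simp add: \<eta>_def w_pos)

lemma \<eta>_less_1: "\<eta> < 1"
  using w_pos w_less_1 L_pos by (simp add: \<eta>_def power_less_one_iff)

lemma transition_L_ge:
  assumes "t \<ge> 1"
  shows "\<eta> \<le> transition W t L i j"
proof -
  have "card (reached t L j) \<le> CARD('n)" by (rule card_mono) auto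
  then have "reached t L j = UNIV" using reached_card[OF assms, of "CARD('n)" j] by (auto simp: L_def)
  then show ?thesis by (auto simp: reached_def \<eta>_def)
qed

text \<open>The contraction over \<open>L\<close> rounds is summed over all rounds: the sum of
  spreads reappears on the right with factor \<open>1 - \<eta>\<close>, and moving it to the left
  gives the division by \<open>\<eta>\<close>. The first \<open>L\<close> rounds cost
  \<open>2 * R\<close> each, and every error occurs in at most \<open>L\<close> windows.\<close>

lemma sum_spread_le:
  fixes x e :: "nat \<Rightarrow> 'n \<Rightarrow> 'a::real_normed_vector"
  assumes step: "\<And>t i. t \<ge> 1 \<Longrightarrow> x (t + 1) i = (\<Sum>j\<in>UNIV. W t $ i $ j *\<^sub>R x t j) + e t i"
    and bound: "\<And>t i. t \<ge> 1 \<Longrightarrow> norm (x t i) \<le> R"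
  shows "(\<Sum>t=1..T. spread (x t)) \<le> 2 * real L / \<eta> * (R + (\<Sum>t=1..T. \<Sum>i\<in>UNIV. norm (e t i)))"
proof -
  define err where "err t = (\<Sum>i\<in>UNIV. norm (e t i))" for t
  have err: "0 \<le> err t" "norm (e t i) \<le> err t" for t i
    unfolding err_def by (auto intro: sum_nonneg member_le_sum)
  \<comment> \<open>The deviation from pure mixing since round \<open>t\<close> is the accumulated
    error: stochastic rows do not enlarge earlier errors.\<close>
  have dev: "norm (x (t + k) i - (\<Sum>j\<in>UNIV. transition W t k i j *\<^sub>R x t j)) \<le> (\<Sum>l<k. err (t + l))"
    if t: "t \<ge> 1" for t k i
  proof (induction k arbitrary: i)
    case 0
    have "(\<Sum>j\<in>UNIV. transition W t 0 i j *\<^sub>R x t j) = (\<Sum>j\<in>UNIV. if j = i then x t j else 0)"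
      by (rule sum.cong) auto
    then show ?case by simp
  next
    case (Suc k)
    let ?y = "\<lambda>l. \<Sum>j\<in>UNIV. transition W t k l j *\<^sub>R x t j"
    have "(\<Sum>j\<in>UNIV. transition W t (Suc k) i j *\<^sub>R x t j) = (\<Sum>l\<in>UNIV. W (t + k) $ i $ l *\<^sub>R ?y l)"
      by (simp add: scaleR_sum_left scaleR_sum_right) (rule sum.swap)
    then have "x (t + Suc k) i - (\<Sum>j\<in>UNIV. transition W t (Suc k) i j *\<^sub>R x t j) =
        (\<Sum>l\<in>UNIV. W (t + k) $ i $ l *\<^sub>R (x (t + k) l - ?y l)) + e (t + k) i"
      using step[of "t + k" i] t by (simp add: scaleR_right_diff_distrib sum_subtractf)
    also have "norm \<dots> \<le> (\<Sum>l\<in>UNIV. W (t + k) $ i $ l * (\<Sum>l<k. err (t + l))) + err (t + k)"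
      using t Suc.IH W_nonneg[of "t + k"]
      by (intro norm_triangle_le add_mono order_trans[OF norm_sum] sum_mono err)
        (auto intro!: mult_left_mono)
    also have "\<dots> = (\<Sum>l<Suc k. err (t + l))"
      using t W_rows[of "t + k" i] by (simp add: sum_distrib_right[symmetric])
    finally show ?case .
  qed
  have contract: "spread (x (t + L)) \<le> (1 - \<eta>) * spread (x t) + 2 * (\<Sum>l<L. err (t + l))" if t: "t \<ge> 1" for t
  proof (rule spread_leI)
    fix i j
    let ?y = "\<lambda>i. \<Sum>j\<in>UNIV. transition W t L i j *\<^sub>R x t j"
    have "norm (?y i - ?y j) \<le> (1 - \<eta>) * spread (x t)"
      using spread_contraction[of "transition W t L" \<eta> undefined i "x t" j] t
      by (simp add: transition_nonneg transition_rows transition_L_ge \<eta>_less_1)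
    moreover have "norm (x (t + L) i - x (t + L) j) \<le>
        norm (x (t + L) i - ?y i) + norm (?y i - ?y j) + norm (x (t + L) j - ?y j)"
      by norm
    ultimately show "norm (x (t + L) i - x (t + L) j) \<le> (1 - \<eta>) * spread (x t) + 2 * (\<Sum>l<L. err (t + l))"
      using dev[OF t, of L i] dev[OF t, of L j] by linarith
  qed
  let ?D = "\<lambda>t. spread (x t)"
  \<comment> \<open>For \<open>T < L\<close> the truncated difference \<open>T - L\<close> is 0 and
    the left-hand sum is empty.\<close>
  have sub: "(\<Sum>t=1..T-L. a (t + l)) \<le> (\<Sum>t=1..T. a t)" if "l \<le> L" "\<And>t. (0::real) \<le> a t" for l and a :: "nat \<Rightarrow> real"
  proof -
    have "(\<Sum>t=1..T-L. a (t + l)) = (\<Sum>t=1+l..T-L+l. a t)" by (rule sum.shift_bounds_cl_nat_ivl[symmetric])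
    also have "\<dots> \<le> (\<Sum>t=1..T. a t)"
    proof (cases "T \<ge> L")
      case True
      then show ?thesis using that by (intro sum_mono2) auto
    next
      case False
      then show ?thesis using that by (simp add: sum_nonneg)
    qed
    finally show ?thesis .
  qed
  have "(\<Sum>t=1..T. ?D t) \<le> (\<Sum>t=1..L. ?D t) + (\<Sum>t=1..T-L. ?D (t + L))"
  proof (cases "T \<ge> L")
    case True
    have "{1..T} = {1..L} \<union> {1+L..T-L+L}" using True by auto
    then have "(\<Sum>t=1..T. ?D t) = (\<Sum>t=1..L. ?D t) + (\<Sum>t=1+L..T-L+L. ?D t)"
      by (simp only:) (rule sum.union_disjoint, auto)
    then show ?thesis by (simp only: sum.shift_bounds_cl_nat_ivl)
  next
    case False
    then have "(\<Sum>t=1..T. ?D t) \<le> (\<Sum>t=1..L. ?D t)" by (intro sum_mono2) (auto simp: spread_nonneg)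
    then show ?thesis using False by simp
  qed
  also have "(\<Sum>t=1..L. ?D t) \<le> (\<Sum>t=1..L. 2 * R)"
    using bound by (intro sum_mono spread_bounded) auto
  also have "(\<Sum>t=1..T-L. ?D (t + L)) \<le> (\<Sum>t=1..T-L. (1 - \<eta>) * ?D t + 2 * (\<Sum>l<L. err (t + l)))"
    by (intro sum_mono contract) auto
  also have "\<dots> = (1 - \<eta>) * (\<Sum>t=1..T-L. ?D (t + 0)) + 2 * (\<Sum>l<L. \<Sum>t=1..T-L. err (t + l))"
    by (simp add: sum.distrib sum_distrib_left) (rule sum.swap)
  also have "\<dots> \<le> (1 - \<eta>) * (\<Sum>t=1..T. ?D t) + 2 * (\<Sum>l<L. \<Sum>t=1..T. err t)"
    using \<eta>_less_1 err by (intro add_mono mult_left_mono sum_mono sub) (auto simp: spread_nonneg)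
  finally have "\<eta> * (\<Sum>t=1..T. ?D t) \<le> 2 * real L * (R + (\<Sum>t=1..T. err t))"
    by (simp add: algebra_simps)
  then show ?thesis
    using \<eta>_pos by (simp add: field_simps err_def)
qed

end

section \<open>Auxiliary inequalities\<close>

lemma norm_column_le_spectral_norm:
  fixes A :: "nat \<Rightarrow> real ^ 'p"
  assumes "k < d"
  shows "norm (A k) \<le> spectral_norm d A"
proof -
  let ?e = "\<lambda>l. if l = k then 1 else (0::real)"
  \<comment> \<open>The supremum in \<open>spectral_norm\<close> can be used only once it is known
    to be finite; the sum of the column norms bounds it.\<close>
  have "norm (\<Sum>l<d. v l *\<^sub>R A l) \<le> (\<Sum>l<d. norm (A l))" if "L2_set v {..<d} \<le> 1" for v
  proof (intro order_trans[OF norm_sum] sum_mono)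
    fix l assume "l \<in> {..<d}"
    then have "\<bar>v l\<bar> \<le> L2_set (\<lambda>l. \<bar>v l\<bar>) {..<d}" by (intro member_le_L2_set) auto
    also have "\<dots> \<le> 1" using that by (simp add: L2_set_def)
    finally show "norm (v l *\<^sub>R A l) \<le> norm (A l)"
      using mult_right_mono[of "\<bar>v l\<bar>" 1 "norm (A l)"] by simp
  qed
  then have "bdd_above ((\<lambda>v. norm (\<Sum>l<d. v l *\<^sub>R A l)) ` {v. L2_set v {..<d} \<le> 1})"
    by (intro bdd_aboveI2) auto
  moreover have "L2_set ?e {..<d} \<le> 1"
    using assms by (simp add: L2_set_def if_distrib[of "\<lambda>x. x\<^sup>2"] cong: if_cong)
  ultimately have "norm (\<Sum>l<d. ?e l *\<^sub>R A l) \<le> spectral_norm d A"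
    unfolding spectral_norm_def by (intro cSUP_upper) auto
  moreover have "(\<Sum>l<d. ?e l *\<^sub>R A l) = A k"
    using assms by (simp add: if_distrib[of "\<lambda>x. x *\<^sub>R _"] cong: if_cong)
  ultimately show ?thesis by simp
qed

lemma subgradient_bound_imp_lipschitz:
  assumes "\<And>z. z \<in> X \<Longrightarrow> \<exists>v. subgradient_on X h z v \<and> norm v \<le> K"
    and "a \<in> X" "b \<in> X"
  shows "\<bar>h a - h b\<bar> \<le> K * norm (a - b)"
proof -
  have *: "h a - h b \<le> K * norm (a - b)" if "a \<in> X" "b \<in> X" for a b
  proof -
    obtain v where v: "subgradient_on X h a v" "norm v \<le> K" using assms(1)[OF \<open>a \<in> X\<close>] by blast
    have "h b \<ge> h a + v \<bullet> (b - a)" using v that by (auto simp: subgradient_on_def)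
    moreover have "- (v \<bullet> (b - a)) \<le> K * norm (a - b)"
      using Cauchy_Schwarz_ineq2[of v "b - a"] mult_right_mono[OF v(2), of "norm (b - a)"]
      by (simp add: norm_minus_commute)
    ultimately show ?thesis by simp
  qed
  show ?thesis using *[of a b] *[of b a] assms(2,3) by (simp add: norm_minus_commute abs_le_iff)
qed

text \<open>Jensen's inequality for the square, obtained from the nonnegativity of the weighted
  variance about the mean \<open>b\<close>.\<close>

lemma norm_weighted_sum_power2_le:
  fixes y :: "'n::finite \<Rightarrow> 'a::real_inner"
  assumes "\<And>j. 0 \<le> p j" "(\<Sum>j\<in>UNIV. p j) = 1"
  shows "(norm (\<Sum>j\<in>UNIV. p j *\<^sub>R y j))\<^sup>2 \<le> (\<Sum>j\<in>UNIV. p j * (norm (y j))\<^sup>2)"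
proof -
  define b where "b = (\<Sum>j\<in>UNIV. p j *\<^sub>R y j)"
  have eq: "p j * (norm (y j - b))\<^sup>2 = p j * (norm (y j))\<^sup>2 - 2 * ((p j *\<^sub>R y j) \<bullet> b) + p j * (b \<bullet> b)" for j
    by (simp add: power2_norm_eq_inner inner_diff_left inner_diff_right inner_commute algebra_simps)
  have 1: "(\<Sum>j\<in>UNIV. p j * (b \<bullet> b)) = b \<bullet> b"
    by (simp add: sum_distrib_right[symmetric] assms)
  have 2: "(\<Sum>j\<in>UNIV. 2 * ((p j *\<^sub>R y j) \<bullet> b)) = 2 * (b \<bullet> b)"
    unfolding sum_distrib_left[symmetric] inner_sum_left[symmetric] b_def[symmetric] ..
  have "0 \<le> (\<Sum>j\<in>UNIV. p j * (norm (y j - b))\<^sup>2)"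
    using assms by (intro sum_nonneg mult_nonneg_nonneg) auto
  also have "\<dots> = (\<Sum>j\<in>UNIV. p j * (norm (y j))\<^sup>2) - 2 * (b \<bullet> b) + b \<bullet> b"
    unfolding eq sum.distrib sum_subtractf 1 2 ..
  finally show ?thesis by (simp add: power2_norm_eq_inner b_def)
qed

text \<open>Abel summation: each increment of the weight \<open>h\<close> meets a value of
  \<open>V\<close> that is at most \<open>Vm\<close>. The induction needs the stronger bound with
  \<open>Vm - V (T + 1)\<close>.\<close>

lemma sum_telescope_weighted_le:
  fixes h V :: "nat \<Rightarrow> real"
  assumes h: "\<And>t. t \<ge> 1 \<Longrightarrow> 0 \<le> h t" "\<And>t. t \<ge> 1 \<Longrightarrow> h t \<le> h (t + 1)"
    and V: "\<And>t. t \<ge> 1 \<Longrightarrow> 0 \<le> V t" "\<And>t. t \<ge> 1 \<Longrightarrow> V t \<le> Vm"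
  shows "(\<Sum>t=1..T. h (t + 1) * (V t - V (t + 1))) \<le> h (T + 1) * Vm"
proof -
  have Vm: "0 \<le> Vm" using V(1)[of 1] V(2)[of 1] by simp
  have "(\<Sum>t=1..T. h (t + 1) * (V t - V (t + 1))) \<le> h (T + 1) * (Vm - V (T + 1))"
  proof (induction T)
    case 0
    then show ?case using h(1)[of 1] V(2)[of 1] by simp
  next
    case (Suc T)
    have "h (T + 1) * (Vm - V (T + 1)) \<le> h (T + 2) * (Vm - V (T + 1))"
      using h(2)[of "T + 1"] V(2)[of "T + 1"] by (intro mult_right_mono) auto
    with Suc show ?case by (simp add: algebra_simps)
  qed
  also have "\<dots> \<le> h (T + 1) * Vm"
    using h(1)[of "T + 1"] V(1)[of "T + 1"] by (intro mult_left_mono) auto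
  finally show ?thesis .
qed

text \<open>By the mean value theorem each term is at most an increment of
  \<open>t powr p / p\<close>. The first term is treated apart because the derivative formula fails
  at 0.\<close>

lemma powr_sum_le:
  assumes p: "0 < p" "p \<le> 1"
  shows "(\<Sum>t=1..T. real t powr (p - 1)) \<le> real T powr p / p"
proof (induction T)
  case (Suc T)
  have "p * real (Suc T) powr (p - 1) \<le> real (Suc T) powr p - real T powr p"
  proof (cases "T = 0")
    case True
    then show ?thesis using p by simp
  next
    case False
    have "\<exists>z. real T < z \<and> z < real T + 1 \<and>
        (real T + 1) powr p - real T powr p = ((real T + 1) - real T) * (p * z powr (p - 1))"
      using False by (intro MVT2) (auto intro!: derivative_eq_intros)
    then obtain z where z: "real T < z" "z < real T + 1"
      "(real T + 1) powr p - real T powr p = p * z powr (p - 1)" by auto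
    have "(real T + 1) powr (p - 1) \<le> z powr (p - 1)"
      using z p False by (intro powr_mono2') auto
    then show ?thesis using z p by (simp add: add.commute mult_left_mono)
  qed
  then have "real (Suc T) powr (p - 1) \<le> (real (Suc T) powr p - real T powr p) / p"
    using p by (simp add: field_simps)
  then show ?case using Suc by (simp add: diff_divide_distrib)
qed simp

text \<open>Clipping at 0 does not move away from \<open>\<mu> \<ge> 0\<close>, so the square can be
  expanded with the drift \<open>b - be * q\<close>. The regularisation enters through
  \<open>q * (q - \<mu>) \<ge> (q\<^sup>2 - \<mu>\<^sup>2) / 2\<close>.\<close>

lemma dual_step:
  fixes q b :: real
  assumes "\<mu> \<ge> 0" "ga > 0" "be \<ge> 0" and H: "\<bar>b - be * q\<bar> \<le> H"
  shows "q * b \<ge> ((max 0 ((1 - be * ga) * q + ga * b) - \<mu>)\<^sup>2 - (q - \<mu>)\<^sup>2) / (2 * ga)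
    + \<mu> * b + be / 2 * q\<^sup>2 - be / 2 * \<mu>\<^sup>2 - ga * H\<^sup>2 / 2"
proof -
  let ?w = "(1 - be * ga) * q + ga * b"
  have "(max 0 ?w - \<mu>)\<^sup>2 \<le> (?w - \<mu>)\<^sup>2"
    using assms by (intro abs_le_square_iff[THEN iffD1]) auto
  also have "?w - \<mu> = (q - \<mu>) + ga * (b - be * q)" by (simp add: algebra_simps)
  also have "((q - \<mu>) + ga * (b - be * q))\<^sup>2 = (q - \<mu>)\<^sup>2 + 2 * ga * ((q - \<mu>) * (b - be * q)) + ga\<^sup>2 * (b - be * q)\<^sup>2"
    by (simp add: power2_eq_square algebra_simps)
  also have "(b - be * q)\<^sup>2 \<le> H\<^sup>2" using H by (metis abs_ge_zero power2_abs power_mono)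
  finally have "((max 0 ?w - \<mu>)\<^sup>2 - (q - \<mu>)\<^sup>2) \<le> 2 * ga * ((q - \<mu>) * (b - be * q)) + ga\<^sup>2 * H\<^sup>2"
    by (simp add: mult_left_mono)
  then have "((max 0 ?w - \<mu>)\<^sup>2 - (q - \<mu>)\<^sup>2) / (2 * ga) \<le> (q - \<mu>) * (b - be * q) + ga * H\<^sup>2 / 2"
    using assms by (simp add: field_simps power2_eq_square)
  moreover have "be * (q - \<mu>)\<^sup>2 \<ge> 0" using assms by simp
  ultimately show ?thesis by (simp add: power2_eq_square algebra_simps)
qed

text \<open>The variational inequality of the projection, rewritten by the three-point identity. The
  term with \<open>norm (x' - z)\<close> is kept: it is the negative square that later pays for
  displacements.\<close>

lemma closest_point_step:
  fixes K :: "'a::euclidean_space set"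
  assumes "convex K" "closed K" "v \<in> K" "a > 0"
    and x': "x' = closest_point K (z - a *\<^sub>R \<omega>)"
  shows "\<omega> \<bullet> (x' - v) \<le> ((norm (z - v))\<^sup>2 - (norm (x' - v))\<^sup>2 - (norm (x' - z))\<^sup>2) / (2 * a)"
proof -
  have "((z - a *\<^sub>R \<omega>) - x') \<bullet> (v - x') \<le> 0"
    unfolding x' using assms by (intro closest_point_dot) auto
  then have "a * (\<omega> \<bullet> (x' - v)) \<le> (z - x') \<bullet> (x' - v)"
    by (simp add: inner_diff_left inner_diff_right algebra_simps)
  also have "\<dots> = ((norm (z - v))\<^sup>2 - (norm (x' - v))\<^sup>2 - (norm (x' - z))\<^sup>2) / 2"
    by (simp add: power2_norm_eq_inner inner_diff_left inner_diff_right inner_commute)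
  finally show ?thesis using assms(4) by (simp add: field_simps)
qed

text \<open>A point of the small ball is a convex combination, with weights \<open>1 - s\<close> and
  \<open>s\<close>, of a point of \<open>X\<close> and a point of \<open>cball 0 r\<close>. With
  \<open>s = \<xi> t\<close> the radius is exactly \<open>\<delta> t\<close>, so perturbed decisions
  stay in \<open>X\<close>.\<close>

lemma mem_scaled_translate:
  assumes X: "convex X" "cball 0 r \<subseteq> X" and s: "0 < s" "s < 1" and r: "0 < r"
    and x: "x \<in> (\<lambda>z. (1 - s) *\<^sub>R z) ` X"
  shows "cball x (r * s) \<subseteq> (X :: 'a::real_normed_vector set)"
proof
  fix y assume y: "y \<in> cball x (r * s)"
  obtain z where z: "z \<in> X" "x = (1 - s) *\<^sub>R z" using x by auto
  let ?b = "(1 / s) *\<^sub>R (y - x)"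
  have "norm ?b \<le> r"
  proof -
    have "norm ?b = norm (x - y) / s" using s by (simp only: norm_scaleR) (simp add: norm_minus_commute)
    also have "\<dots> \<le> r" using y s by (simp add: dist_norm divide_le_eq)
    finally show ?thesis .
  qed
  then have "?b \<in> X" using X by auto
  then have "(1 - s) *\<^sub>R z + s *\<^sub>R ?b \<in> X"
    using X z s by (intro convexD) auto
  then show "y \<in> X" using z s by simp
qed

text \<open>The two-point difference is of order \<open>d\<close>, which cancels the division by
  \<open>d\<close>: the estimators stay bounded although \<open>\<delta> t\<close> tends to
  0.\<close>

lemma norm_grad_est_le:
  fixes x v :: "real ^ 'p"
  assumes "\<bar>h (x + d *\<^sub>R v) - h x\<bar> \<le> K * norm (d *\<^sub>R v)" "d > 0" "norm v = 1"
  shows "norm (grad_est d h x v) \<le> real CARD('p) * K"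
proof -
  have "norm (grad_est d h x v) = real CARD('p) / d * \<bar>h (x + d *\<^sub>R v) - h x\<bar>"
    using assms by (simp add: grad_est_def abs_mult)
  also have "\<dots> \<le> real CARD('p) / d * (K * d)"
    using assms by (intro mult_left_mono) auto
  finally show ?thesis using assms by simp
qed

text \<open>Completing the square; this is how a displacement \<open>s\<close> with coefficient
  \<open>k\<close> is absorbed.\<close>

lemma linear_minus_square_le:
  fixes k s a :: real
  assumes "a > 0"
  shows "k * s - s\<^sup>2 / (2 * a) \<le> k\<^sup>2 * a / 2"
proof -
  have "0 \<le> (s - k * a)\<^sup>2 / (2 * a)" using assms by simp
  also have "\<dots> = s\<^sup>2 / (2 * a) - k * s + k\<^sup>2 * a / 2"
    using assms by (simp add: power2_eq_square field_simps)
  finally show ?thesis by simp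
qed

lemma power2_norm_perturb:
  fixes a b :: "'a::real_normed_vector"
  assumes "norm a \<le> 2 * R" "norm b \<le> 2 * R" "norm (a - b) \<le> s"
  shows "(norm a)\<^sup>2 \<le> (norm b)\<^sup>2 + 4 * R * s"
proof -
  have "(norm a)\<^sup>2 - (norm b)\<^sup>2 = (norm a - norm b) * (norm a + norm b)"
    by (simp add: power2_eq_square algebra_simps)
  also have "\<dots> \<le> \<bar>norm a - norm b\<bar> * (norm a + norm b)"
    by (intro mult_right_mono) auto
  also have "\<dots> \<le> s * (4 * R)"
    using assms norm_triangle_ineq3[of a b] by (intro mult_mono) auto
  finally show ?thesis by (simp add: mult_ac)
qed

section \<open>Problem data and parameter sequences\<close>

locale problem = network E W w B
  for E :: "nat \<Rightarrow> ('n::finite \<times> 'n) set" and W :: "nat \<Rightarrow> real ^ 'n ^ 'n" and w :: real and B :: nat +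
  fixes X :: "(real ^ 'p) set" and r R :: real and m :: "'n \<Rightarrow> nat"
    and f :: "'n \<Rightarrow> nat \<Rightarrow> real ^ 'p \<Rightarrow> real"
    and g :: "'n \<Rightarrow> nat \<Rightarrow> real ^ 'p \<Rightarrow> nat \<Rightarrow> real"
    and F1 F2 c \<kappa> :: real and \<alpha> \<beta> \<gamma> \<tau> \<xi> \<delta> \<Psi> :: "nat \<Rightarrow> real"
  assumes convex_problem: "convex_problem_assm X r R m f g F1 F2"
    and c: "c > 1" and \<kappa>: "0 < \<kappa>" "\<kappa> < 1"
    and \<tau>: "\<And>t. t \<ge> 1 \<Longrightarrow> \<tau> t = 1 / c ^ t"
    and \<Psi>: "\<And>t. t \<ge> 1 \<Longrightarrow> \<Psi> t = (\<Sum>k=1..t. \<tau> k)"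
    and \<alpha>: "\<And>t. t \<ge> 1 \<Longrightarrow> \<alpha> t = sqrt (\<Psi> t / real t)"
    and \<beta>: "\<And>t. t \<ge> 1 \<Longrightarrow> \<beta> t = 1 / real t powr \<kappa>"
    and \<gamma>: "\<And>t. t \<ge> 1 \<Longrightarrow> \<gamma> t = 1 / real t powr (1 - \<kappa>)"
    and \<xi>: "\<And>t. t \<ge> 1 \<Longrightarrow> \<xi> t = 1 / (real t + 1)"
    and \<delta>: "\<And>t. t \<ge> 1 \<Longrightarrow> \<delta> t = r / (real t + 1)"
begin

abbreviation gpos :: "'n \<Rightarrow> nat \<Rightarrow> nat \<Rightarrow> real ^ 'p \<Rightarrow> real" where
  "gpos i t k z \<equiv> max 0 (g i t z k)"

lemma X: "convex X" "closed X" "cball 0 r \<subseteq> X" "r > 0" "R > 0"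
  and norm_X: "z \<in> X \<Longrightarrow> norm z \<le> R"
  using convex_problem unfolding convex_problem_assm_def by (simp_all add: subset_iff)

lemma zero_in_X: "0 \<in> X"
  using X by auto

lemma convex_f: "t \<ge> 1 \<Longrightarrow> convex_on X (f i t)"
  and convex_gpos: "t \<ge> 1 \<Longrightarrow> k < m i \<Longrightarrow> convex_on X (gpos i t k)"
proof -
  assume t: "t \<ge> 1"
  then show "convex_on X (f i t)" using convex_problem by (auto simp: convex_problem_assm_def)
  assume "k < m i"
  then have g: "convex_on X (\<lambda>z. g i t z k)" using t convex_problem by (auto simp: convex_problem_assm_def)
  show "convex_on X (gpos i t k)"
  proof (rule convex_onI)
    fix s :: real and x y :: "real ^ 'p" assume s: "0 < s" "s < 1" and xy: "x \<in> X" "y \<in> X"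
    have "g i t ((1 - s) *\<^sub>R x + s *\<^sub>R y) k \<le> (1 - s) * g i t x k + s * g i t y k"
      using convex_onD[OF g, of s x y] s xy by simp
    also have "\<dots> \<le> (1 - s) * gpos i t k x + s * gpos i t k y"
      using s by (intro add_mono mult_left_mono) auto
    finally show "gpos i t k ((1 - s) *\<^sub>R x + s *\<^sub>R y) \<le> (1 - s) * gpos i t k x + s * gpos i t k y"
      using s by (auto intro!: add_nonneg_nonneg mult_nonneg_nonneg)
  qed (rule X)
qed

lemma f_diff_le_F1: "t \<ge> 1 \<Longrightarrow> z \<in> X \<Longrightarrow> z' \<in> X \<Longrightarrow> \<bar>f i t z - f i t z'\<bar> \<le> F1"
  using convex_problem by (auto simp: convex_problem_assm_def)

lemma f_lipschitz:
  assumes "t \<ge> 1" "z \<in> X" "z' \<in> X"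
  shows "\<bar>f i t z - f i t z'\<bar> \<le> F2 * norm (z - z')"
  using assms convex_problem
  by (intro subgradient_bound_imp_lipschitz[of X "f i t"]) (simp_all add: convex_problem_assm_def)

lemma F2_nonneg: "0 \<le> F2"
proof -
  obtain v :: "real^'p" where "norm v \<le> F2"
    using convex_problem zero_in_X unfolding convex_problem_assm_def by blast
  then show ?thesis using norm_ge_zero order_trans by blast
qed

lemma F1_nonneg: "0 \<le> F1"
  using f_diff_le_F1[of 1 0 0 undefined] zero_in_X by simp

lemma gpos_lipschitz:
  assumes t: "t \<ge> 1" and k: "k < m i" and z: "z \<in> X" "z' \<in> X"
  shows "\<bar>gpos i t k z - gpos i t k z'\<bar> \<le> F2 * norm (z - z')"
proof -
  have "\<exists>v. subgradient_on X (\<lambda>z'. g i t z' k) z v \<and> norm v \<le> F2" if z: "z \<in> X" for z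
  proof -
    obtain A where "\<forall>k<m i. subgradient_on X (\<lambda>z'. g i t z' k) z (A k)" "spectral_norm (m i) A \<le> F2"
      using convex_problem z t unfolding convex_problem_assm_def by blast
    then show ?thesis using norm_column_le_spectral_norm[OF k, of A] k by (intro exI[of _ "A k"]) auto
  qed
  then have "\<bar>g i t z k - g i t z' k\<bar> \<le> F2 * norm (z - z')"
    using z by (intro subgradient_bound_imp_lipschitz[of X "\<lambda>z. g i t z k"])
  then show ?thesis by linarith
qed

lemma gpos_le_F1:
  assumes t: "t \<ge> 1" and k: "k < m i" and z: "z \<in> X"
  shows "gpos i t k z \<le> F1"
proof -
  have "\<bar>g i t z k\<bar> \<le> L2_set (\<lambda>k. \<bar>g i t z k\<bar>) {..<m i}" using k by (intro member_le_L2_set) auto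
  also have "\<dots> = L2_set (g i t z) {..<m i}" by (simp add: L2_set_def)
  also have "\<dots> \<le> F1" using convex_problem t z by (auto simp: convex_problem_assm_def)
  finally show ?thesis using F1_nonneg by simp
qed

definition shrunk :: "nat \<Rightarrow> (real ^ 'p) set" where
  "shrunk t = (\<lambda>z. (1 - \<xi> t) *\<^sub>R z) ` X"

lemma \<xi>_bounds: "t \<ge> 1 \<Longrightarrow> 0 < \<xi> t \<and> \<xi> t < 1" and \<xi>_antimono: "t \<ge> 1 \<Longrightarrow> \<xi> (t + 1) \<le> \<xi> t"
  and \<delta>_eq: "t \<ge> 1 \<Longrightarrow> \<delta> t = r * \<xi> t" and \<delta>_pos: "t \<ge> 1 \<Longrightarrow> 0 < \<delta> t"
  using X by (simp_all add: \<xi> \<delta> frac_le)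

lemma shrunk: "convex (shrunk t)" "closed (shrunk t)" "shrunk t \<noteq> {}"
  using X zero_in_X by (auto simp: shrunk_def convex_scaling closed_scaling)

lemma cball_shrunk: "t \<ge> 1 \<Longrightarrow> z \<in> shrunk t \<Longrightarrow> cball z (\<delta> t) \<subseteq> X"
  unfolding \<delta>_eq shrunk_def by (rule mem_scaled_translate) (use X \<xi>_bounds in auto)

lemma shrunk_subset: "t \<ge> 1 \<Longrightarrow> shrunk t \<subseteq> X"
proof
  fix z assume "t \<ge> 1" "z \<in> shrunk t"
  then have "cball z (\<delta> t) \<subseteq> X" "z \<in> cball z (\<delta> t)"
    using cball_shrunk \<delta>_pos[of t] by auto
  then show "z \<in> X" by blast
qed

text \<open>The comparator of round \<open>t\<close> lies in \<open>shrunk t\<close>, whereas the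
  step of round \<open>t\<close> projects onto \<open>shrunk (t + 1)\<close>. The inclusion holds
  because \<open>X\<close> is star-shaped about 0.\<close>

lemma shrunk_mono:
  assumes "t \<ge> 1"
  shows "shrunk t \<subseteq> shrunk (t + 1)"
proof
  fix y assume "y \<in> shrunk t"
  then obtain z where z: "z \<in> X" "y = (1 - \<xi> t) *\<^sub>R z" by (auto simp: shrunk_def)
  define a b where "a = 1 - \<xi> t" and "b = 1 - \<xi> (t + 1)"
  have ab: "0 < a" "a \<le> b"
    using \<xi>_bounds[OF assms] \<xi>_antimono[OF assms] by (auto simp: a_def b_def)
  have "(a / b) *\<^sub>R z \<in> X"
    using convexD[OF X(1) z(1) zero_in_X, of "a / b" "1 - a / b"] ab by simp
  moreover have "y = b *\<^sub>R ((a / b) *\<^sub>R z)" using z ab by (simp add: a_def)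
  ultimately show "y \<in> shrunk (t + 1)" unfolding shrunk_def b_def by blast
qed

section \<open>Thresholds, step sizes and their sums\<close>

lemma \<tau>_pos: "t \<ge> 1 \<Longrightarrow> 0 < \<tau> t"
  using c by (simp add: \<tau>)

text \<open>The value of the whole geometric series: the triggering thresholds cost only a constant
  in total.\<close>

definition \<tau>sum :: real where "\<tau>sum = 1 / (c - 1)"

lemma \<tau>sum_pos: "0 < \<tau>sum" using c by (simp add: \<tau>sum_def)

lemma sum_\<tau>_le: "(\<Sum>t=1..T. \<tau> t) \<le> \<tau>sum"
proof -
  have "(\<Sum>t=1..T. \<tau> t) = (1 - 1 / c ^ T) / (c - 1)"
  proof (induction T)
    case (Suc T)
    have "(1 - 1 / a) / (c - 1) + 1 / (c * a) = (1 - 1 / (c * a)) / (c - 1)" if "a > 0" for a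
      using c that by (simp add: field_simps)
    from this[of "c ^ T"] show ?case using c Suc by (simp add: \<tau>)
  qed simp
  also have "\<dots> \<le> \<tau>sum" using c by (simp add: \<tau>sum_def divide_right_mono)
  finally show ?thesis .
qed

lemma \<Psi>_bounds:
  assumes "t \<ge> 1"
  shows "1 / c \<le> \<Psi> t" "\<Psi> t \<le> \<tau>sum"
proof -
  have "\<tau> 1 \<le> (\<Sum>k=1..t. \<tau> k)"
    using assms \<tau>_pos by (intro member_le_sum) (auto simp: less_imp_le)
  then show "1 / c \<le> \<Psi> t" using assms by (simp add: \<Psi> \<tau>)
  show "\<Psi> t \<le> \<tau>sum" using assms sum_\<tau>_le by (simp add: \<Psi>)
qed

lemma \<Psi>_pos: "t \<ge> 1 \<Longrightarrow> 0 < \<Psi> t"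
  by (rule less_le_trans[OF _ \<Psi>_bounds(1)]) (use c in auto)

lemma \<alpha>_pos: "t \<ge> 1 \<Longrightarrow> 0 < \<alpha> t"
  using \<Psi>_pos[of t] by (simp add: \<alpha>)

lemma \<alpha>_le: "t \<ge> 1 \<Longrightarrow> \<alpha> t \<le> sqrt \<tau>sum * real t powr (- 1 / 2)"
proof -
  assume t: "t \<ge> 1"
  have "\<alpha> t \<le> sqrt (\<tau>sum / real t)"
    using t \<Psi>_bounds[OF t] by (simp add: \<alpha> divide_right_mono)
  also have "\<dots> = sqrt \<tau>sum * real t powr (- 1 / 2)"
    using t by (simp add: real_sqrt_divide powr_minus_divide powr_half_sqrt)
  finally show ?thesis .
qed

text \<open>\<open>\<Psi>\<close> is at least its first term \<open>1 / c\<close>, and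
  \<open>t + 1 \<le> 2 * T\<close>; this is the origin of \<open>sqrt (2 * c)\<close> in the later
  constants.\<close>

lemma inverse_\<alpha>_le:
  assumes t: "t \<ge> 1" "t \<le> T"
  shows "1 / \<alpha> (t + 1) \<le> sqrt (2 * c) * sqrt (real T)"
proof -
  have "1 / \<alpha> (t + 1) = sqrt (real (t + 1) / \<Psi> (t + 1))"
    by (simp add: \<alpha> real_sqrt_divide)
  also have "real (t + 1) / \<Psi> (t + 1) \<le> real (t + 1) / (1 / c)"
    using \<Psi>_bounds[of "t + 1"] \<Psi>_pos[of "t + 1"] c by (intro divide_left_mono) auto
  also have "\<dots> \<le> 2 * c * real T" using t c by simp
  finally show ?thesis by (simp add: real_sqrt_mult)
qed

text \<open>\<open>\<Psi> t / t\<close> is the average of the first \<open>t\<close> terms of a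
  decreasing sequence, hence decreasing. The weighted telescoping of the squared distances depends
  on this.\<close>

lemma inverse_\<alpha>_mono:
  assumes t: "t \<ge> 1"
  shows "1 / \<alpha> t \<le> 1 / \<alpha> (t + 1)"
proof -
  have "real t * \<tau> (t + 1) = (\<Sum>k=1..t. \<tau> (t + 1))" by simp
  also have "\<dots> \<le> (\<Sum>k=1..t. \<tau> k)"
  proof (rule sum_mono)
    fix k assume "k \<in> {1..t}"
    then show "\<tau> (t + 1) \<le> \<tau> k"
      using c power_increasing[of k "t + 1" c] by (simp add: \<tau> frac_le)
  qed
  finally have "real t * \<tau> (t + 1) \<le> \<Psi> t" using t by (simp add: \<Psi>)
  moreover have "\<Psi> (t + 1) = \<Psi> t + \<tau> (t + 1)" using t by (simp add: \<Psi>)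
  ultimately have "real t * \<Psi> (t + 1) \<le> real (t + 1) * \<Psi> t" by (simp add: algebra_simps)
  then have "\<Psi> (t + 1) / real (t + 1) \<le> \<Psi> t / real t" using t by (simp add: field_simps)
  then have "\<alpha> (t + 1) \<le> \<alpha> t" using t by (simp add: \<alpha>)
  then show ?thesis using \<alpha>_pos[of "t + 1"] by (intro frac_le) auto
qed

lemma sum_\<alpha>_le: "(\<Sum>t=1..T. \<alpha> (t + 1)) \<le> 2 * sqrt \<tau>sum * sqrt (real T)"
proof -
  have "\<alpha> (t + 1) \<le> sqrt \<tau>sum * real t powr (1/2 - 1)" if "t \<ge> 1" for t
  proof -
    have "\<alpha> (t + 1) \<le> sqrt \<tau>sum * real (t + 1) powr (- 1 / 2)" by (rule \<alpha>_le) simp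
    also have "\<dots> \<le> sqrt \<tau>sum * real t powr (- 1 / 2)"
      using that \<tau>sum_pos by (intro mult_left_mono powr_mono2') auto
    finally show ?thesis by simp
  qed
  then have "(\<Sum>t=1..T. \<alpha> (t + 1)) \<le> (\<Sum>t=1..T. sqrt \<tau>sum * real t powr (1/2 - 1))"
    by (intro sum_mono) auto
  also have "\<dots> \<le> sqrt \<tau>sum * (real T powr (1/2) / (1/2))"
    unfolding sum_distrib_left[symmetric] using \<tau>sum_pos by (intro mult_left_mono powr_sum_le) auto
  finally show ?thesis by (simp add: powr_half_sqrt)
qed

lemma \<beta>\<gamma>_pos: "t \<ge> 1 \<Longrightarrow> 0 < \<beta> t" "t \<ge> 1 \<Longrightarrow> 0 < \<gamma> t"
  by (auto simp: \<beta> \<gamma>)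

lemma \<beta>_antimono: "t \<ge> 1 \<Longrightarrow> \<beta> (t + 1) \<le> \<beta> t"
  using \<kappa> by (auto simp: \<beta> intro!: divide_left_mono powr_mono2)

lemma \<beta>\<gamma>_eq: "t \<ge> 1 \<Longrightarrow> \<beta> t * \<gamma> t = 1 / real t"
  by (simp add: \<beta> \<gamma> powr_add[symmetric])

text \<open>From \<open>1 / \<gamma> t = t * t powr (- \<kappa>)\<close>. The weights of the dual
  telescoping sum grow by at most \<open>\<beta> (t + 1)\<close>, which is just what the
  regularisation can pay for.\<close>

lemma inverse_\<gamma>_diff_le:
  assumes t: "t \<ge> 1"
  shows "1 / \<gamma> (t + 1) \<le> 1 / \<gamma> t + \<beta> (t + 1)"
proof -
  let ?s = "real (t + 1)"
  have "1 / \<gamma> (t + 1) = ?s * ?s powr (- \<kappa>)"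
    by (simp add: \<gamma> powr_diff powr_minus_divide)
  also have "\<dots> = real t * ?s powr (- \<kappa>) + \<beta> (t + 1)"
    by (simp add: \<beta> powr_minus_divide add_divide_distrib)
  also have "real t * ?s powr (- \<kappa>) \<le> real t * real t powr (- \<kappa>)"
    using t \<kappa> by (intro mult_left_mono powr_mono2') auto
  also have "\<dots> = 1 / \<gamma> t" using t by (simp add: \<gamma> powr_diff powr_minus_divide)
  finally show ?thesis by simp
qed

lemma sum_\<beta>_le: "(\<Sum>t=1..T. \<beta> (t + 1)) \<le> real T powr (1 - \<kappa>) / (1 - \<kappa>)"
proof -
  have "(\<Sum>t=1..T. \<beta> (t + 1)) \<le> (\<Sum>t=1..T. real t powr ((1 - \<kappa>) - 1))"
    using \<beta>_antimono by (intro sum_mono) (fastforce simp: \<beta> powr_minus_divide)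
  also have "\<dots> \<le> real T powr (1 - \<kappa>) / (1 - \<kappa>)" using \<kappa> by (intro powr_sum_le) auto
  finally show ?thesis .
qed

lemma sum_\<gamma>_le: "(\<Sum>t=1..T. \<gamma> (t + 1)) \<le> real T powr \<kappa> / \<kappa>"
proof -
  have "\<gamma> (t + 1) \<le> real t powr (\<kappa> - 1)" if "t \<ge> 1" for t
  proof -
    have "\<gamma> (t + 1) = real (t + 1) powr (\<kappa> - 1)"
      by (simp add: \<gamma> powr_minus_divide[symmetric])
    also have "\<dots> \<le> real t powr (\<kappa> - 1)" using that \<kappa> by (intro powr_mono2') auto
    finally show ?thesis .
  qed
  then have "(\<Sum>t=1..T. \<gamma> (t + 1)) \<le> (\<Sum>t=1..T. real t powr (\<kappa> - 1))"
    by (intro sum_mono) auto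
  also have "\<dots> \<le> real T powr \<kappa> / \<kappa>" using \<kappa> by (intro powr_sum_le) auto
  finally show ?thesis .
qed

text \<open>\<open>G\<close> bounds the estimators; \<open>H\<close> bounds the linearised
  constraint values \<open>b\<close> as well as the products
  \<open>\<beta> t * q i t k\<close>.\<close>

definition G where "G = real CARD('p) * F2"
definition H where "H = F1 + G * (2 * R)"

lemma G_nonneg: "0 \<le> G" and H_nonneg: "0 \<le> H"
  using F2_nonneg F1_nonneg X by (auto simp: G_def H_def)

end

section \<open>A single realisation of the algorithm\<close>

locale run = problem E W w B X r R m f g F1 F2 c \<kappa> \<alpha> \<beta> \<gamma> \<tau> \<xi> \<delta> \<Psi>
  for E :: "nat \<Rightarrow> ('n::finite \<times> 'n) set" and W w B and X :: "(real ^ 'p) set"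
    and r R m f g F1 F2 c \<kappa> \<alpha> \<beta> \<gamma> \<tau> \<xi> \<delta> \<Psi> +
  fixes x1 :: "'n \<Rightarrow> real ^ 'p" and u x xh :: "'n \<Rightarrow> nat \<Rightarrow> real ^ 'p" and q :: "'n \<Rightarrow> nat \<Rightarrow> nat \<Rightarrow> real"
  assumes algorithm: "algorithm_run X m f g W \<alpha> \<beta> \<gamma> \<tau> \<xi> \<delta> x1 u x xh q"
    and norm_u: "\<And>i t. t \<ge> 1 \<Longrightarrow> norm (u i t) = 1"
begin

definition df where "df i t = grad_est (\<delta> t) (f i t) (x i t) (u i t)"
definition dg where "dg i t k = grad_est (\<delta> t) (gpos i t k) (x i t) (u i t)"
definition z where "z i t = (\<Sum>j\<in>UNIV. W t $ i $ j *\<^sub>R xh j t)"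

lemma init: "x i 1 \<in> shrunk 1" "xh i 1 = x i 1" "k < m i \<Longrightarrow> q i 1 k = 0"
  using algorithm unfolding algorithm_run_def shrunk_def by auto

lemma
  assumes "t \<ge> 1"
  shows x_Suc: "x i (t + 1) = closest_point (shrunk (t + 1)) (z i t - \<alpha> (t + 1) *\<^sub>R (df i t + (\<Sum>k<m i. q i t k *\<^sub>R dg i t k)))"
    and q_Suc: "k < m i \<Longrightarrow> q i (t + 1) k = max 0 ((1 - \<beta> (t + 1) * \<gamma> (t + 1)) * q i t k
                    + \<gamma> (t + 1) * (gpos i t k (x i t) + dg i t k \<bullet> (x i (t + 1) - x i t)))"
    and xh_Suc: "xh i (t + 1) = (if norm (x i (t + 1) - xh i t) \<ge> \<tau> (t + 1) then x i (t + 1) else xh i t)"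
proof -
  from algorithm assms show "x i (t + 1) = closest_point (shrunk (t + 1)) (z i t - \<alpha> (t + 1) *\<^sub>R (df i t + (\<Sum>k<m i. q i t k *\<^sub>R dg i t k)))"
    unfolding algorithm_run_def Let_def df_def dg_def z_def shrunk_def by blast
  from algorithm assms show "xh i (t + 1) = (if norm (x i (t + 1) - xh i t) \<ge> \<tau> (t + 1) then x i (t + 1) else xh i t)"
    unfolding algorithm_run_def Let_def by blast
  from algorithm assms show "k < m i \<Longrightarrow> q i (t + 1) k = max 0 ((1 - \<beta> (t + 1) * \<gamma> (t + 1)) * q i t k
                    + \<gamma> (t + 1) * (gpos i t k (x i t) + dg i t k \<bullet> (x i (t + 1) - x i t)))"
    unfolding algorithm_run_def Let_def dg_def by blast
qed

lemma x_in_shrunk: "t \<ge> 1 \<Longrightarrow> x i t \<in> shrunk t"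
proof (induction t rule: dec_induct)
  case (step t)
  then show ?case using x_Suc[of t i] closest_point_in_set[OF shrunk(2,3)] by simp
qed (use init in simp)

lemma x_in_X: "t \<ge> 1 \<Longrightarrow> x i t \<in> X"
  using x_in_shrunk shrunk_subset by blast

lemma perturbed_in_X:
  assumes "t \<ge> 1"
  shows "x i t + \<delta> t *\<^sub>R u i t \<in> X"
proof -
  have "x i t + \<delta> t *\<^sub>R u i t \<in> cball (x i t) (\<delta> t)"
    using norm_u[OF assms] \<delta>_pos[OF assms] by (simp add: dist_norm)
  then show ?thesis using cball_shrunk[OF assms x_in_shrunk[OF assms]] by blast
qed

lemma norm_df_le: "t \<ge> 1 \<Longrightarrow> norm (df i t) \<le> G"
  and norm_dg_le: "t \<ge> 1 \<Longrightarrow> k < m i \<Longrightarrow> norm (dg i t k) \<le> G"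
proof -
  assume t: "t \<ge> 1"
  show "norm (df i t) \<le> G" unfolding df_def G_def
    using f_lipschitz[OF t perturbed_in_X[OF t, of i] x_in_X[OF t, of i], of i] \<delta>_pos[OF t] norm_u[OF t]
    by (intro norm_grad_est_le) simp_all
  assume k: "k < m i"
  show "norm (dg i t k) \<le> G" unfolding dg_def G_def
    using gpos_lipschitz[OF t k perturbed_in_X[OF t, of i] x_in_X[OF t, of i]] \<delta>_pos[OF t] norm_u[OF t]
    by (intro norm_grad_est_le) simp_all
qed

definition b where "b i t k = gpos i t k (x i t) + dg i t k \<bullet> (x i (t + 1) - x i t)"

lemma norm_x_diff_le: "t \<ge> 1 \<Longrightarrow> s \<ge> 1 \<Longrightarrow> norm (x i t - x j s) \<le> 2 * R"
  using norm_triangle_ineq4[of "x i t" "x j s"] norm_X[OF x_in_X, of t i] norm_X[OF x_in_X, of s j] by linarith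

lemma inner_dg_le:
  assumes "t \<ge> 1" "k < m i"
  shows "\<bar>dg i t k \<bullet> v\<bar> \<le> G * norm v"
  using Cauchy_Schwarz_ineq2[of "dg i t k" v] mult_right_mono[OF norm_dg_le[OF assms], of "norm v"] by simp

lemma abs_b_le:
  assumes t: "t \<ge> 1" and k: "k < m i"
  shows "\<bar>b i t k\<bar> \<le> H"
proof -
  have "\<bar>dg i t k \<bullet> (x i (t + 1) - x i t)\<bar> \<le> G * (2 * R)"
    using inner_dg_le[OF t k, of "x i (t + 1) - x i t"] mult_left_mono[OF norm_x_diff_le[of "t + 1" t i i] G_nonneg] t
    by simp
  moreover have "0 \<le> gpos i t k (x i t)" by simp
  ultimately show ?thesis using gpos_le_F1[OF t k x_in_X[OF t, of i]] unfolding b_def H_def by linarith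
qed

lemma q_nonneg: "t \<ge> 1 \<Longrightarrow> k < m i \<Longrightarrow> 0 \<le> q i t k"
proof (induction t rule: dec_induct)
  case (step t)
  then show ?case using q_Suc[of t k i] by simp
qed (use init in simp)

text \<open>Before clipping, \<open>\<beta> (t + 1)\<close> times the update is a convex combination
  of \<open>\<beta> (t + 1) * q i t k\<close> and \<open>b i t k\<close>, with weight
  \<open>\<beta> (t + 1) * \<gamma> (t + 1) = 1 / (t + 1)\<close> on the latter; both are at most
  \<open>H\<close>.\<close>

lemma \<beta>_mult_q_le:
  assumes k: "k < m i"
  shows "t \<ge> 1 \<Longrightarrow> \<beta> t * q i t k \<le> H"
proof (induction t rule: dec_induct)
  case base
  then show ?case using init(3)[OF k] H_nonneg by simp
next
  case (step t)
  let ?be = "\<beta> (t + 1)" and ?ga = "\<gamma> (t + 1)"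
  have pos: "0 < ?be" "0 < ?ga" by (simp_all add: \<beta>\<gamma>_pos)
  have le1: "?be * ?ga \<le> 1" using \<beta>\<gamma>_eq[of "t + 1"] by simp
  have q0: "0 \<le> q i t k" using q_nonneg step k by simp
  have "?be * q i t k \<le> H"
    using mult_right_mono[OF \<beta>_antimono q0] step by fastforce
  then have "(1 - ?be * ?ga) * (?be * q i t k) \<le> (1 - ?be * ?ga) * H"
    using le1 by (intro mult_left_mono) auto
  moreover have "?be * ?ga * b i t k \<le> ?be * ?ga * H"
    using abs_b_le[of t k i] step k pos by (intro mult_left_mono) auto
  ultimately have "?be * ((1 - ?be * ?ga) * q i t k + ?ga * b i t k) \<le> H"
    by (simp add: algebra_simps)
  then have "?be * max 0 ((1 - ?be * ?ga) * q i t k + ?ga * b i t k) \<le> H"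
    using H_nonneg by (simp add: max_def)
  then show ?case using q_Suc[of t k i] step k by (simp add: b_def)
qed

lemma drift_bound:
  assumes t: "t \<ge> 1" and k: "k < m i"
  shows "\<bar>b i t k - \<beta> (t + 1) * q i t k\<bar> \<le> 2 * H"
proof -
  have "\<beta> (t + 1) * q i t k \<le> H"
    using mult_right_mono[OF \<beta>_antimono[OF t] q_nonneg[OF t k]] \<beta>_mult_q_le[OF k t] by linarith
  moreover have "0 \<le> \<beta> (t + 1) * q i t k"
    using q_nonneg[OF t k] \<beta>\<gamma>_pos(1)[of "t + 1"] by simp
  ultimately show ?thesis using abs_b_le[OF t k] by linarith
qed

definition \<epsilon> where "\<epsilon> i t = x i (t + 1) - z i t"

text \<open>The part of the step inequality whose randomness, given the past, sits only in the
  estimators. Subtracting \<open>gpos\<close> makes the constraint part nonnegative in the mean, up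
  to O(\<open>\<xi> t\<close>) times \<open>q\<close>, for a shrunk feasible comparator.\<close>

definition est_gap where
  "est_gap i t v = df i t \<bullet> (x i t - v) + (\<Sum>k<m i. q i t k * (dg i t k \<bullet> (x i t - v) - gpos i t k (x i t)))"

definition Q where "Q \<mu> i t = (\<Sum>k<m i. (q i t k - \<mu>)\<^sup>2)"

text \<open>\<open>closest_point_step\<close> bounds the step direction paired with
  \<open>x (t + 1) - v\<close>, and \<open>dual_step\<close> bounds \<open>q * b\<close> from below.
  Subtracting them leaves \<open>est_gap\<close>, the multiplier term and displacements without the
  factor \<open>q\<close>.\<close>

lemma agent_step:
  assumes t: "t \<ge> 1" and \<mu>: "\<mu> \<ge> 0" and v: "v \<in> shrunk t"
  shows "est_gap i t v + \<mu> * (\<Sum>k<m i. gpos i t k (x i t)) \<le>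
    ((norm (z i t - v))\<^sup>2 - (norm (x i (t + 1) - v))\<^sup>2 - (norm (\<epsilon> i t))\<^sup>2) / (2 * \<alpha> (t + 1))
    + (1 + real (m i) * \<mu>) * G * norm (x i (t + 1) - x i t)
    + (Q \<mu> i t - Q \<mu> i (t + 1)) / (2 * \<gamma> (t + 1))
    - \<beta> (t + 1) / 2 * Q 0 i t + \<beta> (t + 1) / 2 * (real (m i) * \<mu>\<^sup>2)
    + real (m i) * (\<gamma> (t + 1) * (2 * H)\<^sup>2 / 2)"
proof -
  let ?d = "x i (t + 1) - x i t"
  let ?\<omega> = "df i t + (\<Sum>k<m i. q i t k *\<^sub>R dg i t k)"
  let ?P = "((norm (z i t - v))\<^sup>2 - (norm (x i (t + 1) - v))\<^sup>2 - (norm (\<epsilon> i t))\<^sup>2) / (2 * \<alpha> (t + 1))"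
  let ?be = "\<beta> (t + 1)" and ?ga = "\<gamma> (t + 1)"
  have proj: "?\<omega> \<bullet> (x i (t + 1) - v) \<le> ?P"
    unfolding \<epsilon>_def
    by (rule closest_point_step[OF shrunk(1,2) _ _ x_Suc[OF t]])
      (use v shrunk_mono[OF t] \<alpha>_pos in auto)
  have dual: "(\<Sum>k<m i. q i t k * b i t k) \<ge>
      (Q \<mu> i (t + 1) - Q \<mu> i t) / (2 * ?ga) + \<mu> * (\<Sum>k<m i. b i t k) + ?be / 2 * Q 0 i t
      - ?be / 2 * (real (m i) * \<mu>\<^sup>2) - real (m i) * (?ga * (2 * H)\<^sup>2 / 2)"
  proof -
    have "(\<Sum>k<m i. q i t k * b i t k) \<ge>
      (\<Sum>k<m i. ((q i (t + 1) k - \<mu>)\<^sup>2 - (q i t k - \<mu>)\<^sup>2) / (2 * ?ga) + \<mu> * b i t k + ?be / 2 * (q i t k)\<^sup>2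
        - ?be / 2 * \<mu>\<^sup>2 - ?ga * (2 * H)\<^sup>2 / 2)"
    proof (rule sum_mono)
      fix k assume "k \<in> {..<m i}"
      then have k: "k < m i" by simp
      show "((q i (t + 1) k - \<mu>)\<^sup>2 - (q i t k - \<mu>)\<^sup>2) / (2 * ?ga) + \<mu> * b i t k + ?be / 2 * (q i t k)\<^sup>2
        - ?be / 2 * \<mu>\<^sup>2 - ?ga * (2 * H)\<^sup>2 / 2 \<le> q i t k * b i t k"
        unfolding q_Suc[OF t k, folded b_def]
        using \<beta>\<gamma>_pos[of "t + 1"] by (intro dual_step \<mu> drift_bound t k) auto
    qed
    also have "(\<Sum>k<m i. ((q i (t + 1) k - \<mu>)\<^sup>2 - (q i t k - \<mu>)\<^sup>2) / (2 * ?ga) + \<mu> * b i t k + ?be / 2 * (q i t k)\<^sup>2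
        - ?be / 2 * \<mu>\<^sup>2 - ?ga * (2 * H)\<^sup>2 / 2) =
      (Q \<mu> i (t + 1) - Q \<mu> i t) / (2 * ?ga) + \<mu> * (\<Sum>k<m i. b i t k) + ?be / 2 * Q 0 i t
      - ?be / 2 * (real (m i) * \<mu>\<^sup>2) - real (m i) * (?ga * (2 * H)\<^sup>2 / 2)"
      by (simp add: Q_def sum.distrib sum_subtractf sum_distrib_left sum_divide_distrib diff_divide_distrib)
    finally show ?thesis .
  qed
  have b_ge: "\<mu> * (\<Sum>k<m i. b i t k) \<ge> \<mu> * (\<Sum>k<m i. gpos i t k (x i t)) - real (m i) * \<mu> * G * norm ?d"
  proof -
    have "(\<Sum>k<m i. b i t k) \<ge> (\<Sum>k<m i. gpos i t k (x i t) - G * norm ?d)"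
    proof (rule sum_mono)
      fix k assume "k \<in> {..<m i}"
      then show "gpos i t k (x i t) - G * norm ?d \<le> b i t k"
        using inner_dg_le[OF t, of k i ?d] by (simp add: b_def)
    qed
    from mult_left_mono[OF this \<mu>] show ?thesis by (simp add: sum_subtractf algebra_simps)
  qed
  have df_ge: "df i t \<bullet> ?d \<ge> - (G * norm ?d)"
    using Cauchy_Schwarz_ineq2[of "df i t" ?d] mult_right_mono[OF norm_df_le[OF t], of "norm ?d" i] by simp
  \<comment> \<open>Passing from \<open>x (t + 1)\<close> to \<open>x t\<close> produces
    \<open>q * (dg \<bullet> ?d)\<close>, which by definition of \<open>b\<close> equals
    \<open>q * b - q * gpos\<close>; no estimate is lost here.\<close>
  have "?\<omega> \<bullet> (x i (t + 1) - v) = ?\<omega> \<bullet> (x i t - v) + ?\<omega> \<bullet> ?d"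
    by (simp add: inner_diff_right)
  also have "?\<omega> \<bullet> (x i t - v) = df i t \<bullet> (x i t - v) + (\<Sum>k<m i. q i t k * (dg i t k \<bullet> (x i t - v)))"
    by (simp add: inner_add_left inner_sum_left)
  also have "?\<omega> \<bullet> ?d = df i t \<bullet> ?d + (\<Sum>k<m i. q i t k * b i t k) - (\<Sum>k<m i. q i t k * gpos i t k (x i t))"
    by (simp add: inner_add_left inner_sum_left b_def distrib_left sum.distrib)
  finally have "?\<omega> \<bullet> (x i (t + 1) - v) = est_gap i t v + df i t \<bullet> ?d + (\<Sum>k<m i. q i t k * b i t k)"
    by (simp add: est_gap_def right_diff_distrib sum_subtractf)
  then have "est_gap i t v \<le> ?P + G * norm ?d - (\<Sum>k<m i. q i t k * b i t k)"
    using proj df_ge by linarith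
  moreover have "(1 + real (m i) * \<mu>) * G * norm ?d = G * norm ?d + real (m i) * \<mu> * G * norm ?d"
    by (simp add: algebra_simps)
  moreover have "(Q \<mu> i t - Q \<mu> i (t + 1)) / (2 * ?ga) = - ((Q \<mu> i (t + 1) - Q \<mu> i t) / (2 * ?ga))"
    by (metis minus_diff_eq minus_divide_left)
  ultimately show ?thesis using dual b_ge by linarith
qed

section \<open>Triggering error and disagreement of the agents\<close>

lemma xh_dist: "t \<ge> 1 \<Longrightarrow> norm (xh i t - x i t) \<le> \<tau> t"
proof (induction t rule: dec_induct)
  case base
  then show ?case using init \<tau>_pos[of 1] by simp
next
  case (step t)
  then show ?case using xh_Suc[of t i] \<tau>_pos[of "t + 1"] by (auto simp: norm_minus_commute)
qed

lemma xh_in_X: "t \<ge> 1 \<Longrightarrow> xh i t \<in> X"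
proof (induction t rule: dec_induct)
  case base
  then show ?case using init x_in_X by simp
next
  case (step t)
  then show ?case using xh_Suc[of t i] x_in_X[of "t + 1" i] by auto
qed

lemma z_minus_mix:
  assumes t: "t \<ge> 1"
  shows "norm (z i t - (\<Sum>j\<in>UNIV. W t $ i $ j *\<^sub>R x j t)) \<le> \<tau> t"
proof -
  have "z i t - (\<Sum>j\<in>UNIV. W t $ i $ j *\<^sub>R x j t) = (\<Sum>j\<in>UNIV. W t $ i $ j *\<^sub>R (xh j t - x j t))"
    by (simp add: z_def sum_subtractf scaleR_right_diff_distrib)
  also have "norm \<dots> \<le> (\<Sum>j\<in>UNIV. W t $ i $ j * \<tau> t)"
    using W_nonneg[OF t] xh_dist[OF t]
    by (intro order_trans[OF norm_sum] sum_mono) (auto intro!: mult_left_mono)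
  also have "\<dots> = \<tau> t" by (simp add: sum_distrib_right[symmetric] W_rows[OF t])
  finally show ?thesis .
qed

lemma move_le:
  assumes t: "t \<ge> 1"
  shows "norm (x i (t + 1) - x i t) \<le> norm (\<epsilon> i t) + \<tau> t + spread (\<lambda>i. x i t)"
proof -
  let ?y = "\<Sum>j\<in>UNIV. W t $ i $ j *\<^sub>R x j t"
  have "?y - x i t = (\<Sum>j\<in>UNIV. W t $ i $ j *\<^sub>R (x j t - x i t))"
    by (simp add: scaleR_right_diff_distrib sum_subtractf scaleR_left.sum[symmetric] W_rows[OF t])
  also have "norm \<dots> \<le> (\<Sum>j\<in>UNIV. W t $ i $ j * spread (\<lambda>i. x i t))"
    using W_nonneg[OF t] norm_diff_le_spread[of "\<lambda>i. x i t"]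
    by (intro order_trans[OF norm_sum] sum_mono) (auto intro!: mult_left_mono)
  also have "\<dots> = spread (\<lambda>i. x i t)" by (simp add: sum_distrib_right[symmetric] W_rows[OF t])
  finally have "norm (?y - x i t) \<le> spread (\<lambda>i. x i t)" .
  moreover have "norm (x i (t + 1) - x i t) \<le> norm (\<epsilon> i t) + norm (z i t - ?y) + norm (?y - x i t)"
    unfolding \<epsilon>_def by norm
  ultimately show ?thesis using z_minus_mix[OF t, of i] by linarith
qed

text \<open>The decisions follow the mixing recursion up to \<open>\<epsilon>\<close> and a
  triggering error of at most \<open>\<tau> t\<close> per agent, and the latter is summable.\<close>

lemma sum_spread_run_le:
  "(\<Sum>t=1..T. spread (\<lambda>i. x i t)) \<le>
    2 * real L / \<eta> * (R + real CARD('n) * \<tau>sum + (\<Sum>t=1..T. \<Sum>i\<in>UNIV. norm (\<epsilon> i t)))"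
proof -
  define e where "e t i = x i (t + 1) - (\<Sum>j\<in>UNIV. W t $ i $ j *\<^sub>R x j t)" for t i
  have "(\<Sum>t=1..T. spread (\<lambda>i. x i t)) \<le> 2 * real L / \<eta> * (R + (\<Sum>t=1..T. \<Sum>i\<in>UNIV. norm (e t i)))"
    by (rule sum_spread_le) (auto simp: e_def norm_X x_in_X)
  also have "(\<Sum>t=1..T. \<Sum>i\<in>UNIV. norm (e t i)) \<le> (\<Sum>t=1..T. \<Sum>i\<in>UNIV. (norm (\<epsilon> i t) + \<tau> t))"
  proof (intro sum_mono)
    fix t i assume "t \<in> {1..T}"
    then have t: "t \<ge> 1" by simp
    have "norm (e t i) \<le> norm (\<epsilon> i t) + norm (z i t - (\<Sum>j\<in>UNIV. W t $ i $ j *\<^sub>R x j t))"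
      unfolding e_def \<epsilon>_def by norm
    then show "norm (e t i) \<le> norm (\<epsilon> i t) + \<tau> t" using z_minus_mix[OF t, of i] by linarith
  qed
  also have "\<dots> = (\<Sum>t=1..T. \<Sum>i\<in>UNIV. norm (\<epsilon> i t)) + real CARD('n) * (\<Sum>t=1..T. \<tau> t)"
    by (simp add: sum.distrib sum_distrib_left)
  also have "(\<Sum>t=1..T. \<tau> t) \<le> \<tau>sum" by (rule sum_\<tau>_le)
  finally show ?thesis
    using \<eta>_pos by (simp add: mult_left_mono add_ac divide_right_mono)
qed

end

section \<open>The summed inequality along a realisation\<close>

context problem
begin

definition M\<^sub>s where "M\<^sub>s = (\<Sum>i\<in>UNIV. real (m i))"
definition \<Gamma>\<^sub>0 where "\<Gamma>\<^sub>0 = (1 + M\<^sub>s) * G"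
text \<open>Once the disagreement is bounded by \<open>sum_spread_run_le\<close>,
  \<open>\<Gamma>\<^sub>1\<close> is the coefficient of the total displacement and
  \<open>\<Gamma>\<^sub>2\<close> the constant remainder, both up to the common factor
  \<open>1 + \<mu>\<close>.\<close>

definition \<Gamma>\<^sub>1 where "\<Gamma>\<^sub>1 \<Lambda> = \<Gamma>\<^sub>0 + (\<Gamma>\<^sub>0 * real CARD('n) + \<Lambda>) * (2 * real L / \<eta>)"
definition \<Gamma>\<^sub>2 where
  "\<Gamma>\<^sub>2 \<Lambda> = \<Gamma>\<^sub>0 * real CARD('n) * \<tau>sum + (\<Gamma>\<^sub>0 * real CARD('n) + \<Lambda>) * (2 * real L / \<eta> * (R + real CARD('n) * \<tau>sum))"

definition C\<^sub>1 where
  "C\<^sub>1 \<Lambda> = 2 * R\<^sup>2 * real CARD('n) * sqrt (2 * c) + 2 * real CARD('n) * R * sqrt (2 * c) * (\<tau>sum + R)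
    + 2 * \<Gamma>\<^sub>2 \<Lambda> + 2 * real CARD('n) * (\<Gamma>\<^sub>1 \<Lambda>)\<^sup>2 * sqrt \<tau>sum"

definition C\<^sub>p where
  "C\<^sub>p \<Lambda> = C\<^sub>1 \<Lambda> + 2 * real CARD('n) * R * sqrt (2 * c) + 2 * H\<^sup>2 * M\<^sub>s / \<kappa> + M\<^sub>s + M\<^sub>s / (1 - \<kappa>)"

lemma M\<^sub>s_nonneg: "0 \<le> M\<^sub>s" and m_le_M\<^sub>s: "real (m i) \<le> M\<^sub>s"
  unfolding M\<^sub>s_def by (auto intro: sum_nonneg member_le_sum)

lemma \<Gamma>_nonneg:
  assumes "0 \<le> \<Lambda>"
  shows "0 \<le> \<Gamma>\<^sub>0" "0 \<le> \<Gamma>\<^sub>1 \<Lambda>" "0 \<le> \<Gamma>\<^sub>2 \<Lambda>"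
proof -
  show 0: "0 \<le> \<Gamma>\<^sub>0" using M\<^sub>s_nonneg G_nonneg by (simp add: \<Gamma>\<^sub>0_def)
  then show "0 \<le> \<Gamma>\<^sub>1 \<Lambda>" "0 \<le> \<Gamma>\<^sub>2 \<Lambda>"
    using assms \<eta>_pos \<tau>sum_pos X(5) unfolding \<Gamma>\<^sub>1_def \<Gamma>\<^sub>2_def
    by (intro add_nonneg_nonneg mult_nonneg_nonneg divide_nonneg_nonneg, auto)+
qed

lemma C_nonneg:
  assumes "0 \<le> \<Lambda>"
  shows "0 \<le> C\<^sub>1 \<Lambda>" "0 \<le> C\<^sub>p \<Lambda>"
proof -
  show 1: "0 \<le> C\<^sub>1 \<Lambda>"
    unfolding C\<^sub>1_def using \<Gamma>_nonneg[OF assms] X(5) c \<tau>sum_pos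
    by (intro add_nonneg_nonneg mult_nonneg_nonneg) auto
  then show "0 \<le> C\<^sub>p \<Lambda>"
    unfolding C\<^sub>p_def using M\<^sub>s_nonneg X(5) c \<kappa>
    by (intro add_nonneg_nonneg mult_nonneg_nonneg divide_nonneg_nonneg) auto
qed

lemma sum_\<xi>_diff_le: "(\<Sum>t=1..T. \<xi> t - \<xi> (t + 1)) \<le> 1"
proof -
  have "(\<Sum>t=1..T. \<xi> t - \<xi> (t + 1)) = \<xi> 1 - \<xi> (T + 1)"
    by (induction T) auto
  then show ?thesis using \<xi>_bounds[of 1] \<xi>_bounds[of "T + 1"] by simp
qed

end

context run
begin

text \<open>Abel summation with growing weights \<open>1 / \<gamma>\<close>. Their growth costs
  \<open>\<beta> / 2 * Q \<mu>\<close>, and since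
  \<open>Q \<mu> \<le> Q 0 + m * \<mu>\<^sup>2\<close>, the regularisation term
  \<open>- \<beta> / 2 * Q 0\<close> cancels the part that depends on \<open>q\<close>.\<close>

lemma sum_dual_le:
  assumes \<mu>: "\<mu> \<ge> 0"
  shows "(\<Sum>t=1..T. (Q \<mu> i t - Q \<mu> i (t + 1)) / (2 * \<gamma> (t + 1)) - \<beta> (t + 1) / 2 * Q 0 i t + \<beta> (t + 1) / 2 * (real (m i) * \<mu>\<^sup>2))
    \<le> real (m i) * \<mu>\<^sup>2 * (1 + real T powr (1 - \<kappa>) / (1 - \<kappa>))"
proof -
  let ?mm = "real (m i) * \<mu>\<^sup>2"
  have Q_le: "Q \<mu> i t \<le> Q 0 i t + ?mm" if "t \<ge> 1" for t
  proof -
    have "Q \<mu> i t \<le> (\<Sum>k<m i. (q i t k)\<^sup>2 + \<mu>\<^sup>2)"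
      unfolding Q_def
    proof (rule sum_mono)
      fix k assume "k \<in> {..<m i}"
      then have "0 \<le> 2 * q i t k * \<mu>" using q_nonneg[OF that] \<mu> by simp
      then show "(q i t k - \<mu>)\<^sup>2 \<le> (q i t k)\<^sup>2 + \<mu>\<^sup>2" unfolding power2_diff by linarith
    qed
    then show ?thesis by (simp add: Q_def sum.distrib)
  qed
  define h where "h t = 1 / \<gamma> t" for t
  have conv: "(a - b) / (2 * \<gamma> s) = h s * a / 2 - h s * b / 2" for a b s
    by (simp add: h_def diff_divide_distrib)
  have "(\<Sum>t=1..T. (Q \<mu> i t - Q \<mu> i (t + 1)) / (2 * \<gamma> (t + 1)) - \<beta> (t + 1) / 2 * Q 0 i t + \<beta> (t + 1) / 2 * ?mm)
    \<le> ?mm * (1 / 2 + (\<Sum>t=1..T. \<beta> (t + 1))) - h (T + 1) * Q \<mu> i (T + 1) / 2"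
    unfolding conv
  proof (induction T)
    \<comment> \<open>Both sides are 0, since \<open>1 / \<gamma> 1 = 1\<close> and the dual
      variables start at 0.\<close>
    case 0
    have "Q \<mu> i 1 = ?mm" using init by (simp add: Q_def)
    then show ?case by (simp add: \<gamma> h_def)
  next
    case (Suc T)
    let ?t = "T + 1"
    have sum_split: "(\<Sum>t=1..Suc T. F t) = (\<Sum>t=1..T. F t) + F (Suc T)" for F :: "nat \<Rightarrow> real" by simp
    have "0 \<le> Q \<mu> i ?t" by (simp add: Q_def sum_nonneg)
    from mult_right_mono[OF inverse_\<gamma>_diff_le[of ?t, folded h_def] this]
    have 1: "h (?t + 1) * Q \<mu> i ?t \<le> h ?t * Q \<mu> i ?t + \<beta> (?t + 1) * Q \<mu> i ?t"
      by (simp add: distrib_right)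
    have "\<beta> (?t + 1) * Q \<mu> i ?t \<le> \<beta> (?t + 1) * (Q 0 i ?t + ?mm)"
      using \<beta>\<gamma>_pos(1)[of "?t + 1"] by (intro mult_left_mono Q_le) auto
    then have 2: "\<beta> (?t + 1) * Q \<mu> i ?t \<le> \<beta> (?t + 1) * Q 0 i ?t + \<beta> (?t + 1) * ?mm"
      by (simp add: distrib_left)
    have 3: "?mm * (1 / 2 + ((\<Sum>t=1..T. \<beta> (t + 1)) + \<beta> (?t + 1))) = ?mm * (1 / 2 + (\<Sum>t=1..T. \<beta> (t + 1))) + \<beta> (?t + 1) * ?mm"
      by (simp add: algebra_simps)
    show ?case
      using Suc.IH 1 2 3 unfolding sum_split unfolding Suc_eq_plus1 by linarith
  qed
  also have "\<dots> \<le> ?mm * (1 / 2 + (\<Sum>t=1..T. \<beta> (t + 1)))"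
    using \<beta>\<gamma>_pos(2)[of "T + 1"] by (simp add: Q_def h_def sum_nonneg)
  also have "\<dots> \<le> ?mm * (1 + real T powr (1 - \<kappa>) / (1 - \<kappa>))"
    using sum_\<beta>_le[of T] by (intro mult_left_mono) auto
  finally show ?thesis .
qed

section \<open>Squared distance to a shrunk comparator sequence\<close>

context
  fixes y :: "nat \<Rightarrow> real ^ 'p"
  assumes y: "\<And>t. t \<ge> 1 \<Longrightarrow> y t \<in> X"
begin

definition v where "v t = (1 - \<xi> t) *\<^sub>R y t"
definition V where "V t = (\<Sum>i\<in>UNIV. (norm (x i t - v t))\<^sup>2)"

lemma v_in_shrunk: "t \<ge> 1 \<Longrightarrow> v t \<in> shrunk t"
  unfolding v_def shrunk_def using y by blast

lemma norm_v: "t \<ge> 1 \<Longrightarrow> norm (v t) \<le> R"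
  using v_in_shrunk shrunk_subset norm_X by blast

text \<open>Shrinking lengthens the path only by the increments of \<open>\<xi>\<close>, which
  telescope to at most 1 in the sum.\<close>

lemma norm_v_diff_le:
  assumes t: "t \<ge> 1"
  shows "norm (v (t + 1) - v t) \<le> norm (y (t + 1) - y t) + R * (\<xi> t - \<xi> (t + 1))"
proof -
  have "v (t + 1) - v t = (1 - \<xi> (t + 1)) *\<^sub>R (y (t + 1) - y t) + (\<xi> t - \<xi> (t + 1)) *\<^sub>R y t"
    by (simp add: v_def algebra_simps)
  also have "norm \<dots> \<le> norm (y (t + 1) - y t) + R * (\<xi> t - \<xi> (t + 1))"
  proof (intro norm_triangle_le add_mono)
    show "norm ((1 - \<xi> (t + 1)) *\<^sub>R (y (t + 1) - y t)) \<le> norm (y (t + 1) - y t)"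
      using \<xi>_bounds[of "t + 1"] by (simp add: mult_left_le_one_le)
    show "norm ((\<xi> t - \<xi> (t + 1)) *\<^sub>R y t) \<le> R * (\<xi> t - \<xi> (t + 1))"
      using \<xi>_antimono[OF t] mult_left_mono[OF norm_X[OF y[OF t]], of "\<xi> t - \<xi> (t + 1)"]
      by (simp add: mult.commute)
  qed
  finally show ?thesis .
qed

lemma norm_diff_le_2R: "norm a \<le> R \<Longrightarrow> norm b \<le> R \<Longrightarrow> norm (a - b) \<le> 2 * R" for a b :: "real ^ 'p"
  using norm_triangle_ineq4[of a b] by linarith

text \<open>Jensen's inequality within each row, then column sums equal to 1: mixing does not
  increase the total squared distance, and triggering adds at most \<open>4 * R * \<tau> t\<close>
  per agent.\<close>

lemma sum_z_le:
  assumes t: "t \<ge> 1"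
  shows "(\<Sum>i\<in>UNIV. (norm (z i t - v t))\<^sup>2) \<le> V t + real CARD('n) * (4 * R * \<tau> t)"
proof -
  have "(norm (z i t - v t))\<^sup>2 \<le> (\<Sum>j\<in>UNIV. W t $ i $ j * (norm (xh j t - v t))\<^sup>2)" for i
  proof -
    have "z i t - v t = (\<Sum>j\<in>UNIV. W t $ i $ j *\<^sub>R (xh j t - v t))"
      by (simp add: z_def scaleR_right_diff_distrib sum_subtractf scaleR_left.sum[symmetric] W_rows[OF t])
    then show ?thesis using norm_weighted_sum_power2_le[of "\<lambda>j. W t $ i $ j"] W_nonneg[OF t] W_rows[OF t] by simp
  qed
  then have "(\<Sum>i\<in>UNIV. (norm (z i t - v t))\<^sup>2) \<le> (\<Sum>i\<in>UNIV. \<Sum>j\<in>UNIV. W t $ i $ j * (norm (xh j t - v t))\<^sup>2)"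
    by (rule sum_mono)
  also have "\<dots> = (\<Sum>j\<in>UNIV. \<Sum>i\<in>UNIV. W t $ i $ j * (norm (xh j t - v t))\<^sup>2)"
    by (rule sum.swap)
  also have "\<dots> = (\<Sum>j\<in>UNIV. (norm (xh j t - v t))\<^sup>2)"
    by (simp add: sum_distrib_right[symmetric] W_cols[OF t])
  also have "\<dots> \<le> (\<Sum>j\<in>UNIV. (norm (x j t - v t))\<^sup>2 + 4 * R * \<tau> t)"
    using t by (intro sum_mono power2_norm_perturb norm_diff_le_2R)
      (auto simp: norm_X xh_in_X x_in_X norm_v xh_dist)
  finally show ?thesis by (simp add: V_def sum.distrib)
qed

lemma V_Suc_le:
  assumes t: "t \<ge> 1"
  shows "V (t + 1) \<le> (\<Sum>i\<in>UNIV. (norm (x i (t + 1) - v t))\<^sup>2) + real CARD('n) * (4 * R * norm (v (t + 1) - v t))"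
proof -
  have "V (t + 1) \<le> (\<Sum>i\<in>UNIV. (norm (x i (t + 1) - v t))\<^sup>2 + 4 * R * norm (v (t + 1) - v t))"
    unfolding V_def using t
    by (intro sum_mono power2_norm_perturb norm_diff_le_2R)
      (auto simp: norm_X x_in_X norm_v norm_minus_commute)
  then show ?thesis by (simp add: sum.distrib)
qed

lemma V_bounds: "0 \<le> V t" "t \<ge> 1 \<Longrightarrow> V t \<le> real CARD('n) * (2 * R)\<^sup>2"
proof -
  show "0 \<le> V t" by (simp add: V_def sum_nonneg)
  assume t: "t \<ge> 1"
  have "V t \<le> (\<Sum>i\<in>(UNIV::'n set). (2 * R)\<^sup>2)"
    unfolding V_def using t
    by (intro sum_mono power_mono norm_diff_le_2R) (auto simp: norm_X x_in_X norm_v)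
  then show "V t \<le> real CARD('n) * (2 * R)\<^sup>2" by simp
qed

definition primal where
  "primal t = (\<Sum>i\<in>UNIV. ((norm (z i t - v t))\<^sup>2 - (norm (x i (t + 1) - v t))\<^sup>2 - (norm (\<epsilon> i t))\<^sup>2) / (2 * \<alpha> (t + 1)))"

text \<open>\<open>V\<close> telescopes with the nondecreasing weights \<open>1 / \<alpha>\<close>;
  triggering and the motion of the comparator enter with the largest weight, of order
  \<open>sqrt T\<close>. The squares of \<open>\<epsilon>\<close> are kept in full.\<close>

lemma sum_primal_le:
  shows "(\<Sum>t=1..T. primal t) \<le>
    2 * R\<^sup>2 * real CARD('n) * sqrt (2 * c) * sqrt (real T)
    + 2 * real CARD('n) * R * sqrt (2 * c) * sqrt (real T) * (\<tau>sum + R + (\<Sum>t=1..T. norm (y (t + 1) - y t)))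
    - (\<Sum>t=1..T. \<Sum>i\<in>UNIV. (norm (\<epsilon> i t))\<^sup>2 / (2 * \<alpha> (t + 1)))"
proof (cases "T = 0")
  case False
  let ?A = "sqrt (2 * c) * sqrt (real T)" and ?N = "real CARD('n)"
  let ?h = "\<lambda>t. 1 / \<alpha> t" and ?d = "\<lambda>t. \<tau> t + norm (v (t + 1) - v t)"
  let ?e2 = "\<lambda>t. \<Sum>i\<in>UNIV. (norm (\<epsilon> i t))\<^sup>2 / (2 * \<alpha> (t + 1))"
  have sum_linear: "(\<Sum>t=1..T. a t / 2 + k * d t - e t) = (\<Sum>t=1..T. a t) / 2 + k * (\<Sum>t=1..T. d t) - (\<Sum>t=1..T. e t)"
    for a d e :: "nat \<Rightarrow> real" and k
    by (simp add: sum.distrib sum_subtractf sum_distrib_left sum_divide_distrib)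
  have split: "(A + 4 * D) / (2 * a) = 1 / a * A / 2 + 2 * D * (1 / a)" if "0 < a" for A D a :: real
    using that by (simp add: field_simps)
  have "primal t \<le> ?h (t + 1) * (V t - V (t + 1)) / 2 + 2 * ?N * R * ?A * ?d t - ?e2 t" if t: "t \<in> {1..T}" for t
  proof -
    have t1: "t \<ge> 1" using t by simp
    have a: "0 < \<alpha> (t + 1)" by (rule \<alpha>_pos) simp
    let ?Z = "\<Sum>i\<in>UNIV. (norm (z i t - v t))\<^sup>2" and ?X = "\<Sum>i\<in>UNIV. (norm (x i (t + 1) - v t))\<^sup>2"
    have 1: "primal t = (?Z - ?X) / (2 * \<alpha> (t + 1)) - ?e2 t"
      by (simp add: primal_def sum_divide_distrib sum_subtractf diff_divide_distrib)
    have "?Z - ?X \<le> V t - V (t + 1) + 4 * (?N * R * ?d t)"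
      using sum_z_le[OF t1] V_Suc_le[OF t1] by (simp add: algebra_simps)
    then have 2: "(?Z - ?X) / (2 * \<alpha> (t + 1)) \<le> (V t - V (t + 1) + 4 * (?N * R * ?d t)) / (2 * \<alpha> (t + 1))"
      using a by (intro divide_right_mono) auto
    have "2 * (?N * R * ?d t) * ?h (t + 1) \<le> 2 * (?N * R * ?d t) * ?A"
    proof (rule mult_left_mono)
      show "?h (t + 1) \<le> ?A" by (rule inverse_\<alpha>_le) (use t in auto)
      show "0 \<le> 2 * (?N * R * ?d t)"
        using X(5) \<tau>_pos[OF t1] by (intro mult_nonneg_nonneg add_nonneg_nonneg) auto
    qed
    also have "\<dots> = 2 * ?N * R * ?A * ?d t" by (simp only: mult_ac)
    finally show ?thesis using 1 2 split[OF a, of "V t - V (t + 1)" "?N * R * ?d t"] by linarith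
  qed
  then have "(\<Sum>t=1..T. primal t) \<le> (\<Sum>t=1..T. ?h (t + 1) * (V t - V (t + 1)) / 2 + 2 * ?N * R * ?A * ?d t - ?e2 t)"
    by (rule sum_mono)
  also have "\<dots> = (\<Sum>t=1..T. ?h (t + 1) * (V t - V (t + 1))) / 2 + 2 * ?N * R * ?A * (\<Sum>t=1..T. ?d t) - (\<Sum>t=1..T. ?e2 t)"
    by (rule sum_linear)
  finally have 1: "(\<Sum>t=1..T. primal t) \<le> \<dots>" .
  have "(\<Sum>t=1..T. ?h (t + 1) * (V t - V (t + 1))) \<le> ?h (T + 1) * (?N * (2 * R)\<^sup>2)"
  proof (rule sum_telescope_weighted_le)
    show "0 \<le> ?h t" if "t \<ge> 1" for t using \<alpha>_pos[OF that] by simp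
  qed (rule inverse_\<alpha>_mono V_bounds; assumption?)+
  also have "\<dots> \<le> ?A * (?N * (2 * R)\<^sup>2)"
    using False by (intro mult_right_mono inverse_\<alpha>_le) auto
  also have "\<dots> = 2 * (2 * R\<^sup>2 * ?N * ?A)"
    by (simp add: power_mult_distrib)
  finally have 2: "(\<Sum>t=1..T. ?h (t + 1) * (V t - V (t + 1))) \<le> 2 * (2 * R\<^sup>2 * ?N * ?A)" .
  have "(\<Sum>t=1..T. norm (v (t + 1) - v t)) \<le> (\<Sum>t=1..T. norm (y (t + 1) - y t) + R * (\<xi> t - \<xi> (t + 1)))"
    by (intro sum_mono norm_v_diff_le) auto
  also have "\<dots> = (\<Sum>t=1..T. norm (y (t + 1) - y t)) + R * (\<Sum>t=1..T. \<xi> t - \<xi> (t + 1))"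
    by (simp only: sum.distrib sum_distrib_left)
  finally have 3: "(\<Sum>t=1..T. ?d t) \<le> \<tau>sum + R + (\<Sum>t=1..T. norm (y (t + 1) - y t))"
    using sum_\<tau>_le[of T] mult_left_mono[OF sum_\<xi>_diff_le[of T], of R] X(5) unfolding sum.distrib by linarith
  have "0 \<le> 2 * ?N * R * ?A" using X(5) c by simp
  from mult_left_mono[OF 3 this] 1 2 show ?thesis
    by (simp only: mult.assoc)
qed simp

text \<open>Disagreement costs no more than displacement, so any multiple \<open>\<Lambda>\<close>
  of it may stand on the left. Its factor \<open>1 + \<mu>\<close> is the one with which
  displacements occur anyway.\<close>

lemma pathwise:
  assumes T: "T \<ge> 1" and \<mu>: "\<mu> \<ge> 0" and \<Lambda>: "\<Lambda> \<ge> 0"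
  defines "P \<equiv> \<Sum>t=1..T. norm (y (t + 1) - y t)"
  shows "(\<Sum>t=1..T. \<Sum>i\<in>UNIV. est_gap i t (v t) + \<mu> * (\<Sum>k<m i. gpos i t k (x i t)))
      + (1 + \<mu>) * \<Lambda> * (\<Sum>t=1..T. spread (\<lambda>i. x i t))
    \<le> C\<^sub>p \<Lambda> * (sqrt (real T) + real T powr \<kappa> + sqrt (real T) * P + \<mu>\<^sup>2 * (sqrt (real T) + real T powr (1 - \<kappa>)))"
proof -
  let ?N = "real CARD('n)" and ?s = "sqrt (real T)"
  let ?D = "\<Sum>t=1..T. spread (\<lambda>i. x i t)" and ?e = "\<Sum>t=1..T. \<Sum>i\<in>UNIV. norm (\<epsilon> i t)"
  let ?e2 = "\<Sum>t=1..T. \<Sum>i\<in>UNIV. (norm (\<epsilon> i t))\<^sup>2 / (2 * \<alpha> (t + 1))"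
  let ?dual = "\<lambda>i t. (Q \<mu> i t - Q \<mu> i (t + 1)) / (2 * \<gamma> (t + 1)) - \<beta> (t + 1) / 2 * Q 0 i t + \<beta> (t + 1) / 2 * (real (m i) * \<mu>\<^sup>2)"
  have "(\<Sum>t=1..T. \<Sum>i\<in>UNIV. est_gap i t (v t) + \<mu> * (\<Sum>k<m i. gpos i t k (x i t)))
    \<le> (\<Sum>t=1..T. \<Sum>i\<in>UNIV.
        ((norm (z i t - v t))\<^sup>2 - (norm (x i (t + 1) - v t))\<^sup>2 - (norm (\<epsilon> i t))\<^sup>2) / (2 * \<alpha> (t + 1))
        + (1 + \<mu>) * \<Gamma>\<^sub>0 * (norm (\<epsilon> i t) + \<tau> t + spread (\<lambda>i. x i t))
        + ?dual i t + real (m i) * (\<gamma> (t + 1) * (2 * H)\<^sup>2 / 2))"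
  proof (intro sum_mono)
    fix t i assume "t \<in> {1..T}"
    then have t: "t \<ge> 1" by simp
    have "(1 + real (m i) * \<mu>) * G \<le> (1 + \<mu>) * \<Gamma>\<^sub>0"
    proof -
      have "1 + real (m i) * \<mu> \<le> 1 + M\<^sub>s * \<mu>" using m_le_M\<^sub>s \<mu> by (simp add: mult_right_mono)
      also have "\<dots> \<le> (1 + \<mu>) * (1 + M\<^sub>s)" using M\<^sub>s_nonneg \<mu> by (simp add: algebra_simps)
      finally show ?thesis using G_nonneg by (simp add: \<Gamma>\<^sub>0_def mult.assoc[symmetric] mult_right_mono)
    qed
    then have "(1 + real (m i) * \<mu>) * G * norm (x i (t + 1) - x i t) \<le>
        (1 + \<mu>) * \<Gamma>\<^sub>0 * (norm (\<epsilon> i t) + \<tau> t + spread (\<lambda>i. x i t))"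
      by (rule mult_mono[OF _ move_le[OF t]]) (use \<mu> \<Gamma>_nonneg(1)[OF \<Lambda>] in auto)
    then show "est_gap i t (v t) + \<mu> * (\<Sum>k<m i. gpos i t k (x i t)) \<le>
        ((norm (z i t - v t))\<^sup>2 - (norm (x i (t + 1) - v t))\<^sup>2 - (norm (\<epsilon> i t))\<^sup>2) / (2 * \<alpha> (t + 1))
        + (1 + \<mu>) * \<Gamma>\<^sub>0 * (norm (\<epsilon> i t) + \<tau> t + spread (\<lambda>i. x i t))
        + ?dual i t + real (m i) * (\<gamma> (t + 1) * (2 * H)\<^sup>2 / 2)"
      using agent_step[OF t \<mu> v_in_shrunk[OF t], of i] by linarith
  qed
  also have "\<dots> = (\<Sum>t=1..T. primal t) + (1 + \<mu>) * \<Gamma>\<^sub>0 * (?e + ?N * (\<Sum>t=1..T. \<tau> t) + ?N * ?D)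
      + (\<Sum>i\<in>UNIV. \<Sum>t=1..T. ?dual i t) + 2 * H\<^sup>2 * M\<^sub>s * (\<Sum>t=1..T. \<gamma> (t + 1))"
  proof -
    have "(\<Sum>t=1..T. \<Sum>i\<in>UNIV. ?dual i t) = (\<Sum>i\<in>UNIV. \<Sum>t=1..T. ?dual i t)" by (rule sum.swap)
    moreover have "(\<Sum>t=1..T. \<Sum>i\<in>UNIV. real (m i) * (\<gamma> (t + 1) * (2 * H)\<^sup>2 / 2)) = 2 * H\<^sup>2 * M\<^sub>s * (\<Sum>t=1..T. \<gamma> (t + 1))"
    proof -
      have "(\<Sum>i\<in>UNIV. real (m i) * (\<gamma> (t + 1) * (2 * H)\<^sup>2 / 2)) = 2 * H\<^sup>2 * M\<^sub>s * \<gamma> (t + 1)" for t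
        unfolding M\<^sub>s_def sum_distrib_right[symmetric] by (simp add: power_mult_distrib)
      then show ?thesis by (simp only: sum_distrib_left)
    qed
    moreover have "(\<Sum>t=1..T. \<Sum>i\<in>UNIV. (1 + \<mu>) * \<Gamma>\<^sub>0 * (norm (\<epsilon> i t) + \<tau> t + spread (\<lambda>i. x i t)))
        = (1 + \<mu>) * \<Gamma>\<^sub>0 * (?e + ?N * (\<Sum>t=1..T. \<tau> t) + ?N * ?D)"
      by (simp only: sum_distrib_left[symmetric] sum.distrib sum_constant)
    ultimately show ?thesis unfolding sum.distrib primal_def by simp
  qed
  also have "(\<Sum>i\<in>UNIV. \<Sum>t=1..T. ?dual i t) \<le> (\<Sum>i\<in>UNIV. real (m i) * \<mu>\<^sup>2 * (1 + real T powr (1 - \<kappa>) / (1 - \<kappa>)))"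
    by (intro sum_mono sum_dual_le \<mu>)
  also have "\<dots> = M\<^sub>s * \<mu>\<^sup>2 * (1 + real T powr (1 - \<kappa>) / (1 - \<kappa>))"
    by (simp only: M\<^sub>s_def sum_distrib_right)
  also have "2 * H\<^sup>2 * M\<^sub>s * (\<Sum>t=1..T. \<gamma> (t + 1)) \<le> 2 * H\<^sup>2 * M\<^sub>s * (real T powr \<kappa> / \<kappa>)"
    using M\<^sub>s_nonneg by (intro mult_left_mono sum_\<gamma>_le) auto
  also have "(1 + \<mu>) * \<Gamma>\<^sub>0 * (?e + ?N * (\<Sum>t=1..T. \<tau> t) + ?N * ?D) \<le> (1 + \<mu>) * \<Gamma>\<^sub>0 * (?e + ?N * \<tau>sum + ?N * ?D)"
    using \<mu> \<Gamma>_nonneg(1)[OF \<Lambda>] sum_\<tau>_le[of T] by (intro mult_left_mono add_mono) auto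
  finally have main: "(\<Sum>t=1..T. \<Sum>i\<in>UNIV. est_gap i t (v t) + \<mu> * (\<Sum>k<m i. gpos i t k (x i t))) + (1 + \<mu>) * \<Lambda> * ?D
     \<le> (\<Sum>t=1..T. primal t) + (1 + \<mu>) * (\<Gamma>\<^sub>0 * (?e + ?N * \<tau>sum) + (\<Gamma>\<^sub>0 * ?N + \<Lambda>) * ?D)
      + M\<^sub>s * \<mu>\<^sup>2 * (1 + real T powr (1 - \<kappa>) / (1 - \<kappa>)) + 2 * H\<^sup>2 * M\<^sub>s * (real T powr \<kappa> / \<kappa>)"
    by (simp add: algebra_simps)
  \<comment> \<open>Separates the bound into a part without \<open>\<mu>\<close>, for the regret,
    and a part proportional to \<open>\<mu>\<^sup>2\<close>.\<close>
  have square_le: "(1 + \<mu>)\<^sup>2 \<le> 2 * (1 + \<mu>\<^sup>2)"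
    using zero_le_power2[of "1 - \<mu>"] by (simp add: power2_eq_square algebra_simps)
  define K U where "K = 2 * real L / \<eta>" and "U = \<Gamma>\<^sub>0 * ?N + \<Lambda>"
  have \<Gamma>_eq: "\<Gamma>\<^sub>1 \<Lambda> = \<Gamma>\<^sub>0 + U * K" "\<Gamma>\<^sub>2 \<Lambda> = \<Gamma>\<^sub>0 * ?N * \<tau>sum + U * (K * (R + ?N * \<tau>sum))"
    unfolding \<Gamma>\<^sub>1_def \<Gamma>\<^sub>2_def K_def U_def by (rule refl)+
  have "(\<Gamma>\<^sub>0 * ?N + \<Lambda>) * ?D \<le> (\<Gamma>\<^sub>0 * ?N + \<Lambda>) * (2 * real L / \<eta> * (R + ?N * \<tau>sum + ?e))"
    using \<Gamma>_nonneg(1)[OF \<Lambda>] \<Lambda> by (intro mult_left_mono sum_spread_run_le) auto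
  then have "\<Gamma>\<^sub>0 * (?e + ?N * \<tau>sum) + (\<Gamma>\<^sub>0 * ?N + \<Lambda>) * ?D \<le> \<Gamma>\<^sub>1 \<Lambda> * ?e + \<Gamma>\<^sub>2 \<Lambda>"
    unfolding \<Gamma>_eq K_def[symmetric] U_def[symmetric] by (simp add: algebra_simps)
  then have "(1 + \<mu>) * (\<Gamma>\<^sub>0 * (?e + ?N * \<tau>sum) + (\<Gamma>\<^sub>0 * ?N + \<Lambda>) * ?D) \<le> (1 + \<mu>) * (\<Gamma>\<^sub>1 \<Lambda> * ?e + \<Gamma>\<^sub>2 \<Lambda>)"
    using \<mu> by (intro mult_left_mono) auto
  \<comment> \<open>Each displacement is maximised against its own negative square, which leaves
    \<open>?k\<^sup>2 * \<alpha> (t + 1) / 2\<close>; the sum of the \<open>\<alpha> (t + 1)\<close>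
    is of order \<open>sqrt T\<close>.\<close>
  moreover have "(1 + \<mu>) * \<Gamma>\<^sub>1 \<Lambda> * ?e - ?e2 \<le> ?N * ((1 + \<mu>) * \<Gamma>\<^sub>1 \<Lambda>)\<^sup>2 * sqrt \<tau>sum * ?s"
  proof -
    let ?k = "(1 + \<mu>) * \<Gamma>\<^sub>1 \<Lambda>"
    have "?k * ?e - ?e2 = (\<Sum>t=1..T. \<Sum>i\<in>UNIV. ?k * norm (\<epsilon> i t) - (norm (\<epsilon> i t))\<^sup>2 / (2 * \<alpha> (t + 1)))"
      by (simp only: sum_subtractf sum_distrib_left)
    also have "\<dots> \<le> (\<Sum>t=1..T. \<Sum>i\<in>(UNIV::'n set). ?k\<^sup>2 * \<alpha> (t + 1) / 2)"
      by (intro sum_mono linear_minus_square_le \<alpha>_pos) simp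
    also have "\<dots> = ?N * ?k\<^sup>2 / 2 * (\<Sum>t=1..T. \<alpha> (t + 1))"
      by (simp add: sum_distrib_left mult.assoc)
    also have "\<dots> \<le> ?N * ?k\<^sup>2 / 2 * (2 * sqrt \<tau>sum * ?s)"
      by (intro mult_left_mono sum_\<alpha>_le) simp
    finally show ?thesis by simp
  qed
  moreover have "?N * ((1 + \<mu>) * \<Gamma>\<^sub>1 \<Lambda>)\<^sup>2 * sqrt \<tau>sum * ?s \<le> 2 * ?N * (\<Gamma>\<^sub>1 \<Lambda>)\<^sup>2 * sqrt \<tau>sum * ((1 + \<mu>\<^sup>2) * ?s)"
  proof -
    have "(1 + \<mu>)\<^sup>2 * (?N * (\<Gamma>\<^sub>1 \<Lambda>)\<^sup>2 * sqrt \<tau>sum * ?s) \<le> 2 * (1 + \<mu>\<^sup>2) * (?N * (\<Gamma>\<^sub>1 \<Lambda>)\<^sup>2 * sqrt \<tau>sum * ?s)"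
      using \<tau>sum_pos by (intro mult_right_mono square_le) auto
    moreover have "(1 + \<mu>)\<^sup>2 * (?N * (\<Gamma>\<^sub>1 \<Lambda>)\<^sup>2 * sqrt \<tau>sum * ?s) = ?N * ((1 + \<mu>) * \<Gamma>\<^sub>1 \<Lambda>)\<^sup>2 * sqrt \<tau>sum * ?s"
      "2 * (1 + \<mu>\<^sup>2) * (?N * (\<Gamma>\<^sub>1 \<Lambda>)\<^sup>2 * sqrt \<tau>sum * ?s) = 2 * ?N * (\<Gamma>\<^sub>1 \<Lambda>)\<^sup>2 * sqrt \<tau>sum * ((1 + \<mu>\<^sup>2) * ?s)"
      by (simp_all only: power_mult_distrib mult_ac)
    ultimately show ?thesis by linarith
  qed
  moreover have "(1 + \<mu>) * \<Gamma>\<^sub>2 \<Lambda> \<le> 2 * \<Gamma>\<^sub>2 \<Lambda> * ((1 + \<mu>\<^sup>2) * ?s)"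
  proof -
    have "(1 + \<mu>) * 1 \<le> (1 + \<mu>) * (1 + \<mu>)" using \<mu> by (intro mult_left_mono) auto
    then have "1 + \<mu> \<le> (1 + \<mu>)\<^sup>2" by (simp add: power2_eq_square)
    also have "\<dots> \<le> 2 * (1 + \<mu>\<^sup>2)" by (rule square_le)
    also have "\<dots> \<le> 2 * (1 + \<mu>\<^sup>2) * ?s"
      using mult_left_mono[of 1 ?s "2 * (1 + \<mu>\<^sup>2)"] T by simp
    finally have "(1 + \<mu>) * \<Gamma>\<^sub>2 \<Lambda> \<le> 2 * (1 + \<mu>\<^sup>2) * ?s * \<Gamma>\<^sub>2 \<Lambda>"
      using \<Gamma>_nonneg(3)[OF \<Lambda>] by (rule mult_right_mono)
    also have "\<dots> = 2 * \<Gamma>\<^sub>2 \<Lambda> * ((1 + \<mu>\<^sup>2) * ?s)" by (simp only: mult_ac)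
    finally show ?thesis .
  qed
  ultimately have sum_le: "(\<Sum>t=1..T. \<Sum>i\<in>UNIV. est_gap i t (v t) + \<mu> * (\<Sum>k<m i. gpos i t k (x i t))) + (1 + \<mu>) * \<Lambda> * ?D
     \<le> 2 * R\<^sup>2 * ?N * sqrt (2 * c) * ?s + 2 * ?N * R * sqrt (2 * c) * ?s * (\<tau>sum + R + P)
      + 2 * ?N * (\<Gamma>\<^sub>1 \<Lambda>)\<^sup>2 * sqrt \<tau>sum * ((1 + \<mu>\<^sup>2) * ?s) + 2 * \<Gamma>\<^sub>2 \<Lambda> * ((1 + \<mu>\<^sup>2) * ?s)
      + M\<^sub>s * \<mu>\<^sup>2 * (1 + real T powr (1 - \<kappa>) / (1 - \<kappa>)) + 2 * H\<^sup>2 * M\<^sub>s * (real T powr \<kappa> / \<kappa>)"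
    using main sum_primal_le[of T] unfolding P_def distrib_left[of "1 + \<mu>"] mult.assoc[of "1 + \<mu>" "\<Gamma>\<^sub>1 \<Lambda>", symmetric]
    by linarith
  define a1 a2 a3 where "a1 = 2 * R\<^sup>2 * ?N * sqrt (2 * c) + 2 * ?N * R * sqrt (2 * c) * (\<tau>sum + R)"
    and "a2 = 2 * \<Gamma>\<^sub>2 \<Lambda> + 2 * ?N * (\<Gamma>\<^sub>1 \<Lambda>)\<^sup>2 * sqrt \<tau>sum" and "a3 = 2 * ?N * R * sqrt (2 * c)"
  define a4 a5 where "a4 = 2 * H\<^sup>2 * M\<^sub>s / \<kappa>" and "a5 = M\<^sub>s / (1 - \<kappa>)"
  have nn: "0 \<le> a1" "0 \<le> a2" "0 \<le> a3" "0 \<le> a4" "0 \<le> a5" "0 \<le> M\<^sub>s"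
    unfolding a1_def a2_def a3_def a4_def a5_def
    using \<Gamma>_nonneg[OF \<Lambda>] X(5) c \<tau>sum_pos M\<^sub>s_nonneg \<kappa>
    by (auto intro!: add_nonneg_nonneg mult_nonneg_nonneg divide_nonneg_nonneg)
  have Cp: "C\<^sub>p \<Lambda> = a1 + a2 + a3 + a4 + M\<^sub>s + a5"
    by (simp add: C\<^sub>p_def C\<^sub>1_def a1_def a2_def a3_def a4_def a5_def)
  have P0: "0 \<le> P" by (simp add: P_def sum_nonneg)
  have s1: "1 \<le> ?s" using T by simp
  have "2 * R\<^sup>2 * ?N * sqrt (2 * c) * ?s + 2 * ?N * R * sqrt (2 * c) * ?s * (\<tau>sum + R + P)
      + 2 * ?N * (\<Gamma>\<^sub>1 \<Lambda>)\<^sup>2 * sqrt \<tau>sum * ((1 + \<mu>\<^sup>2) * ?s) + 2 * \<Gamma>\<^sub>2 \<Lambda> * ((1 + \<mu>\<^sup>2) * ?s)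
      + M\<^sub>s * \<mu>\<^sup>2 * (1 + real T powr (1 - \<kappa>) / (1 - \<kappa>)) + 2 * H\<^sup>2 * M\<^sub>s * (real T powr \<kappa> / \<kappa>)
    = (a1 + a2) * ?s + a2 * (\<mu>\<^sup>2 * ?s) + a3 * (?s * P) + M\<^sub>s * \<mu>\<^sup>2 + a5 * (\<mu>\<^sup>2 * real T powr (1 - \<kappa>)) + a4 * real T powr \<kappa>"
    by (simp add: a1_def a2_def a3_def a4_def a5_def algebra_simps)
  \<comment> \<open>One \<open>M\<^sub>s\<close> in \<open>C\<^sub>p\<close> is set aside for the
    lone term \<open>M\<^sub>s * \<mu>\<^sup>2\<close>, which is rounded up to a multiple of
    \<open>\<mu>\<^sup>2 * sqrt T\<close>.\<close>
  also have "\<dots> \<le> C\<^sub>p \<Lambda> * ?s + (C\<^sub>p \<Lambda> - M\<^sub>s) * (\<mu>\<^sup>2 * ?s) + C\<^sub>p \<Lambda> * (?s * P) + M\<^sub>s * (\<mu>\<^sup>2 * ?s)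
      + C\<^sub>p \<Lambda> * (\<mu>\<^sup>2 * real T powr (1 - \<kappa>)) + C\<^sub>p \<Lambda> * real T powr \<kappa>"
  proof -
    have "(a1 + a2) * ?s \<le> C\<^sub>p \<Lambda> * ?s" "a2 * (\<mu>\<^sup>2 * ?s) \<le> (C\<^sub>p \<Lambda> - M\<^sub>s) * (\<mu>\<^sup>2 * ?s)"
      "a3 * (?s * P) \<le> C\<^sub>p \<Lambda> * (?s * P)" "a4 * real T powr \<kappa> \<le> C\<^sub>p \<Lambda> * real T powr \<kappa>"
      "a5 * (\<mu>\<^sup>2 * real T powr (1 - \<kappa>)) \<le> C\<^sub>p \<Lambda> * (\<mu>\<^sup>2 * real T powr (1 - \<kappa>))"
      by (rule mult_right_mono; use nn P0 Cp in simp)+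
    moreover have "\<mu>\<^sup>2 * 1 \<le> \<mu>\<^sup>2 * ?s" using s1 by (rule mult_left_mono) simp
    then have "M\<^sub>s * \<mu>\<^sup>2 \<le> M\<^sub>s * (\<mu>\<^sup>2 * ?s)" using nn by (intro mult_left_mono) auto
    ultimately show ?thesis by linarith
  qed
  also have "\<dots> = C\<^sub>p \<Lambda> * (?s + real T powr \<kappa> + ?s * P + \<mu>\<^sup>2 * (?s + real T powr (1 - \<kappa>)))"
    by (simp add: algebra_simps)
  finally show ?thesis using sum_le by linarith
qed

end

end

section \<open>Conditioning on the past\<close>

lemma borel_measurable_grad_est:
  fixes h :: "real ^ 'p \<Rightarrow> real"
  assumes h: "continuous_on X h" and [measurable]: "Y \<in> borel_measurable N" "U \<in> borel_measurable N"
    and "\<And>\<omega>. \<omega> \<in> space N \<Longrightarrow> Y \<omega> \<in> X" "\<And>\<omega>. \<omega> \<in> space N \<Longrightarrow> Y \<omega> + d *\<^sub>R U \<omega> \<in> X"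
  shows "(\<lambda>\<omega>. grad_est d h (Y \<omega>) (U \<omega>)) \<in> borel_measurable N"
proof -
  have [measurable]: "(\<lambda>\<omega>. h (Y \<omega>)) \<in> borel_measurable N" "(\<lambda>\<omega>. h (Y \<omega> + d *\<^sub>R U \<omega>)) \<in> borel_measurable N"
    by (rule borel_measurable_compose_continuous_on[OF h]; use assms in measurable)+
  show ?thesis unfolding grad_est_def by measurable
qed

lemma lipschitz_imp_continuous_on:
  fixes h :: "'a::real_normed_vector \<Rightarrow> real"
  assumes "\<And>x y. x \<in> X \<Longrightarrow> y \<in> X \<Longrightarrow> \<bar>h x - h y\<bar> \<le> K * norm (x - y)" "0 \<le> K"
  shows "continuous_on X h"
  by (rule lipschitz_on_continuous_on[of K], rule lipschitz_onI) (use assms in \<open>auto simp: dist_norm\<close>)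

locale stochastic_run = problem E W w B X r R m f g F1 F2 c \<kappa> \<alpha> \<beta> \<gamma> \<tau> \<xi> \<delta> \<Psi>
  for E :: "nat \<Rightarrow> ('n::finite \<times> 'n) set" and W w B and X :: "(real ^ 'p) set"
    and r R m f g F1 F2 c \<kappa> \<alpha> \<beta> \<gamma> \<tau> \<xi> \<delta> \<Psi> +
  fixes M :: "'w measure" and u x xh :: "'n \<Rightarrow> nat \<Rightarrow> 'w \<Rightarrow> real ^ 'p"
    and q :: "'n \<Rightarrow> nat \<Rightarrow> 'w \<Rightarrow> nat \<Rightarrow> real" and x1 :: "'n \<Rightarrow> real ^ 'p"
  assumes draws: "indep_sphere_draws M u"
    and algorithm: "\<And>\<omega>. \<omega> \<in> space M \<Longrightarrow>
           algorithm_run X m f g W \<alpha> \<beta> \<gamma> \<tau> \<xi> \<delta> x1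
             (\<lambda>i t. u i t \<omega>) (\<lambda>i t. x i t \<omega>) (\<lambda>i t. xh i t \<omega>) (\<lambda>i t. q i t \<omega>)"
begin

sublocale prob_space M
  using draws by (simp add: indep_sphere_draws_def)

lemma run_at:
  assumes "\<omega> \<in> space M"
  shows "run E W w B X r R m f g F1 F2 c \<kappa> \<alpha> \<beta> \<gamma> \<tau> \<xi> \<delta> \<Psi> x1
    (\<lambda>i t. u i t \<omega>) (\<lambda>i t. x i t \<omega>) (\<lambda>i t. xh i t \<omega>) (\<lambda>i t. q i t \<omega>)"
  using draws assms
  by (intro run.intro problem_axioms run_axioms.intro algorithm) (auto simp: indep_sphere_draws_def)

lemma x_in_shrunk: "\<omega> \<in> space M \<Longrightarrow> t \<ge> 1 \<Longrightarrow> x i t \<omega> \<in> shrunk t"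
  by (rule run.x_in_shrunk[OF run_at])

lemma x_in_X: "\<omega> \<in> space M \<Longrightarrow> t \<ge> 1 \<Longrightarrow> x i t \<omega> \<in> X"
  by (rule run.x_in_X[OF run_at])

lemma perturbed_in_X: "\<omega> \<in> space M \<Longrightarrow> t \<ge> 1 \<Longrightarrow> x i t \<omega> + \<delta> t *\<^sub>R u i t \<omega> \<in> X"
  by (rule run.perturbed_in_X[OF run_at])

lemma continuous_f: "t \<ge> 1 \<Longrightarrow> continuous_on X (f i t)"
  by (rule lipschitz_imp_continuous_on[OF f_lipschitz F2_nonneg])

lemma continuous_gpos: "t \<ge> 1 \<Longrightarrow> k < m i \<Longrightarrow> continuous_on X (gpos i t k)"
  by (rule lipschitz_imp_continuous_on[OF gpos_lipschitz F2_nonneg])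

text \<open>The state at round \<open>t\<close> is built from the draws of the earlier rounds by
  continuous and measurable operations. Entries of \<open>q\<close> from index \<open>m i\<close> on
  are unspecified, hence the restriction on \<open>k\<close>.\<close>

lemma measurable_state:
  "t \<ge> 1 \<Longrightarrow> (\<forall>i. x i t \<in> borel_measurable (past M u t) \<and> xh i t \<in> borel_measurable (past M u t) \<and>
     (\<forall>k<m i. (\<lambda>\<omega>. q i t \<omega> k) \<in> borel_measurable (past M u t)))"
proof (induction t rule: dec_induct)
  \<comment> \<open>The initial state is constant on \<open>space M\<close> only; outside it the
    trajectories are arbitrary.\<close>
  case base
  have "x i 1 \<in> borel_measurable (past M u 1)" "xh i 1 \<in> borel_measurable (past M u 1)"
    "k < m i \<Longrightarrow> (\<lambda>\<omega>. q i 1 \<omega> k) \<in> borel_measurable (past M u 1)" for i k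
  proof -
    have eq: "x i 1 \<omega> = x1 i" "xh i 1 \<omega> = x1 i" "k < m i \<Longrightarrow> q i 1 \<omega> k = 0" if "\<omega> \<in> space M" for \<omega>
      using algorithm[OF that] unfolding algorithm_run_def by auto
    show "x i 1 \<in> borel_measurable (past M u 1)"
      by (rule measurable_cong[THEN iffD2, of _ _ "\<lambda>_. x1 i"]) (use eq(1) in simp_all)
    show "xh i 1 \<in> borel_measurable (past M u 1)"
      by (rule measurable_cong[THEN iffD2, of _ _ "\<lambda>_. x1 i"]) (use eq(2) in simp_all)
    show "(\<lambda>\<omega>. q i 1 \<omega> k) \<in> borel_measurable (past M u 1)" if "k < m i"
      by (rule measurable_cong[THEN iffD2, of _ _ "\<lambda>_. 0"]) (use eq(3) that in simp_all)
  qed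
  then show ?case by simp
next
  case (step t)
  then have t: "t \<ge> 1" by simp
  let ?N = "past M u (t + 1)"
  have x [measurable]: "x i t \<in> borel_measurable ?N" and xh [measurable]: "xh i t \<in> borel_measurable ?N"
    and u [measurable]: "u i t \<in> borel_measurable ?N" for i
    using step.IH t by (auto intro: measurable_past_mono[of _ M u t] measurable_past_draw)
  have q [measurable]: "(\<lambda>\<omega>. q i t \<omega> k) \<in> borel_measurable ?N" if "k < m i" for i k
    using step.IH that by (auto intro: measurable_past_mono[of _ M u t])
  define df where "df i \<omega> = grad_est (\<delta> t) (f i t) (x i t \<omega>) (u i t \<omega>)" for i \<omega>
  define dg where "dg i k \<omega> = grad_est (\<delta> t) (gpos i t k) (x i t \<omega>) (u i t \<omega>)" for i k \<omega>
  have df [measurable]: "df i \<in> borel_measurable ?N" for i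
    unfolding df_def
    by (rule borel_measurable_grad_est[OF continuous_f[OF t] x u]) (use t x_in_X perturbed_in_X in auto)
  have dg [measurable]: "dg i k \<in> borel_measurable ?N" if "k < m i" for i k
    unfolding dg_def
    by (rule borel_measurable_grad_est[OF continuous_gpos[OF t that] x u]) (use t x_in_X perturbed_in_X in auto)
  have gx [measurable]: "(\<lambda>\<omega>. gpos i t k (x i t \<omega>)) \<in> borel_measurable ?N" if "k < m i" for i k
    by (rule borel_measurable_compose_continuous_on[OF continuous_gpos[OF t that] x]) (use t x_in_X in auto)
  have x_Suc: "x i (t + 1) \<in> borel_measurable ?N" for i
  proof -
    have [measurable]: "closest_point (shrunk (t + 1)) \<in> borel_measurable borel"
      by (intro borel_measurable_continuous_onI continuous_on_closest_point shrunk)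
    have [measurable]: "(\<lambda>\<omega>. \<Sum>k<m i. q i t \<omega> k *\<^sub>R dg i k \<omega>) \<in> borel_measurable ?N"
      by (intro borel_measurable_sum borel_measurable_scaleR q dg) auto
    have "(\<lambda>\<omega>. closest_point (shrunk (t + 1)) ((\<Sum>j\<in>UNIV. W t $ i $ j *\<^sub>R xh j t \<omega>)
        - \<alpha> (t + 1) *\<^sub>R (df i \<omega> + (\<Sum>k<m i. q i t \<omega> k *\<^sub>R dg i k \<omega>)))) \<in> borel_measurable ?N"
      by measurable
    then show ?thesis
      by (rule measurable_cong[THEN iffD1, rotated])
        (simp add: run.x_Suc[OF run_at t, simplified] run.df_def[OF run_at] run.dg_def[OF run_at] run.z_def[OF run_at] df_def dg_def)
  qed
  have xh_Suc: "xh i (t + 1) \<in> borel_measurable ?N" for i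
  proof -
    note [measurable] = x_Suc[of i]
    have "(\<lambda>\<omega>. if norm (x i (t + 1) \<omega> - xh i t \<omega>) \<ge> \<tau> (t + 1) then x i (t + 1) \<omega> else xh i t \<omega>) \<in> borel_measurable ?N"
      by measurable
    then show ?thesis
      by (rule measurable_cong[THEN iffD1, rotated]) (simp add: run.xh_Suc[OF run_at t, simplified])
  qed
  have q_Suc: "(\<lambda>\<omega>. q i (t + 1) \<omega> k) \<in> borel_measurable ?N" if k: "k < m i" for i k
  proof -
    note [measurable] = x_Suc[of i] q[OF k] dg[OF k] gx[OF k]
    have "(\<lambda>\<omega>. max 0 ((1 - \<beta> (t + 1) * \<gamma> (t + 1)) * q i t \<omega> k
        + \<gamma> (t + 1) * (gpos i t k (x i t \<omega>) + dg i k \<omega> \<bullet> (x i (t + 1) \<omega> - x i t \<omega>)))) \<in> borel_measurable ?N"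
      by measurable
    then show ?thesis
      by (rule measurable_cong[THEN iffD1, rotated])
        (simp add: run.q_Suc[OF run_at t k, simplified] run.dg_def[OF run_at] dg_def)
  qed
  show ?case using x_Suc xh_Suc q_Suc by simp
qed

lemma measurable_x: "t \<ge> 1 \<Longrightarrow> x i t \<in> borel_measurable (past M u t)"
  and measurable_q: "t \<ge> 1 \<Longrightarrow> k < m i \<Longrightarrow> (\<lambda>\<omega>. q i t \<omega> k) \<in> borel_measurable (past M u t)"
  using measurable_state by auto

lemma random_variable_x [measurable]: "t \<ge> 1 \<Longrightarrow> random_variable borel (x i t)"
  using measurable_past[OF draws measurable_x] .

text \<open>The weight \<open>Y\<close> is determined by the past and nonnegative, so it multiplies
  the inequality for a frozen state. It is 1 for the losses and \<open>q\<close> for the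
  constraints.\<close>

lemma estimator_gap:
  assumes t: "t \<ge> 1" and v: "v \<in> shrunk t" and h: "convex_on X h"
    and lip: "\<And>z z'. z \<in> X \<Longrightarrow> z' \<in> X \<Longrightarrow> \<bar>h z - h z'\<bar> \<le> F2 * norm (z - z')"
    and Y: "Y \<in> borel_measurable (past M u t)" "\<And>\<omega>. \<omega> \<in> space M \<Longrightarrow> 0 \<le> Y \<omega>" "\<And>\<omega>. \<omega> \<in> space M \<Longrightarrow> Y \<omega> \<le> K"
  shows "integrable M (\<lambda>\<omega>. Y \<omega> * (grad_est (\<delta> t) h (x i t \<omega>) (u i t \<omega>) \<bullet> (x i t \<omega> - v)))" (is "integrable M ?A")
    and "integrable M (\<lambda>\<omega>. Y \<omega> * (h (x i t \<omega>) - h v - 2 * F2 * \<delta> t))" (is "integrable M ?B")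
    and "expectation (\<lambda>\<omega>. Y \<omega> * (h (x i t \<omega>) - h v - 2 * F2 * \<delta> t))
      \<le> expectation (\<lambda>\<omega>. Y \<omega> * (grad_est (\<delta> t) h (x i t \<omega>) (u i t \<omega>) \<bullet> (x i t \<omega> - v)))"
proof -
  \<comment> \<open>\<open>h\<close> may fail to be measurable off \<open>X\<close>\<close>
  define h' where "h' z = h (closest_point X z)" for z
  have h'_eq: "h' z = h z" if "z \<in> X" for z
    using that by (simp add: h'_def closest_point_self)
  have cont: "continuous_on X h" by (rule lipschitz_imp_continuous_on[OF lip F2_nonneg])
  have X_ne: "X \<noteq> {}" using zero_in_X by auto
  have "continuous_on UNIV h'"
    unfolding h'_def
    by (rule continuous_on_compose2[OF cont continuous_on_closest_point[OF X(1,2) X_ne]])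
      (use closest_point_in_set[OF X(2) X_ne] in auto)
  then have [measurable]: "h' \<in> borel_measurable borel" by (rule borel_measurable_continuous_onI)
  let ?F = "past M u t"
  note [measurable] = measurable_x[OF t] Y(1)
  have vX: "v \<in> X" using v shrunk_subset[OF t] by auto
  define \<phi> where "\<phi> = (\<lambda>(\<omega>, a). Y \<omega> * (grad_est (\<delta> t) h' (x i t \<omega>) a \<bullet> (x i t \<omega> - v)))"
  define \<psi> where "\<psi> \<omega> = Y \<omega> * (h' (x i t \<omega>) - h' v - 2 * F2 * \<delta> t)" for \<omega>
  have \<phi>_meas [measurable]: "\<phi> \<in> borel_measurable (?F \<Otimes>\<^sub>M borel)"
    unfolding \<phi>_def grad_est_def by measurable
  have \<psi>_meas [measurable]: "\<psi> \<in> borel_measurable ?F"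
    unfolding \<psi>_def by measurable
  have A: "?A \<omega> = \<phi> (\<omega>, u i t \<omega>)" and B: "?B \<omega> = \<psi> \<omega>" if "\<omega> \<in> space M" for \<omega>
    using that t x_in_X perturbed_in_X vX by (simp_all add: \<phi>_def \<psi>_def grad_est_def h'_eq)
  have bound: "\<bar>?A \<omega>\<bar> \<le> K * (real CARD('p) * F2 * (2 * R))" "\<bar>?B \<omega>\<bar> \<le> K * (F2 * (2 * R) + 2 * F2 * \<delta> t)"
    if \<omega>: "\<omega> \<in> space M" for \<omega>
  proof -
    have nd: "norm (x i t \<omega> - v) \<le> 2 * R"
      using norm_triangle_ineq4[of "x i t \<omega>" v] norm_X[OF x_in_X[OF \<omega> t]] norm_X[OF vX] by (smt (verit))
    have u1: "norm (u i t \<omega>) = 1" by (rule run.norm_u[OF run_at[OF \<omega>] t])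
    have "norm (grad_est (\<delta> t) h (x i t \<omega>) (u i t \<omega>)) \<le> real CARD('p) * F2"
      using lip[OF perturbed_in_X[OF \<omega> t, of i] x_in_X[OF \<omega> t, of i]] \<delta>_pos[OF t] u1 by (intro norm_grad_est_le) simp_all
    then have "\<bar>grad_est (\<delta> t) h (x i t \<omega>) (u i t \<omega>) \<bullet> (x i t \<omega> - v)\<bar> \<le> real CARD('p) * F2 * (2 * R)"
      using nd F2_nonneg by (intro order_trans[OF Cauchy_Schwarz_ineq2] mult_mono) auto
    then show "\<bar>?A \<omega>\<bar> \<le> K * (real CARD('p) * F2 * (2 * R))"
      unfolding abs_mult using Y(2,3)[OF \<omega>] by (intro mult_mono) auto
    have "\<bar>h (x i t \<omega>) - h v\<bar> \<le> F2 * (2 * R)"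
      using lip[OF x_in_X[OF \<omega> t, of i] vX] mult_left_mono[OF nd F2_nonneg] by linarith
    moreover have "0 \<le> F2 * \<delta> t" using F2_nonneg \<delta>_pos[OF t] by simp
    ultimately have "\<bar>h (x i t \<omega>) - h v - 2 * F2 * \<delta> t\<bar> \<le> F2 * (2 * R) + 2 * F2 * \<delta> t" by linarith
    then show "\<bar>?B \<omega>\<bar> \<le> K * (F2 * (2 * R) + 2 * F2 * \<delta> t)"
      unfolding abs_mult using Y(2,3)[OF \<omega>] by (intro mult_mono) auto
  qed
  have [measurable]: "u i t \<in> borel_measurable M" by (rule measurable_draw[OF draws t])
  have [measurable]: "(\<lambda>\<omega>. \<omega>) \<in> measurable M ?F"
    by (rule measurable_past[OF draws, of "\<lambda>\<omega>. \<omega>" t]) simp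
  have int\<phi>: "integrable M (\<lambda>\<omega>. \<phi> (\<omega>, u i t \<omega>))"
    by (rule integrable_const_bound[of _ "K * (real CARD('p) * F2 * (2 * R))"])
      (use bound(1) A in \<open>auto intro!: AE_I2\<close>)
  have int\<psi>: "integrable M \<psi>"
    by (rule integrable_const_bound[of _ "K * (F2 * (2 * R) + 2 * F2 * \<delta> t)"])
      (use bound(2) B measurable_past[OF draws \<psi>_meas] in \<open>auto intro!: AE_I2\<close>)
  show "integrable M ?A" using int\<phi> by (rule Bochner_Integration.integrable_cong[THEN iffD2, rotated 2]) (auto simp: A)
  show "integrable M ?B" using int\<psi> by (rule Bochner_Integration.integrable_cong[THEN iffD2, rotated 2]) (auto simp: B)
  have sphere: "distr M borel (u i t) = uniform_sphere"
    using draws t by (simp add: indep_sphere_draws_def)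
  have "expectation \<psi> \<le> expectation (\<lambda>\<omega>. \<phi> (\<omega>, u i t \<omega>))"
  proof (rule expectation_indep_ge[where N = ?F and K = borel and U = "u i t" and \<phi> = \<phi> and \<psi> = \<psi>])
    fix \<omega> assume "\<omega> \<in> space ?F"
    then have \<omega>: "\<omega> \<in> space M" by simp
    have conv: "convex_on X h'"
    proof (rule convex_onI[OF _ X(1)])
      fix s :: real and a b assume s: "0 < s" "s < 1" and ab: "a \<in> X" "b \<in> X"
      have "(1 - s) *\<^sub>R a + s *\<^sub>R b \<in> X" using s ab X(1) by (intro convexD) auto
      then show "h' ((1 - s) *\<^sub>R a + s *\<^sub>R b) \<le> (1 - s) * h' a + s * h' b"
        using convex_onD[OF h, of s a b] s ab by (simp add: h'_eq)
    qed
    have "h' (x i t \<omega>) - h' v - 2 * F2 * \<delta> t \<le> (\<integral>a. grad_est (\<delta> t) h' (x i t \<omega>) a \<bullet> (x i t \<omega> - v) \<partial>uniform_sphere)"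
      by (rule grad_est_expectation_ge[OF conv])
        (use lip h'_eq \<delta>_pos[OF t] cball_shrunk[OF t x_in_shrunk[OF \<omega> t]] cball_shrunk[OF t v] in auto)
    then show "\<psi> \<omega> \<le> (\<integral>a. \<phi> (\<omega>, a) \<partial>distr M borel (u i t))"
      unfolding sphere \<psi>_def \<phi>_def using Y(2)[OF \<omega>] by (simp add: mult_left_mono)
  qed (use int\<phi> int\<psi> indep_set_past[OF draws t] sets_past_subset[OF draws] in auto)
  also have "expectation (\<lambda>\<omega>. \<phi> (\<omega>, u i t \<omega>)) = expectation ?A"
    by (rule Bochner_Integration.integral_cong) (auto simp: A)
  also have "expectation \<psi> = expectation ?B"
    by (rule Bochner_Integration.integral_cong) (auto simp: B)
  finally show "expectation ?B \<le> expectation ?A" .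
qed

end

section \<open>Taking expectations\<close>

context stochastic_run
begin

text \<open>\<open>est_gap\<close> with \<open>\<omega>\<close> as an explicit argument, in the form
  needed for integration.\<close>

definition gap :: "'n \<Rightarrow> nat \<Rightarrow> real ^ 'p \<Rightarrow> 'w \<Rightarrow> real" where
  "gap i t v \<omega> = grad_est (\<delta> t) (f i t) (x i t \<omega>) (u i t \<omega>) \<bullet> (x i t \<omega> - v)
    + (\<Sum>k<m i. q i t \<omega> k * (grad_est (\<delta> t) (gpos i t k) (x i t \<omega>) (u i t \<omega>) \<bullet> (x i t \<omega> - v) - gpos i t k (x i t \<omega>)))"

lemma est_gap_eq_gap:
  assumes "\<omega> \<in> space M"
  shows "run.est_gap m f g \<delta> (\<lambda>i t. u i t \<omega>) (\<lambda>i t. x i t \<omega>) (\<lambda>i t. q i t \<omega>) i t v = gap i t v \<omega>"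
  unfolding gap_def run.est_gap_def[OF run_at[OF assms]] run.df_def[OF run_at[OF assms]] run.dg_def[OF run_at[OF assms]] ..

lemma
  assumes t: "t \<ge> 1"
  shows integrable_f: "integrable M (\<lambda>\<omega>. f j t (x i t \<omega>))"
    and integrable_gpos: "k < m j \<Longrightarrow> integrable M (\<lambda>\<omega>. gpos j t k (x i t \<omega>))"
proof -
  note [measurable] = random_variable_x[OF t]
  show "integrable M (\<lambda>\<omega>. f j t (x i t \<omega>))"
  proof (rule integrable_const_bound[of _ "\<bar>f j t 0\<bar> + F1"])
    show "random_variable borel (\<lambda>\<omega>. f j t (x i t \<omega>))"
      by (rule borel_measurable_compose_continuous_on[OF continuous_f[OF t] random_variable_x[OF t]]) (rule x_in_X[OF _ t])
    show "AE \<omega> in M. norm (f j t (x i t \<omega>)) \<le> \<bar>f j t 0\<bar> + F1"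
    proof (rule AE_I2)
      fix \<omega> assume "\<omega> \<in> space M"
      from f_diff_le_F1[OF t x_in_X[OF this t, of i] zero_in_X, of j]
      show "norm (f j t (x i t \<omega>)) \<le> \<bar>f j t 0\<bar> + F1" by simp
    qed
  qed
  assume k: "k < m j"
  show "integrable M (\<lambda>\<omega>. gpos j t k (x i t \<omega>))"
  proof (rule integrable_const_bound[of _ F1])
    show "random_variable borel (\<lambda>\<omega>. gpos j t k (x i t \<omega>))"
      by (rule borel_measurable_compose_continuous_on[OF continuous_gpos[OF t k] random_variable_x[OF t]]) (rule x_in_X[OF _ t])
    show "AE \<omega> in M. norm (gpos j t k (x i t \<omega>)) \<le> F1"
      using gpos_le_F1[OF t k x_in_X[OF _ t]] by (intro AE_I2) simp
  qed
qed

lemma integrable_spread: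
  assumes t: "t \<ge> 1"
  shows "integrable M (\<lambda>\<omega>. spread (\<lambda>i. x i t \<omega>))"
proof (rule integrable_const_bound[of _ "2 * R"])
  note [measurable] = random_variable_x[OF t]
  show "random_variable borel (\<lambda>\<omega>. spread (\<lambda>i. x i t \<omega>))"
    unfolding spread_def by (intro borel_measurable_Max) (auto simp: case_prod_unfold)
  show "AE \<omega> in M. norm (spread (\<lambda>i. x i t \<omega>)) \<le> 2 * R"
    using t by (intro AE_I2) (auto simp: spread_nonneg intro!: spread_bounded norm_X x_in_X)
qed

lemma q_bounds:
  assumes \<omega>: "\<omega> \<in> space M" and t: "t \<ge> 1" and k: "k < m i"
  shows "0 \<le> q i t \<omega> k" "q i t \<omega> k \<le> H * real t powr \<kappa>"
proof -
  show "0 \<le> q i t \<omega> k" by (rule run.q_nonneg[OF run_at[OF \<omega>] t k])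
  have "\<beta> t * q i t \<omega> k \<le> H" by (rule run.\<beta>_mult_q_le[OF run_at[OF \<omega>] k t])
  then show "q i t \<omega> k \<le> H * real t powr \<kappa>" using t by (simp add: \<beta> field_simps)
qed

text \<open>In units of \<open>\<xi> t\<close>: \<open>R\<close> is the shift from \<open>y\<close>
  to the shrunk comparator, \<open>2 * r\<close> the estimator bias, as
  \<open>\<delta> t = r * \<xi> t\<close>.\<close>

definition K\<^sub>\<xi> where "K\<^sub>\<xi> = F2 * (R + 2 * r)"

text \<open>Both errors are O(\<open>\<xi> t\<close>). In the constraint part they are weighted by
  \<open>q \<le> H * t powr \<kappa>\<close>, and this product determines the rate
  \<open>t powr (\<kappa> - 1)\<close>.\<close>

lemma expectation_gap_ge:
  assumes t: "t \<ge> 1" and y: "y \<in> X" "\<And>k. k < m i \<Longrightarrow> g i t y k \<le> 0"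
  defines "v \<equiv> (1 - \<xi> t) *\<^sub>R y"
  shows "integrable M (gap i t v)"
    and "expectation (\<lambda>\<omega>. f i t (x i t \<omega>) - f i t y) - K\<^sub>\<xi> * (1 + M\<^sub>s * H) * real t powr (\<kappa> - 1)
      \<le> expectation (gap i t v)"
proof -
  have v: "v \<in> shrunk t" unfolding v_def shrunk_def using y(1) by blast
  then have vX: "v \<in> X" using shrunk_subset[OF t] by auto
  have vy: "norm (v - y) \<le> R * \<xi> t"
  proof -
    have "v - y = (- \<xi> t) *\<^sub>R y" by (simp add: v_def algebra_simps)
    then show ?thesis using \<xi>_bounds[OF t] mult_left_mono[OF norm_X[OF y(1)], of "\<xi> t"] by (simp add: mult.commute)
  qed
  let ?A = "\<lambda>\<omega>. grad_est (\<delta> t) (f i t) (x i t \<omega>) (u i t \<omega>) \<bullet> (x i t \<omega> - v)"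
  let ?B = "\<lambda>k \<omega>. q i t \<omega> k * (grad_est (\<delta> t) (gpos i t k) (x i t \<omega>) (u i t \<omega>) \<bullet> (x i t \<omega> - v))"
  let ?G = "\<lambda>k \<omega>. q i t \<omega> k * gpos i t k (x i t \<omega>)"
  have \<xi>_le: "0 \<le> K\<^sub>\<xi> * \<xi> t" "\<xi> t \<le> real t powr (- 1)" "K\<^sub>\<xi> \<ge> 0"
    using \<xi>_bounds[OF t] F2_nonneg X(4,5) t by (auto simp: K\<^sub>\<xi>_def \<xi> powr_minus_divide frac_le)
  have f_int: "integrable M ?A"
    and f_le: "expectation (\<lambda>\<omega>. f i t (x i t \<omega>) - f i t y) - K\<^sub>\<xi> * \<xi> t \<le> expectation ?A"
  proof -
    note est = estimator_gap[OF t v convex_f[OF t] f_lipschitz[OF t], of "\<lambda>_. 1" 1 i i, simplified]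
    show "integrable M ?A" by (rule est(1))
    have "f i t v \<le> f i t y + F2 * (R * \<xi> t)"
      using f_lipschitz[OF t vX y(1), of i] mult_left_mono[OF vy F2_nonneg] by linarith
    then have "f i t (x i t \<omega>) - f i t y - K\<^sub>\<xi> * \<xi> t \<le> f i t (x i t \<omega>) - f i t v - 2 * F2 * \<delta> t" for \<omega>
      by (simp add: K\<^sub>\<xi>_def \<delta>_eq[OF t] algebra_simps)
    then have "expectation (\<lambda>\<omega>. f i t (x i t \<omega>) - f i t y - K\<^sub>\<xi> * \<xi> t) \<le> expectation (\<lambda>\<omega>. f i t (x i t \<omega>) - f i t v - 2 * F2 * \<delta> t)"
      using integrable_f[OF t] by (intro integral_mono) auto
    also have "\<dots> \<le> expectation ?A" by (rule est(3))
    finally show "expectation (\<lambda>\<omega>. f i t (x i t \<omega>) - f i t y) - K\<^sub>\<xi> * \<xi> t \<le> expectation ?A"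
      using integrable_f[OF t] by (simp add: prob_space)
  qed
  have g_int: "integrable M (?B k)" "integrable M (?G k)"
    and g_le: "- (H * K\<^sub>\<xi> * real t powr (\<kappa> - 1)) \<le> expectation (\<lambda>\<omega>. ?B k \<omega> - ?G k \<omega>)" if k: "k < m i" for k
  proof -
    note est = estimator_gap[OF t v convex_gpos[OF t k] gpos_lipschitz[OF t k] measurable_q[OF t k] q_bounds[OF _ t k]]
    show B: "integrable M (?B k)" by (rule est(1))
    have [measurable]: "(\<lambda>\<omega>. q i t \<omega> k) \<in> borel_measurable M"
      by (rule measurable_past[OF draws measurable_q[OF t k]])
    have Hp: "0 \<le> H * real t powr \<kappa>" using H_nonneg by simp
    show G: "integrable M (?G k)"
    proof (rule integrable_const_bound[of _ "H * real t powr \<kappa> * F1"])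
      show "random_variable borel (?G k)"
        using integrable_gpos[OF t k, of i] by (intro borel_measurable_times) (auto dest: borel_measurable_integrable)
      show "AE \<omega> in M. norm (?G k \<omega>) \<le> H * real t powr \<kappa> * F1"
      proof (rule AE_I2)
        fix \<omega> assume \<omega>: "\<omega> \<in> space M"
        show "norm (?G k \<omega>) \<le> H * real t powr \<kappa> * F1"
          unfolding norm_mult using q_bounds[OF \<omega> t k] gpos_le_F1[OF t k x_in_X[OF \<omega> t, of i]] Hp
          by (intro mult_mono) auto
      qed
    qed
    \<comment> \<open>\<open>gpos\<close> vanishes at the feasible \<open>y\<close>, so at
      \<open>v\<close> it is bounded by the Lipschitz constant times the shift.\<close>
    have gv: "gpos i t k v \<le> F2 * (R * \<xi> t)"
      using gpos_lipschitz[OF t k vX y(1)] mult_left_mono[OF vy F2_nonneg] y(2)[OF k] by (simp add: abs_le_iff)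
    have pt: "- (H * K\<^sub>\<xi> * real t powr (\<kappa> - 1)) + ?G k \<omega> \<le> q i t \<omega> k * (gpos i t k (x i t \<omega>) - gpos i t k v - 2 * F2 * \<delta> t)"
      if \<omega>: "\<omega> \<in> space M" for \<omega>
    proof -
      have "q i t \<omega> k * (gpos i t k v + 2 * F2 * \<delta> t) \<le> q i t \<omega> k * (K\<^sub>\<xi> * \<xi> t)"
        using gv q_bounds[OF \<omega> t k] by (intro mult_left_mono) (auto simp: K\<^sub>\<xi>_def \<delta>_eq[OF t] algebra_simps)
      also have "\<dots> \<le> (H * real t powr \<kappa>) * (K\<^sub>\<xi> * real t powr (- 1))"
        using q_bounds[OF \<omega> t k] \<xi>_le Hp by (intro mult_mono mult_left_mono) auto
      also have "\<dots> = H * K\<^sub>\<xi> * real t powr (\<kappa> - 1)"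
        using t by (simp add: powr_diff powr_minus_divide)
      finally show ?thesis by (simp add: algebra_simps)
    qed
    have "expectation (\<lambda>\<omega>. - (H * K\<^sub>\<xi> * real t powr (\<kappa> - 1)) + ?G k \<omega>) \<le>
        expectation (\<lambda>\<omega>. q i t \<omega> k * (gpos i t k (x i t \<omega>) - gpos i t k v - 2 * F2 * \<delta> t))"
      using G est(2) pt by (intro integral_mono) auto
    also have "\<dots> \<le> expectation (?B k)" by (rule est(3))
    finally show "- (H * K\<^sub>\<xi> * real t powr (\<kappa> - 1)) \<le> expectation (\<lambda>\<omega>. ?B k \<omega> - ?G k \<omega>)"
      using B G by (simp add: prob_space)
  qed
  have gap_eq: "gap i t v = (\<lambda>\<omega>. ?A \<omega> + (\<Sum>k<m i. ?B k \<omega> - ?G k \<omega>))"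
    by (simp add: gap_def fun_eq_iff right_diff_distrib)
  have diff_int: "integrable M (\<lambda>\<omega>. ?B k \<omega> - ?G k \<omega>)" if "k < m i" for k
    using g_int[OF that] by (rule Bochner_Integration.integrable_diff)
  show "integrable M (gap i t v)"
    unfolding gap_eq using diff_int by (intro Bochner_Integration.integrable_add f_int Bochner_Integration.integrable_sum) auto
  have "expectation (gap i t v) = expectation ?A + (\<Sum>k<m i. expectation (\<lambda>\<omega>. ?B k \<omega> - ?G k \<omega>))"
  proof -
    have "expectation (\<lambda>\<omega>. \<Sum>k<m i. ?B k \<omega> - ?G k \<omega>) = (\<Sum>k<m i. expectation (\<lambda>\<omega>. ?B k \<omega> - ?G k \<omega>))"
      using diff_int by (intro Bochner_Integration.integral_sum) auto
    then show ?thesis unfolding gap_eq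
      using f_int diff_int by (subst Bochner_Integration.integral_add) (auto intro!: Bochner_Integration.integrable_sum)
  qed
  moreover have "(\<Sum>k<m i. - (H * K\<^sub>\<xi> * real t powr (\<kappa> - 1))) \<le> (\<Sum>k<m i. expectation (\<lambda>\<omega>. ?B k \<omega> - ?G k \<omega>))"
    using g_le by (intro sum_mono) auto
  moreover have "real (m i) * (H * K\<^sub>\<xi> * real t powr (\<kappa> - 1)) \<le> M\<^sub>s * (H * K\<^sub>\<xi> * real t powr (\<kappa> - 1))"
    using H_nonneg \<xi>_le by (intro mult_right_mono m_le_M\<^sub>s) auto
  moreover have "K\<^sub>\<xi> * \<xi> t \<le> K\<^sub>\<xi> * real t powr (\<kappa> - 1)"
    using \<xi>_le \<kappa> t powr_mono[of "- 1" "\<kappa> - 1" "real t"] by (intro mult_left_mono) auto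
  moreover have "K\<^sub>\<xi> * (1 + M\<^sub>s * H) * real t powr (\<kappa> - 1) = K\<^sub>\<xi> * real t powr (\<kappa> - 1) + M\<^sub>s * (H * K\<^sub>\<xi> * real t powr (\<kappa> - 1))"
    by (simp add: algebra_simps)
  ultimately show "expectation (\<lambda>\<omega>. f i t (x i t \<omega>) - f i t y) - K\<^sub>\<xi> * (1 + M\<^sub>s * H) * real t powr (\<kappa> - 1)
      \<le> expectation (gap i t v)"
    using f_le by simp
qed

definition C\<^sub>s where "C\<^sub>s \<Lambda> = C\<^sub>p \<Lambda> + real CARD('n) * (K\<^sub>\<xi> * (1 + M\<^sub>s * H)) / \<kappa>"

lemma C\<^sub>s_nonneg: "0 \<le> \<Lambda> \<Longrightarrow> 0 \<le> C\<^sub>s \<Lambda>"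
  unfolding C\<^sub>s_def K\<^sub>\<xi>_def using C_nonneg F2_nonneg H_nonneg M\<^sub>s_nonneg X(4,5) \<kappa>
  by (intro add_nonneg_nonneg divide_nonneg_nonneg mult_nonneg_nonneg) auto

text \<open>A common majorant for both results: with \<open>\<mu> = 0\<close> it dominates the
  regret, with \<open>\<mu> > 0\<close> the scaled constraint violation; \<open>\<Lambda>\<close> is
  chosen to cover the disagreement in each case.\<close>

definition objective :: "real \<Rightarrow> real \<Rightarrow> (nat \<Rightarrow> real ^ 'p) \<Rightarrow> nat \<Rightarrow> 'w \<Rightarrow> real" where
  "objective \<mu> \<Lambda> y T \<omega> =
    (\<Sum>t=1..T. \<Sum>i\<in>UNIV. (f i t (x i t \<omega>) - f i t (y t)) + \<mu> * (\<Sum>k<m i. gpos i t k (x i t \<omega>)))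
      + (1 + \<mu>) * \<Lambda> * (\<Sum>t=1..T. spread (\<lambda>i. x i t \<omega>))"

lemma integrable_objective: "integrable M (objective \<mu> \<Lambda> y T)"
  unfolding objective_def
  by (intro Bochner_Integration.integrable_add Bochner_Integration.integrable_sum Bochner_Integration.integrable_diff
      integrable_mult_right integrable_f integrable_gpos integrable_spread) auto

text \<open>The pathwise bound applies to \<open>gap\<close>, whose mean exceeds the loss difference
  up to \<open>t powr (\<kappa> - 1)\<close>; the sum of these errors is the second summand of
  \<open>C\<^sub>s\<close>.\<close>

lemma expectation_objective_le:
  assumes T: "T \<ge> 1" and \<mu>: "\<mu> \<ge> 0" and \<Lambda>: "\<Lambda> \<ge> 0" and y: "y \<in> feasible_seqs X m g T"
  shows "expectation (objective \<mu> \<Lambda> y T)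
    \<le> C\<^sub>s \<Lambda> * (sqrt (real T) + real T powr \<kappa> + sqrt (real T) * path_length y T + \<mu>\<^sup>2 * (sqrt (real T) + real T powr (1 - \<kappa>)))"
proof -
  \<comment> \<open>\<open>y\<close> is arbitrary after round \<open>T\<close>, but the pathwise bound refers to \<open>y (T + 1)\<close>\<close>
  define y' where "y' t = y (min t T)" for t
  have y'_eq: "y' t = y t" if "t \<in> {1..T}" for t using that by (simp add: y'_def)
  have y'X: "y' t \<in> X" if "t \<ge> 1" for t
    using that T y unfolding y'_def feasible_seqs_def by auto
  define v where "v t = (1 - \<xi> t) *\<^sub>R y' t" for t
  have path: "(\<Sum>t=1..T. norm (y' (t + 1) - y' t)) = path_length y T"
  proof -
    have "(\<Sum>t=1..T. norm (y' (t + 1) - y' t)) = (\<Sum>t=1..<T. norm (y' (t + 1) - y' t)) + norm (y' (T + 1) - y' T)"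
      using T by (simp add: sum.last_plus add.commute)
    also have "(\<Sum>t=1..<T. norm (y' (t + 1) - y' t)) = path_length y T"
      unfolding path_length_def by (rule sum.cong) (auto simp: y'_def min_def)
    finally show ?thesis by (simp add: y'_def)
  qed
  let ?B = "sqrt (real T) + real T powr \<kappa> + sqrt (real T) * path_length y T + \<mu>\<^sup>2 * (sqrt (real T) + real T powr (1 - \<kappa>))"
  let ?K = "K\<^sub>\<xi> * (1 + M\<^sub>s * H)"
  define Z where "Z \<omega> = (\<Sum>t=1..T. \<Sum>i\<in>UNIV. gap i t (v t) \<omega> + \<mu> * (\<Sum>k<m i. gpos i t k (x i t \<omega>)))
      + (1 + \<mu>) * \<Lambda> * (\<Sum>t=1..T. spread (\<lambda>i. x i t \<omega>))" for \<omega>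
  have gap_ge: "integrable M (gap i t (v t))"
    "expectation (\<lambda>\<omega>. f i t (x i t \<omega>) - f i t (y t)) - ?K * real t powr (\<kappa> - 1) \<le> expectation (gap i t (v t))"
    if t: "t \<in> {1..T}" for i t
  proof -
    have t1: "t \<ge> 1" using t by simp
    have "g i t (y' t) k \<le> 0" if "k < m i" for k
      using y t that unfolding y'_eq[OF t] feasible_seqs_def by blast
    note expectation_gap_ge[OF t1 y'X[OF t1] this]
    then show "integrable M (gap i t (v t))"
      "expectation (\<lambda>\<omega>. f i t (x i t \<omega>) - f i t (y t)) - ?K * real t powr (\<kappa> - 1) \<le> expectation (gap i t (v t))"
      unfolding v_def by (simp_all only: y'_eq[OF t])
  qed
  have Z_le: "Z \<omega> \<le> C\<^sub>p \<Lambda> * ?B" if \<omega>: "\<omega> \<in> space M" for \<omega>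
  proof -
    have "run.v \<xi> y' t = v t" for t
      unfolding v_def by (rule run.v_def[OF run_at[OF \<omega>]]) (rule y'X)
    note v_eq = this
    show ?thesis
      unfolding Z_def path[symmetric] v_eq[symmetric] est_gap_eq_gap[OF \<omega>, symmetric]
      by (rule run.pathwise[OF run_at[OF \<omega>] _ T \<mu> \<Lambda>]) (rule y'X)
  qed
  have intZ: "integrable M Z"
    unfolding Z_def
    by (intro Bochner_Integration.integrable_add Bochner_Integration.integrable_sum integrable_mult_right
        integrable_gpos gap_ge integrable_spread) auto
  have EZ: "expectation Z \<le> C\<^sub>p \<Lambda> * ?B"
  proof -
    have "expectation Z \<le> expectation (\<lambda>_. C\<^sub>p \<Lambda> * ?B)"
      by (rule integral_mono[OF intZ]) (use Z_le in auto)
    then show ?thesis by (simp add: prob_space)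
  qed
  \<comment> \<open>The multiplier and disagreement terms are the same in both and cancel; only
    losses against \<open>gap\<close> are left.\<close>
  have "expectation (objective \<mu> \<Lambda> y T) - expectation Z = expectation (\<lambda>\<omega>. objective \<mu> \<Lambda> y T \<omega> - Z \<omega>)"
    using integrable_objective intZ by simp
  also have "\<dots> = expectation (\<lambda>\<omega>. \<Sum>t=1..T. \<Sum>i\<in>UNIV. (f i t (x i t \<omega>) - f i t (y t)) - gap i t (v t) \<omega>)"
    unfolding objective_def Z_def
    by (intro Bochner_Integration.integral_cong refl) (simp add: sum_subtractf[symmetric])
  also have "\<dots> = (\<Sum>t=1..T. \<Sum>i\<in>UNIV. expectation (\<lambda>\<omega>. f i t (x i t \<omega>) - f i t (y t)) - expectation (gap i t (v t)))"
  proof -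
    have int: "integrable M (\<lambda>\<omega>. f i t (x i t \<omega>) - f i t (y t))" if "t \<in> {1..T}" for i t
      using that by (intro Bochner_Integration.integrable_diff integrable_f) auto
    show ?thesis
      using int gap_ge(1)
      by (subst Bochner_Integration.integral_sum, (auto intro!: Bochner_Integration.integrable_sum Bochner_Integration.integrable_diff)[1])
        (intro sum.cong refl, subst Bochner_Integration.integral_sum, auto intro!: Bochner_Integration.integral_diff)
  qed
  also have "\<dots> \<le> (\<Sum>t=1..T. \<Sum>i\<in>(UNIV::'n set). ?K * real t powr (\<kappa> - 1))"
    using gap_ge(2) by (intro sum_mono) (simp add: algebra_simps)
  also have "\<dots> = real CARD('n) * ?K * (\<Sum>t=1..T. real t powr (\<kappa> - 1))"
    by (simp add: sum_distrib_left mult.assoc)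
  also have "\<dots> \<le> real CARD('n) * ?K * (real T powr \<kappa> / \<kappa>)"
    using F2_nonneg H_nonneg M\<^sub>s_nonneg X(4,5) \<kappa>
    by (intro mult_left_mono powr_sum_le mult_nonneg_nonneg) (auto simp: K\<^sub>\<xi>_def)
  also have "\<dots> \<le> real CARD('n) * ?K / \<kappa> * ?B"
  proof -
    have "real T powr \<kappa> \<le> ?B" by (simp add: path_length_def sum_nonneg)
    moreover have "0 \<le> real CARD('n) * ?K / \<kappa>"
      using F2_nonneg H_nonneg M\<^sub>s_nonneg X(4,5) \<kappa> by (simp add: K\<^sub>\<xi>_def)
    ultimately have "real CARD('n) * ?K / \<kappa> * real T powr \<kappa> \<le> real CARD('n) * ?K / \<kappa> * ?B"
      by (rule mult_left_mono)
    then show ?thesis by simp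
  qed
  finally show ?thesis using EZ unfolding C\<^sub>s_def distrib_right by linarith
qed

end

section \<open>Regret and constraint violation\<close>

context stochastic_run
begin

section \<open>From local to network-wide quantities\<close>

lemma f_transfer:
  assumes \<omega>: "\<omega> \<in> space M" and t: "t \<ge> 1"
  shows "f j t (x i t \<omega>) \<le> f j t (x j t \<omega>) + F2 * spread (\<lambda>i. x i t \<omega>)"
  using f_lipschitz[OF t x_in_X[OF \<omega> t, of i] x_in_X[OF \<omega> t, of j], of j]
    mult_left_mono[OF norm_diff_le_spread[of "\<lambda>i. x i t \<omega>" i j] F2_nonneg] by linarith

lemma gpos_transfer:
  assumes \<omega>: "\<omega> \<in> space M" and t: "t \<ge> 1" and k: "k < m j"
  shows "gpos j t k (x i t \<omega>) \<le> gpos j t k (x j t \<omega>) + F2 * spread (\<lambda>i. x i t \<omega>)"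
  using gpos_lipschitz[OF t k x_in_X[OF \<omega> t, of i] x_in_X[OF \<omega> t, of j]]
    mult_left_mono[OF norm_diff_le_spread[of "\<lambda>i. x i t \<omega>" i j] F2_nonneg] by linarith

text \<open>The analysis controls \<open>f j\<close> only at agent \<open>j\<close>'s own decision;
  moving it to the decision of agent \<open>i\<close> costs \<open>F2\<close> times the spread. The
  factor \<open>CARD('n)\<close> in \<open>\<Lambda>\<close> offsets the final division.\<close>

lemma net_reg_le_objective:
  assumes \<omega>: "\<omega> \<in> space M"
  shows "net_reg f (\<lambda>i t. x i t \<omega>) y T \<le> objective 0 (real CARD('n) * F2) y T \<omega> / real CARD('n)"
proof -
  let ?N = "real CARD('n)" and ?D = "\<lambda>t. spread (\<lambda>i. x i t \<omega>)"
  have avg: "avg_loss f t (x i t \<omega>) \<le> (\<Sum>j\<in>UNIV. f j t (x j t \<omega>)) / ?N + F2 * ?D t" if t: "t \<in> {1..T}" for i t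
  proof -
    have "(\<Sum>j\<in>UNIV. f j t (x i t \<omega>)) \<le> (\<Sum>j\<in>UNIV. f j t (x j t \<omega>) + F2 * ?D t)"
      using t by (intro sum_mono f_transfer \<omega>) auto
    also have "\<dots> = (\<Sum>j\<in>UNIV. f j t (x j t \<omega>)) + ?N * (F2 * ?D t)" by (simp add: sum.distrib)
    finally show ?thesis by (simp add: avg_loss_def field_simps)
  qed
  have "(\<Sum>i\<in>UNIV. \<Sum>t=1..T. avg_loss f t (x i t \<omega>))
      \<le> (\<Sum>i\<in>(UNIV::'n set). \<Sum>t=1..T. (\<Sum>j\<in>UNIV. f j t (x j t \<omega>)) / ?N + F2 * ?D t)"
    by (intro sum_mono avg)
  also have "\<dots> = ?N * (\<Sum>t=1..T. (\<Sum>j\<in>UNIV. f j t (x j t \<omega>)) / ?N + F2 * ?D t)" by simp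
  finally have "(1 / ?N) * (\<Sum>i\<in>UNIV. \<Sum>t=1..T. avg_loss f t (x i t \<omega>))
      \<le> (\<Sum>t=1..T. (\<Sum>j\<in>UNIV. f j t (x j t \<omega>)) / ?N + F2 * ?D t)"
    by (simp add: field_simps)
  moreover have "objective 0 (?N * F2) y T \<omega> / ?N
      = (\<Sum>t=1..T. (\<Sum>j\<in>UNIV. f j t (x j t \<omega>)) / ?N + F2 * ?D t) - (\<Sum>t=1..T. avg_loss f t (y t))"
    by (simp add: objective_def avg_loss_def sum_subtractf sum.distrib sum_divide_distrib[symmetric]
        sum_distrib_left[symmetric] add_divide_distrib diff_divide_distrib)
  ultimately show ?thesis unfolding net_reg_def by linarith
qed

text \<open>Euclidean norms are bounded by sums of entries, each transferred to its own agent. The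
  loss differences in \<open>objective\<close> may be negative, but not below \<open>- F1\<close>
  per agent and round.\<close>

lemma net_ccv_le_objective:
  assumes \<omega>: "\<omega> \<in> space M" and y: "\<And>t. t \<in> {1..T} \<Longrightarrow> y t \<in> X" and \<mu>: "\<mu> \<ge> 0"
  shows "\<mu> * net_ccv m g (\<lambda>i t. x i t \<omega>) T \<le> objective \<mu> (M\<^sub>s * F2) y T \<omega> + real CARD('n) * F1 * real T"
proof -
  let ?N = "real CARD('n)" and ?D = "\<lambda>t. spread (\<lambda>i. x i t \<omega>)"
  let ?g = "\<lambda>t. \<Sum>j\<in>UNIV. \<Sum>k<m j. gpos j t k (x j t \<omega>)"
  have pcn: "pos_constraint_norm m g t (x i t \<omega>) \<le> ?g t + M\<^sub>s * F2 * ?D t" if t: "t \<in> {1..T}" for i t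
  proof -
    have t1: "t \<ge> 1" using t by simp
    have "pos_constraint_norm m g t (x i t \<omega>) \<le> (\<Sum>(j, k)\<in>(SIGMA j:UNIV. {..<m j}). gpos j t k (x i t \<omega>))"
      unfolding pos_constraint_norm_def case_prod_unfold by (rule L2_set_le_sum) simp
    also have "\<dots> = (\<Sum>j\<in>UNIV. \<Sum>k<m j. gpos j t k (x i t \<omega>))"
      by (rule sum.Sigma[symmetric]) auto
    also have "\<dots> \<le> (\<Sum>j\<in>UNIV. \<Sum>k<m j. gpos j t k (x j t \<omega>) + F2 * ?D t)"
      by (intro sum_mono gpos_transfer \<omega> t1) auto
    also have "\<dots> = ?g t + M\<^sub>s * F2 * ?D t"
      by (simp add: sum.distrib M\<^sub>s_def sum_distrib_right mult.assoc)
    finally show ?thesis .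
  qed
  have "(\<Sum>i\<in>UNIV. \<Sum>t=1..T. pos_constraint_norm m g t (x i t \<omega>))
      \<le> (\<Sum>i\<in>(UNIV::'n set). \<Sum>t=1..T. ?g t + M\<^sub>s * F2 * ?D t)"
    by (intro sum_mono pcn)
  also have "\<dots> = ?N * (\<Sum>t=1..T. ?g t + M\<^sub>s * F2 * ?D t)" by simp
  finally have "net_ccv m g (\<lambda>i t. x i t \<omega>) T \<le> (\<Sum>t=1..T. ?g t + M\<^sub>s * F2 * ?D t)"
    by (simp add: net_ccv_def field_simps)
  then have "\<mu> * net_ccv m g (\<lambda>i t. x i t \<omega>) T \<le> \<mu> * (\<Sum>t=1..T. ?g t + M\<^sub>s * F2 * ?D t)"
    using \<mu> by (rule mult_left_mono)
  also have "\<dots> = (\<Sum>t=1..T. \<mu> * ?g t) + \<mu> * (M\<^sub>s * F2) * (\<Sum>t=1..T. ?D t)"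
    by (simp add: sum.distrib sum_distrib_left distrib_left mult.assoc)
  also have "\<mu> * (M\<^sub>s * F2) * (\<Sum>t=1..T. ?D t) \<le> (1 + \<mu>) * (M\<^sub>s * F2) * (\<Sum>t=1..T. ?D t)"
    using M\<^sub>s_nonneg F2_nonneg \<mu> by (intro mult_right_mono sum_nonneg spread_nonneg) auto
  also have "(\<Sum>t=1..T. \<mu> * ?g t) \<le> (\<Sum>t=1..T. (\<Sum>i\<in>UNIV. (f i t (x i t \<omega>) - f i t (y t)) + \<mu> * (\<Sum>k<m i. gpos i t k (x i t \<omega>))) + ?N * F1)"
  proof (rule sum_mono)
    fix t assume t: "t \<in> {1..T}"
    then have t1: "t \<ge> 1" by simp
    have "\<mu> * ?g t = (\<Sum>i\<in>UNIV. \<mu> * (\<Sum>k<m i. gpos i t k (x i t \<omega>)))" by (rule sum_distrib_left)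
    also have "\<dots> \<le> (\<Sum>i\<in>UNIV. (f i t (x i t \<omega>) - f i t (y t)) + \<mu> * (\<Sum>k<m i. gpos i t k (x i t \<omega>)) + F1)"
    proof (rule sum_mono)
      fix i
      show "\<mu> * (\<Sum>k<m i. gpos i t k (x i t \<omega>)) \<le> (f i t (x i t \<omega>) - f i t (y t)) + \<mu> * (\<Sum>k<m i. gpos i t k (x i t \<omega>)) + F1"
        using f_diff_le_F1[OF t1 x_in_X[OF \<omega> t1, of i] y[OF t], of i] by linarith
    qed
    also have "\<dots> = (\<Sum>i\<in>UNIV. (f i t (x i t \<omega>) - f i t (y t)) + \<mu> * (\<Sum>k<m i. gpos i t k (x i t \<omega>))) + ?N * F1"
      unfolding sum.distrib[of _ "\<lambda>_. F1"] by simp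
    finally show "\<mu> * ?g t \<le> (\<Sum>i\<in>UNIV. (f i t (x i t \<omega>) - f i t (y t)) + \<mu> * (\<Sum>k<m i. gpos i t k (x i t \<omega>))) + ?N * F1" .
  qed
  also have "\<dots> = (\<Sum>t=1..T. \<Sum>i\<in>UNIV. (f i t (x i t \<omega>) - f i t (y t)) + \<mu> * (\<Sum>k<m i. gpos i t k (x i t \<omega>))) + ?N * F1 * real T"
    unfolding sum.distrib[of _ "\<lambda>_. ?N * F1"] by simp
  finally show ?thesis unfolding objective_def by linarith
qed

lemma integrable_net_reg: "integrable M (\<lambda>\<omega>. net_reg f (\<lambda>i t. x i t \<omega>) y T)"
  unfolding net_reg_def avg_loss_def
  by (intro Bochner_Integration.integrable_diff Bochner_Integration.integrable_sum integrable_mult_right integrable_f) auto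

lemma integrable_net_ccv: "integrable M (\<lambda>\<omega>. net_ccv m g (\<lambda>i t. x i t \<omega>) T)"
proof -
  have "integrable M (\<lambda>\<omega>. pos_constraint_norm m g t (x i t \<omega>))" if t: "t \<in> {1..T}" for i t
  proof -
    let ?S = "SIGMA j:UNIV. {..<m j}"
    have t1: "t \<ge> 1" using t by simp
    have meas: "random_variable borel (\<lambda>\<omega>. gpos j t k (x i t \<omega>))" if "k < m j" for j k
      using integrable_gpos[OF t1 that, of i] by (rule borel_measurable_integrable)
    show ?thesis
    proof (rule Bochner_Integration.integrable_bound)
      show "integrable M (\<lambda>\<omega>. \<Sum>(j, k)\<in>?S. gpos j t k (x i t \<omega>))"
        by (intro Bochner_Integration.integrable_sum) (auto intro!: integrable_gpos t1)
      show "random_variable borel (\<lambda>\<omega>. pos_constraint_norm m g t (x i t \<omega>))"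
      proof -
        have [measurable]: "random_variable borel (\<lambda>\<omega>. \<Sum>(j, k)\<in>?S. (gpos j t k (x i t \<omega>))\<^sup>2)"
          by (intro borel_measurable_sum) (auto intro!: borel_measurable_power meas)
        have "random_variable borel (\<lambda>\<omega>. sqrt (\<Sum>(j, k)\<in>?S. (gpos j t k (x i t \<omega>))\<^sup>2))"
          by measurable
        then show ?thesis
          by (simp add: pos_constraint_norm_def L2_set_def case_prod_unfold)
      qed
      show "AE \<omega> in M. norm (pos_constraint_norm m g t (x i t \<omega>)) \<le> norm (\<Sum>(j, k)\<in>?S. gpos j t k (x i t \<omega>))"
      proof (rule AE_I2)
        fix \<omega>
        have "L2_set (\<lambda>(j, k). gpos j t k (x i t \<omega>)) ?S \<le> (\<Sum>(j, k)\<in>?S. gpos j t k (x i t \<omega>))"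
          unfolding case_prod_unfold by (rule L2_set_le_sum) simp
        then show "norm (pos_constraint_norm m g t (x i t \<omega>)) \<le> norm (\<Sum>(j, k)\<in>?S. gpos j t k (x i t \<omega>))"
          by (simp add: pos_constraint_norm_def)
      qed
    qed
  qed
  then show ?thesis
    unfolding net_ccv_def by (intro integrable_mult_right Bochner_Integration.integrable_sum) auto
qed

lemma expectation_net_reg_le:
  assumes T: "T \<ge> 1" and y: "y \<in> feasible_seqs X m g T"
  shows "expectation (\<lambda>\<omega>. net_reg f (\<lambda>i t. x i t \<omega>) y T)
    \<le> 2 * C\<^sub>s (real CARD('n) * F2) / real CARD('n) * (real T powr max \<kappa> (1/2) + sqrt (real T) * path_length y T)"
proof -
  let ?N = "real CARD('n)"
  let ?C = "C\<^sub>s (?N * F2)"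
  have C: "0 \<le> ?C" using F2_nonneg by (intro C\<^sub>s_nonneg) simp
  define e where "e = max \<kappa> (1/2)"
  have "expectation (\<lambda>\<omega>. net_reg f (\<lambda>i t. x i t \<omega>) y T) \<le> expectation (\<lambda>\<omega>. objective 0 (?N * F2) y T \<omega> / ?N)"
    using net_reg_le_objective integrable_net_reg integrable_objective by (intro integral_mono) auto
  also have "\<dots> = expectation (objective 0 (?N * F2) y T) / ?N" by simp
  also have "\<dots> \<le> ?C * (sqrt (real T) + real T powr \<kappa> + sqrt (real T) * path_length y T) / ?N"
    using expectation_objective_le[OF T order_refl _ y, of "?N * F2"] F2_nonneg by (intro divide_right_mono) auto
  also have "\<dots> \<le> ?C * (2 * (real T powr e + sqrt (real T) * path_length y T)) / ?N"
  proof (intro divide_right_mono mult_left_mono C)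
    have "sqrt (real T) \<le> real T powr e"
      unfolding powr_half_sqrt[symmetric, OF of_nat_0_le_iff] e_def using T by (intro powr_mono) auto
    moreover have "real T powr \<kappa> \<le> real T powr e" unfolding e_def using T by (intro powr_mono) auto
    moreover have "0 \<le> sqrt (real T) * path_length y T" by (simp add: path_length_def sum_nonneg)
    ultimately show "sqrt (real T) + real T powr \<kappa> + sqrt (real T) * path_length y T
      \<le> 2 * (real T powr e + sqrt (real T) * path_length y T)" unfolding distrib_left by linarith
  qed simp
  also have "\<dots> = 2 * ?C / ?N * (real T powr e + sqrt (real T) * path_length y T)" by simp
  finally show ?thesis unfolding e_def .
qed

text \<open>
  The multiplier \<open>\<mu> = T powr ((1 - a) / 2)\<close> with \<open>a = max (1 - \<kappa>) (1/2)\<close> balances the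
  dual cost \<open>\<mu>\<^sup>2 * T powr a\<close> against the regret, which is bounded below only by a multiple of \<open>- T\<close>.
\<close>

lemma expectation_net_ccv_le:
  assumes T: "T \<ge> 1" and y: "y \<in> feasible_static_seqs X m g T"
  shows "expectation (\<lambda>\<omega>. net_ccv m g (\<lambda>i t. x i t \<omega>) T)
    \<le> (4 * C\<^sub>s (M\<^sub>s * F2) + real CARD('n) * F1) * real T powr max (1 - \<kappa>/2) (3/4)"
proof -
  let ?C = "C\<^sub>s (M\<^sub>s * F2)" and ?N = "real CARD('n)"
  have \<Lambda>: "0 \<le> M\<^sub>s * F2" using M\<^sub>s_nonneg F2_nonneg by simp
  have C: "0 \<le> ?C" by (rule C\<^sub>s_nonneg[OF \<Lambda>])
  \<comment> \<open>A static comparator has path length 0, which removes the path term from the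
    bound.\<close>
  have y': "y \<in> feasible_seqs X m g T" and path: "path_length y T = 0"
    using y by (auto simp: feasible_static_seqs_def feasible_seqs_def path_length_def)
  define a where "a = max (1 - \<kappa>) (1/2)"
  define \<mu> where "\<mu> = real T powr ((1 - a) / 2)"
  have T1: "1 \<le> real T" using T by simp
  have a: "1/2 \<le> a" "1 - \<kappa> \<le> a" "a < 1" using \<kappa> by (auto simp: a_def)
  have \<mu>: "0 < \<mu>" using T by (simp add: \<mu>_def)
  \<comment> \<open>The multiplier is tuned so that the dual cost is of order \<open>T\<close>, like
    the lower bound on the loss differences.\<close>
  have \<mu>2: "\<mu>\<^sup>2 * real T powr a = real T"
    using T by (simp add: \<mu>_def power2_eq_square powr_add[symmetric])
  have sqrtT: "sqrt (real T) = real T powr (1/2)" by (simp add: powr_half_sqrt)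
  have "\<mu> * expectation (\<lambda>\<omega>. net_ccv m g (\<lambda>i t. x i t \<omega>) T) = expectation (\<lambda>\<omega>. \<mu> * net_ccv m g (\<lambda>i t. x i t \<omega>) T)"
    by simp
  also have "\<dots> \<le> expectation (\<lambda>\<omega>. objective \<mu> (M\<^sub>s * F2) y T \<omega> + ?N * F1 * real T)"
    using y' \<mu> integrable_net_ccv integrable_objective
    by (intro integral_mono net_ccv_le_objective) (auto simp: feasible_seqs_def)
  also have "\<dots> = expectation (objective \<mu> (M\<^sub>s * F2) y T) + ?N * F1 * real T"
    using integrable_objective by (simp add: prob_space)
  also have "expectation (objective \<mu> (M\<^sub>s * F2) y T) \<le> ?C * (sqrt (real T) + real T powr \<kappa> + \<mu>\<^sup>2 * (sqrt (real T) + real T powr (1 - \<kappa>)))"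
    using expectation_objective_le[OF T _ \<Lambda> y', of \<mu>] \<mu> by (simp add: path)
  \<comment> \<open>Rounding the regret part up to \<open>T\<close> loses nothing, since the term
    \<open>?N * F1 * real T\<close> already has that order.\<close>
  also have "\<dots> \<le> ?C * (real T + real T + \<mu>\<^sup>2 * (real T powr a + real T powr a))"
  proof (intro mult_left_mono add_mono C)
    show "sqrt (real T) \<le> real T" using powr_mono[of "1/2" 1 "real T"] T1 by (simp add: sqrtT)
    show "real T powr \<kappa> \<le> real T" using powr_mono[of \<kappa> 1 "real T"] T1 \<kappa> by simp
    show "sqrt (real T) \<le> real T powr a" unfolding sqrtT using T1 a by (intro powr_mono)
    show "real T powr (1 - \<kappa>) \<le> real T powr a" using T1 a by (intro powr_mono)
  qed simp
  also have "\<dots> = 4 * ?C * real T" using \<mu>2 by (simp add: algebra_simps)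
  finally have "\<mu> * expectation (\<lambda>\<omega>. net_ccv m g (\<lambda>i t. x i t \<omega>) T) \<le> (4 * ?C + ?N * F1) * real T"
    by (simp add: algebra_simps)
  then have "expectation (\<lambda>\<omega>. net_ccv m g (\<lambda>i t. x i t \<omega>) T) \<le> (4 * ?C + ?N * F1) * (real T / \<mu>)"
    using \<mu> by (simp add: field_simps)
  also have "real T / \<mu> = real T powr (1 - (1 - a) / 2)"
    using T by (simp add: \<mu>_def powr_diff)
  also have "1 - (1 - a) / 2 = max (1 - \<kappa>/2) (3/4)"
    by (auto simp: a_def max_def field_simps)
  finally show ?thesis .
qed

end

theorem corollary2:
  fixes X :: "(real ^ 'p) set"
    and m :: "'n::finite \<Rightarrow> nat"
    and f :: "'n \<Rightarrow> nat \<Rightarrow> real ^ 'p \<Rightarrow> real"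
    and g :: "'n \<Rightarrow> nat \<Rightarrow> real ^ 'p \<Rightarrow> nat \<Rightarrow> real"
    and E :: "nat \<Rightarrow> ('n \<times> 'n) set"
    and W :: "nat \<Rightarrow> real ^ 'n ^ 'n"
    and M :: "'w measure"
    and u :: "'n \<Rightarrow> nat \<Rightarrow> 'w \<Rightarrow> real ^ 'p"
    and x xh :: "'n \<Rightarrow> nat \<Rightarrow> 'w \<Rightarrow> real ^ 'p"
    and q :: "'n \<Rightarrow> nat \<Rightarrow> 'w \<Rightarrow> nat \<Rightarrow> real"
    and x1 :: "'n \<Rightarrow> real ^ 'p"
    and \<alpha> \<beta> \<gamma> \<tau> \<xi> \<delta> \<Psi> :: "nat \<Rightarrow> real"
    and r R F1 F2 w c \<kappa> :: real
    and B :: nat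
  assumes "convex_problem_assm X r R m f g F1 F2"
    and "network_assm E W w B"
    and "feasibility_assm X m g"
    and "c > 1" and "0 < \<kappa>" and "\<kappa> < 1"
    and "\<And>t. t \<ge> 1 \<Longrightarrow> \<tau> t = 1 / c ^ t"
    and "\<And>t. t \<ge> 1 \<Longrightarrow> \<Psi> t = (\<Sum>k=1..t. \<tau> k)"
    and "\<And>t. t \<ge> 1 \<Longrightarrow> \<alpha> t = sqrt (\<Psi> t / real t)"
    and "\<And>t. t \<ge> 1 \<Longrightarrow> \<beta> t = 1 / real t powr \<kappa>"
    and "\<And>t. t \<ge> 1 \<Longrightarrow> \<gamma> t = 1 / real t powr (1 - \<kappa>)"
    and "\<And>t. t \<ge> 1 \<Longrightarrow> \<xi> t = 1 / (real t + 1)"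
    and "\<And>t. t \<ge> 1 \<Longrightarrow> \<delta> t = r / (real t + 1)"
    and "indep_sphere_draws M u"
    and "\<And>\<omega>. \<omega> \<in> space M \<Longrightarrow>
           algorithm_run X m f g W \<alpha> \<beta> \<gamma> \<tau> \<xi> \<delta> x1
             (\<lambda>i t. u i t \<omega>) (\<lambda>i t. x i t \<omega>) (\<lambda>i t. xh i t \<omega>) (\<lambda>i t. q i t \<omega>)"
  shows "(\<exists>C. \<forall>T\<ge>1. \<forall>y\<in>feasible_seqs X m g T.
            integrable M (\<lambda>\<omega>. net_reg f (\<lambda>i t. x i t \<omega>) y T) \<and>
            prob_space.expectation M (\<lambda>\<omega>. net_reg f (\<lambda>i t. x i t \<omega>) y T)
              \<le> C * (real T powr max \<kappa> (1/2) + sqrt (real T) * path_length y T)) \<and>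
         (\<exists>C. \<forall>T\<ge>1.
            integrable M (\<lambda>\<omega>. net_ccv m g (\<lambda>i t. x i t \<omega>) T) \<and>
            prob_space.expectation M (\<lambda>\<omega>. net_ccv m g (\<lambda>i t. x i t \<omega>) T)
              \<le> C * real T powr max (1 - \<kappa>/2) (3/4))"
proof -
  interpret stochastic_run E W w B X r R m f g F1 F2 c \<kappa> \<alpha> \<beta> \<gamma> \<tau> \<xi> \<delta> \<Psi> M u x xh q x1
    using assms by unfold_locales auto
  \<comment> \<open>The violation bound mentions no comparator, but its proof compares with a static
    feasible point, which the feasibility assumption provides for each \<open>T\<close>.\<close>
  have static: "\<exists>y. y \<in> feasible_static_seqs X m g T" if "T \<ge> 1" for T
    using assms(3) that by (auto simp: feasibility_assm_def)
  show ?thesis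
    using integrable_net_reg expectation_net_reg_le integrable_net_ccv expectation_net_ccv_le static
    by (intro conjI exI allI impI ballI; fast)
qed

end
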